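(* Let $G$ be a countable discrete group equipped with a left-invariant proper metric, acting on itself ($X=G$) by left multiplication, and consider the corresponding $G$-equivariant cohomologies. The following are equivalent: (1) $G$ is amenable. (2) $[\mathbf 1_Q]\in\operatorname{Im}\bigl(\pi_*:H_Q^0(G,\ell^1(G))\to H_Q^0(G,\mathbb C)\bigr)$. (3) $D[\mathbf 1_Q]=0$ in $H_Q^1(G,\ell^1_0(G))$. (4) $D[\mathbf 1_W]=0$ in $H_W^1(G,\ell^1_0(G))$.
   Context: **Modules.** Put $X=G$ with the given metric and the action of $G$ by left multiplication. A $G$-equivariant $X$-module is a triple $\mathcal V=(V,\|\cdot\|_V,\mathrm{Supp})$ with $(V,\|\cdot\|_V)$ a Banach space with an isometric linear $G$-action and $\mathrm{Supp}$ a function from $V$ to subsets of $X$ such that: $\mathrm{Supp}(0)=\emptyset$; $\mathrm{Supp}(v+w)\subseteq\mathrm{Supp}(v)\cup\mathrm{Supp}(w)$; $\mathrm{Supp}(\lambda v)=\mathrm{Supp}(v)$ for $\lambda\neq0$; if $v_n\to v$ then $\mathrm{Supp}(v)\subseteq\bigcup_n\mathrm{Supp}(v_n)$; and $g\,\mathrm{Supp}(v)=\mathrm{Supp}(gv)$. The modules used here are: $\ell^1(G)$ and its closed subspace $\ell^1_0(G)=\{f:\sum_g f(g)=0\}$, both with the left translation action and $\mathrm{Supp}(f)=\{g: f(g)\ne0\}$; and $\mathbb C$ with trivial action and $\mathrm{Supp}(\lambda)=\emptyset$ for all $\lambda$. Let $\iota:\ell^1_0(G)\to\ell^1(G)$ be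 the inclusion and $\pi:\ell^1(G)\to\mathbb C$, $\pi(f)=\sum_g f(g)$. **Bicomplex.** For $R>0$ let $\Delta_R^{p+1}=\{\mathbf x=(x_0,\dots,x_p)\in X^{p+1}: d(x_i,x_j)\le R\ \forall i,j\}$ and let $\Delta_R^{p+1,q+1}$ be the set of $(\mathbf x,\mathbf y)\in X^{p+1}\times X^{q+1}$ all of whose coordinates $x_0,\dots,x_p,y_0,\dots,y_q$ are pairwise at distance $\le R$. A function $\phi:X^{p+1}\times X^{q+1}\to V$ is of controlled supports if for every $R>0$ there is $S>0$ such that for $(\mathbf x,\mathbf y)\in\Delta_R^{p+1,q+1}$ the set $\mathrm{Supp}(\phi(\mathbf x,\mathbf y))$ is contained in the balls $B_S(x_i)$ and $B_S(y_j)$ for all $i,j$; it is equivariant if $g(\phi(\mathbf x,\mathbf y))=\phi(g\mathbf x,g\mathbf y)$ for all $g\in G$ (diagonal actions). Put $\|\phi\|_R=\sup_{\mathbf x\in\Delta_R^{p+1},\,\mathbf y\in X^{q+1}}\|\phi(\mathbf x,\mathbf y)\|_V$. For $p,q\ge 0$, $\mathcal E^{p,q}(G,\mathcal V)$ is the space of equivariant functions $\phi:X^{p+1}\times X^{q+1}\to V$ of controlled supports with $\|\phi\|_R<\infty$ for all $R>0$, topologised by the seminorms $\|\cdot\|_R$, $R\in\mathbb N$. The continuous anticommuting differentials $D:\mathcal E^{p,q}\to\mathcal E^{p+1,q}$ and $d:\mathcal E^{p,q}\to\mathcal E^{p,q+1}$ are $D\phi((x_0,\dots,x_{p+1}),\mathbf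 y)=\sum_{i=0}^{p+1}(-1)^i\phi((x_0,\dots,\widehat{x_i},\dots,x_{p+1}),\mathbf y)$ and $d\phi(\mathbf x,(y_0,\dots,y_{q+1}))=\sum_{i=0}^{q+1}(-1)^{i+p}\phi(\mathbf x,(y_0,\dots,\widehat{y_i},\dots,y_{q+1}))$. **Completions.** For a vector space $\mathcal E$ with an increasing countable family of seminorms $\|\cdot\|_i$ separating points: the quotient completion $\mathcal E_Q$ is the space of sequences in $\mathcal E$ bounded for every seminorm, modulo sequences converging to 0 for every seminorm. For $\alpha$ in the continuous dual $\mathcal E^*$ put $\|\alpha\|^i=\sup\{|\alpha(\phi)|:\|\phi\|_i\le1\}\in[0,\infty]$. The weak-* completion $\mathcal E_W=\mathcal E^{**}$ is the space of linear functionals $\eta$ on $\mathcal E^*$ with $\sup\{|\eta(\alpha)|:\|\alpha\|^i\le1\}<\infty$ for every $i$, with the weak-* topology. $I_Q:\mathcal E\to\mathcal E_Q$ (constant sequences) and $I_W:\mathcal E\to\mathcal E_W$ (evaluation) are the canonical inclusions. Continuous linear maps extend termwise to $\mathcal E_Q$ and by double transpose to $\mathcal E_W$, denoted by the same symbols. Write $\mathcal E_Q^{p,q},\mathcal E_W^{p,q}$ for the completions of $\mathcal E^{p,q}$. **Cohomology.** For $\sim\,\in\{Q,W\}$, $H_\sim^*(G,\mathcal V)$ is the cohomology of the totalisation (degree $n$ part $\bigoplus_{p+q=n,\ p,q\ge0}\mathcal E_\sim^{p,q}(G,\mathcal V)$, differential $D+d$). The short exact sequence $0\to\ell^1_0(G)\xrightarrow{\iota}\ell^1(G)\xrightarrow{\pi}\mathbb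 C\to0$ induces short exact sequences of the bicomplexes $\mathcal E_\sim^{*,*}$, hence a long exact sequence; $\pi_*$ is the induced map and $D:H_\sim^0(G,\mathbb C)\to H_\sim^1(G,\ell^1_0(G))$ also denotes its connecting homomorphism. $[\mathbf 1_Q]\in H_Q^0(G,\mathbb C)$ and $[\mathbf 1_W]\in H_W^0(G,\mathbb C)$ are the classes of $I_Q\mathbf 1$, $I_W\mathbf 1$, where $\mathbf 1\in\mathcal E^{0,0}(G,\mathbb C)$ is the constant function 1. *)

theory Defs
  imports
    "HOL-Analysis.Analysis"
    "HOL-Algebra.Coset"
    "HOL-Algebra.Product_Groups"
    "HOL-Library.Function_Algebras"
begin

section \<open>Complex vector spaces of functions\<close>

class complex_vector = ab_group_add +
  fixes scaleC :: "complex \<Rightarrow> 'a \<Rightarrow> 'a" (infixr "*\<^sub>C" 75)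
  assumes scaleC_add_right: "a *\<^sub>C (x + y) = a *\<^sub>C x + a *\<^sub>C y"
    and scaleC_add_left: "(a + b) *\<^sub>C x = a *\<^sub>C x + b *\<^sub>C x"
    and scaleC_scaleC: "a *\<^sub>C (b *\<^sub>C x) = (a * b) *\<^sub>C x"
    and scaleC_one: "1 *\<^sub>C x = x"

instantiation complex :: complex_vector
begin
definition scaleC_complex_def: "a *\<^sub>C (x::complex) = a * x"
instance by standard (auto simp: scaleC_complex_def algebra_simps)
end

instantiation "fun" :: (type, complex_vector) complex_vector
begin
definition scaleC_fun_def: "a *\<^sub>C f = (\<lambda>x. a *\<^sub>C f x)"
instance
  by standard
    (auto simp: scaleC_fun_def plus_fun_def scaleC_add_right scaleC_add_left scaleC_scaleC scaleC_one)
end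

definition csubspace :: "'a::complex_vector set \<Rightarrow> bool" where
  "csubspace E \<longleftrightarrow> 0 \<in> E \<and> (\<forall>u\<in>E. \<forall>v\<in>E. u + v \<in> E) \<and> (\<forall>c. \<forall>u\<in>E. c *\<^sub>C u \<in> E)"

definition clinear_on :: "'a::complex_vector set \<Rightarrow> ('a \<Rightarrow> 'b::complex_vector) \<Rightarrow> bool" where
  "clinear_on E T \<longleftrightarrow>
     (\<forall>u\<in>E. \<forall>v\<in>E. T (u + v) = T u + T v) \<and> (\<forall>c. \<forall>u\<in>E. T (c *\<^sub>C u) = c *\<^sub>C T u)"

section \<open>Amenability\<close>

text \<open>Groups are written additively but are not assumed commutative (class \<^class>\<open>group_add\<close>), so
  left translation by \<open>g\<close> is \<open>x \<mapsto> g + x\<close>. A group is amenable if the bounded real functions on it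
  carry a left-invariant mean; the values of \<open>m\<close> at unbounded functions are irrelevant.\<close>

definition invariant_mean :: "(('g::group_add \<Rightarrow> real) \<Rightarrow> real) \<Rightarrow> bool" where
  "invariant_mean m \<longleftrightarrow>
     (\<forall>f h. bounded (range f) \<longrightarrow> bounded (range h) \<longrightarrow> m (\<lambda>x. f x + h x) = m f + m h) \<and>
     (\<forall>c f. bounded (range f) \<longrightarrow> m (\<lambda>x. c * f x) = c * m f) \<and>
     (\<forall>f. bounded (range f) \<longrightarrow> (\<forall>x. 0 \<le> f x) \<longrightarrow> 0 \<le> m f) \<and>
     m (\<lambda>x. 1) = 1 \<and>
     (\<forall>g f. bounded (range f) \<longrightarrow> m (\<lambda>x. f (g + x)) = m f)"

definition amenable :: "'g::group_add itself \<Rightarrow> bool" where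
  "amenable _ \<longleftrightarrow> (\<exists>m :: ('g \<Rightarrow> real) \<Rightarrow> real. invariant_mean m)"

section \<open>Equivariant modules over the group\<close>

record ('g, 'v) xmodule =
  vcarrier :: "'v set"
  vnorm :: "'v \<Rightarrow> real"
  vact :: "'g \<Rightarrow> 'v \<Rightarrow> 'v"
  vsupp :: "'v \<Rightarrow> 'g set"

locale equivariant_module =
  fixes V :: "('g::group_add, 'v::complex_vector) xmodule"
  assumes subspace: "csubspace (vcarrier V)"
    and norm_nonneg: "v \<in> vcarrier V \<Longrightarrow> 0 \<le> vnorm V v"
    and norm_eq_0: "v \<in> vcarrier V \<Longrightarrow> vnorm V v = 0 \<Longrightarrow> v = 0"
    and norm_scale: "v \<in> vcarrier V \<Longrightarrow> vnorm V (c *\<^sub>C v) = cmod c * vnorm V v"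
    and norm_triangle: "v \<in> vcarrier V \<Longrightarrow> w \<in> vcarrier V \<Longrightarrow> vnorm V (v + w) \<le> vnorm V v + vnorm V w"
    and complete:
      "(\<And>n. u n \<in> vcarrier V) \<Longrightarrow> (\<forall>e>0. \<exists>N. \<forall>m\<ge>N. \<forall>n\<ge>N. vnorm V (u m - u n) < e) \<Longrightarrow>
        \<exists>v\<in>vcarrier V. (\<lambda>n. vnorm V (u n - v)) \<longlonglongrightarrow> 0"
    and act_closed: "v \<in> vcarrier V \<Longrightarrow> vact V g v \<in> vcarrier V"
    and act_zero: "v \<in> vcarrier V \<Longrightarrow> vact V 0 v = v"
    and act_add: "v \<in> vcarrier V \<Longrightarrow> vact V (g + h) v = vact V g (vact V h v)"
    and act_linear: "clinear_on (vcarrier V) (vact V g)"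
    and act_isometric: "v \<in> vcarrier V \<Longrightarrow> vnorm V (vact V g v) = vnorm V v"
    and supp_zero: "vsupp V 0 = {}"
    and supp_add: "v \<in> vcarrier V \<Longrightarrow> w \<in> vcarrier V \<Longrightarrow> vsupp V (v + w) \<subseteq> vsupp V v \<union> vsupp V w"
    and supp_scale: "v \<in> vcarrier V \<Longrightarrow> c \<noteq> 0 \<Longrightarrow> vsupp V (c *\<^sub>C v) = vsupp V v"
    and supp_limit:
      "(\<And>n. u n \<in> vcarrier V) \<Longrightarrow> v \<in> vcarrier V \<Longrightarrow> (\<lambda>n. vnorm V (u n - v)) \<longlonglongrightarrow> 0 \<Longrightarrow>
        vsupp V v \<subseteq> (\<Union>n. vsupp V (u n))"
    and supp_act: "v \<in> vcarrier V \<Longrightarrow> (\<lambda>x. g + x) ` vsupp V v = vsupp V (vact V g v)"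

definition ell1 :: "('g::group_add, 'g \<Rightarrow> complex) xmodule" where
  "ell1 = \<lparr>vcarrier = {f. (\<lambda>x. cmod (f x)) summable_on UNIV},
           vnorm = (\<lambda>f. \<Sum>\<^sub>\<infinity>x. cmod (f x)),
           vact = (\<lambda>g f x. f (- g + x)),
           vsupp = (\<lambda>f. {x. f x \<noteq> 0})\<rparr>"

definition ell1_sum :: "('g \<Rightarrow> complex) \<Rightarrow> complex" where
  "ell1_sum f = (\<Sum>\<^sub>\<infinity>x. f x)"

definition ell1_0 :: "('g::group_add, 'g \<Rightarrow> complex) xmodule" where
  "ell1_0 = ell1\<lparr>vcarrier := {f \<in> vcarrier ell1. ell1_sum f = 0}\<rparr>"

definition ell1_incl :: "('g \<Rightarrow> complex) \<Rightarrow> ('g \<Rightarrow> complex)" where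
  "ell1_incl f = f"

definition trivial_module :: "('g::group_add, complex) xmodule" where
  "trivial_module = \<lparr>vcarrier = UNIV, vnorm = cmod, vact = (\<lambda>g v. v), vsupp = (\<lambda>v. {})\<rparr>"

lemma ell1_sel [simp]:
  "vcarrier ell1 = {f. (\<lambda>x. cmod (f x)) summable_on UNIV}"
  "vnorm ell1 = (\<lambda>f. \<Sum>\<^sub>\<infinity>x. cmod (f x))"
  "vact ell1 = (\<lambda>g f x. f (- g + x))"
  "vsupp ell1 = (\<lambda>f. {x. f x \<noteq> 0})"
  by (auto simp: ell1_def)

lemma ell1_0_sel [simp]:
  "vcarrier ell1_0 = {f \<in> vcarrier ell1. ell1_sum f = 0}"
  "vnorm ell1_0 = vnorm ell1" "vact ell1_0 = vact ell1" "vsupp ell1_0 = vsupp ell1"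
  by (auto simp: ell1_0_def ell1_def)

lemma trivial_module_sel [simp]:
  "vcarrier trivial_module = UNIV" "vnorm trivial_module = cmod"
  "vact trivial_module = (\<lambda>g v. v)" "vsupp trivial_module = (\<lambda>v. {})"
  by (auto simp: trivial_module_def)

lemma translate_bij: "bij (\<lambda>x. - g + x :: 'g::group_add)"
  by (rule bijI') (auto, metis add.assoc add.left_neutral left_minus)

lemma ell1_add:
  fixes f h :: "'g \<Rightarrow> complex"
  assumes f: "(\<lambda>x. cmod (f x)) summable_on UNIV" and h: "(\<lambda>x. cmod (h x)) summable_on UNIV"
  shows "(\<lambda>x. cmod (f x + h x)) summable_on UNIV"
    and "(\<Sum>\<^sub>\<infinity>x. cmod (f x + h x)) \<le> (\<Sum>\<^sub>\<infinity>x. cmod (f x)) + (\<Sum>\<^sub>\<infinity>x. cmod (h x))"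
proof -
  have s: "(\<lambda>x. cmod (f x) + cmod (h x)) summable_on UNIV"
    by (intro summable_on_add f h)
  show t: "(\<lambda>x. cmod (f x + h x)) summable_on UNIV"
    by (rule summable_on_comparison_test[OF s]) (auto intro: norm_triangle_ineq)
  have "(\<Sum>\<^sub>\<infinity>x. cmod (f x + h x)) \<le> (\<Sum>\<^sub>\<infinity>x. cmod (f x) + cmod (h x))"
    by (rule infsum_mono[OF t s]) (auto intro: norm_triangle_ineq)
  also have "\<dots> = (\<Sum>\<^sub>\<infinity>x. cmod (f x)) + (\<Sum>\<^sub>\<infinity>x. cmod (h x))"
    by (rule infsum_add[OF f h])
  finally show "(\<Sum>\<^sub>\<infinity>x. cmod (f x + h x)) \<le> (\<Sum>\<^sub>\<infinity>x. cmod (f x)) + (\<Sum>\<^sub>\<infinity>x. cmod (h x))" .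
qed

lemma ell1_diff:
  fixes f h :: "'g \<Rightarrow> complex"
  assumes "(\<lambda>x. cmod (f x)) summable_on UNIV" and "(\<lambda>x. cmod (h x)) summable_on UNIV"
  shows "(\<lambda>x. cmod (f x - h x)) summable_on UNIV"
  using ell1_add(1)[OF assms(1), of "\<lambda>x. - h x"] assms(2) by simp

lemma ell1_pointwise:
  fixes f :: "'g \<Rightarrow> complex"
  assumes "(\<lambda>x. cmod (f x)) summable_on UNIV"
  shows "cmod (f x) \<le> (\<Sum>\<^sub>\<infinity>x. cmod (f x))"
  using finite_sum_le_infsum[OF assms, of "{x}"] by simp

lemma ell1_complete:
  fixes u :: "nat \<Rightarrow> 'g \<Rightarrow> complex"
  assumes u: "\<And>n. (\<lambda>x. cmod (u n x)) summable_on UNIV"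
    and cauchy: "\<forall>e>0. \<exists>N. \<forall>m\<ge>N. \<forall>n\<ge>N. (\<Sum>\<^sub>\<infinity>x. cmod (u m x - u n x)) < e"
  shows "\<exists>v. (\<lambda>x. cmod (v x)) summable_on UNIV \<and> (\<lambda>n. \<Sum>\<^sub>\<infinity>x. cmod (u n x - v x)) \<longlonglongrightarrow> 0"
proof -
  note ud = ell1_diff[OF u u]
  have "Cauchy (\<lambda>n. u n x)" for x
  proof (rule metric_CauchyI)
    fix e :: real assume "e > 0"
    then obtain N where N: "\<forall>m\<ge>N. \<forall>n\<ge>N. (\<Sum>\<^sub>\<infinity>x. cmod (u m x - u n x)) < e"
      using cauchy by blast
    show "\<exists>M. \<forall>m\<ge>M. \<forall>n\<ge>M. dist (u m x) (u n x) < e"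
      using N le_less_trans[OF ell1_pointwise[OF ud]] unfolding dist_norm by blast
  qed
  then have "\<forall>x. \<exists>l. (\<lambda>n. u n x) \<longlonglongrightarrow> l"
    by (auto simp: Cauchy_convergent_iff convergent_def)
  then obtain v where v: "\<And>x. (\<lambda>n. u n x) \<longlonglongrightarrow> v x" by metis
  have key: "\<exists>N. \<forall>n\<ge>N. (\<lambda>x. cmod (u n x - v x)) summable_on UNIV \<and>
      (\<Sum>\<^sub>\<infinity>x. cmod (u n x - v x)) \<le> e" if e: "e > 0" for e
  proof -
    from e obtain N where N: "\<forall>m\<ge>N. \<forall>n\<ge>N. (\<Sum>\<^sub>\<infinity>x. cmod (u m x - u n x)) < e"
      using cauchy by blast
    show ?thesis
    proof (intro exI[of _ N] allI impI)
      fix n assume n: "n \<ge> N"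
      have fin: "(\<Sum>x\<in>F. cmod (u n x - v x)) \<le> e" if F: "finite F" for F
      proof (rule LIMSEQ_le_const2)
        show "(\<lambda>m. \<Sum>x\<in>F. cmod (u n x - u m x)) \<longlonglongrightarrow> (\<Sum>x\<in>F. cmod (u n x - v x))"
          by (intro tendsto_intros v)
        have "(\<Sum>x\<in>F. cmod (u n x - u m x)) \<le> e" if "m \<ge> N" for m
          using finite_sum_le_infsum[OF ud, of F n m] F N n that by force
        then show "\<exists>M. \<forall>m\<ge>M. (\<Sum>x\<in>F. cmod (u n x - u m x)) \<le> e" by blast
      qed
      have s: "(\<lambda>x. cmod (u n x - v x)) summable_on UNIV"
        by (rule nonneg_bdd_above_summable_on) (auto intro!: bdd_aboveI2 fin)
      moreover have "(\<Sum>\<^sub>\<infinity>x. cmod (u n x - v x)) \<le> e"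
        by (rule infsum_le_finite_sums[OF s]) (auto intro: fin)
      ultimately show "(\<lambda>x. cmod (u n x - v x)) summable_on UNIV \<and>
          (\<Sum>\<^sub>\<infinity>x. cmod (u n x - v x)) \<le> e" by blast
    qed
  qed
  obtain N where "(\<lambda>x. cmod (u N x - v x)) summable_on UNIV" using key[of 1] by auto
  from ell1_diff[OF u[of N] this] have vs: "(\<lambda>x. cmod (v x)) summable_on UNIV" by simp
  have "(\<lambda>n. \<Sum>\<^sub>\<infinity>x. cmod (u n x - v x)) \<longlonglongrightarrow> 0"
  proof (rule LIMSEQ_I)
    fix r :: real assume "r > 0"
    then obtain N where "\<forall>n\<ge>N. (\<Sum>\<^sub>\<infinity>x. cmod (u n x - v x)) \<le> r / 2" using key[of "r/2"] by auto
    then show "\<exists>no. \<forall>n\<ge>no. norm ((\<Sum>\<^sub>\<infinity>x. cmod (u n x - v x)) - 0) < r"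
      using \<open>r > 0\<close> by (intro exI[of _ N]) (force simp: abs_of_nonneg infsum_nonneg)
  qed
  with vs show ?thesis by blast
qed

lemma ell1_sum_add:
  assumes "f \<in> vcarrier ell1" "h \<in> vcarrier ell1"
  shows "ell1_sum (f + h) = ell1_sum f + ell1_sum h"
  using assms by (auto simp: ell1_sum_def plus_fun_def intro!: infsum_add abs_summable_summable)

lemma ell1_sum_scale: "ell1_sum (c *\<^sub>C f) = c * ell1_sum f"
  by (simp add: ell1_sum_def scaleC_fun_def scaleC_complex_def infsum_cmult_right')

lemma ell1_sum_translate:
  fixes f :: "'g::group_add \<Rightarrow> complex"
  shows "ell1_sum (vact ell1 g f) = ell1_sum f"
  unfolding ell1_sum_def ell1_sel by (rule infsum_reindex_bij_betw[OF translate_bij])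

lemma ell1_sum_bound: "f \<in> vcarrier ell1 \<Longrightarrow> cmod (ell1_sum f) \<le> vnorm ell1 f"
  by (auto simp: ell1_sum_def intro: norm_infsum_bound)

lemma ell1_module: "equivariant_module (ell1 :: ('g::group_add, 'g \<Rightarrow> complex) xmodule)"
proof
  show "csubspace (vcarrier (ell1 :: ('g, 'g \<Rightarrow> complex) xmodule))"
    by (auto simp: csubspace_def plus_fun_def zero_fun_def scaleC_fun_def scaleC_complex_def
        norm_mult intro: ell1_add summable_on_cmult_right)
next
  fix u :: "nat \<Rightarrow> 'g \<Rightarrow> complex"
  assume "\<And>n. u n \<in> vcarrier ell1"
    and "\<forall>e>0. \<exists>N. \<forall>m\<ge>N. \<forall>n\<ge>N. vnorm ell1 (u m - u n) < e"
  then show "\<exists>v\<in>vcarrier ell1. (\<lambda>n. vnorm ell1 (u n - v)) \<longlonglongrightarrow> 0"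
    using ell1_complete[of u] by auto
next
  fix u :: "nat \<Rightarrow> 'g \<Rightarrow> complex" and v
  assume u: "\<And>n. u n \<in> vcarrier ell1" and v: "v \<in> vcarrier ell1"
    and lim: "(\<lambda>n. vnorm ell1 (u n - v)) \<longlonglongrightarrow> 0"
  show "vsupp ell1 v \<subseteq> (\<Union>n. vsupp ell1 (u n))"
  proof
    fix x assume x: "x \<in> vsupp ell1 v"
    show "x \<in> (\<Union>n. vsupp ell1 (u n))"
    proof (rule ccontr)
      assume "x \<notin> (\<Union>n. vsupp ell1 (u n))"
      then have 0: "u n x = 0" for n by auto
      have "cmod (u n x - v x) \<le> vnorm ell1 (u n - v)" for n
        using ell1_pointwise[OF ell1_diff, of "u n" v x] u[of n] v by simp
      then have "cmod (v x) \<le> vnorm ell1 (u n - v)" for n by (simp add: 0 del: ell1_sel)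
      then have "cmod (v x) \<le> 0" by (intro LIMSEQ_le_const[OF lim]) blast
      with x show False by simp
    qed
  qed
next
  fix v :: "'g \<Rightarrow> complex" assume v: "v \<in> vcarrier ell1" and 0: "vnorm ell1 v = 0"
  have "cmod (v x) \<le> 0" for x using ell1_pointwise[of v x] v 0 by simp
  then show "v = 0" by (auto simp: fun_eq_iff)
next
  fix v :: "'g \<Rightarrow> complex" and g assume v: "v \<in> vcarrier ell1"
  show "vact ell1 g v \<in> vcarrier ell1"
    using v summable_on_reindex_bij_betw[OF translate_bij, of "\<lambda>x. cmod (v x)" g] by simp
  show "vnorm ell1 (vact ell1 g v) = vnorm ell1 v"
    using infsum_reindex_bij_betw[OF translate_bij, of "\<lambda>x. cmod (v x)" g] by simp
  show "(\<lambda>x. g + x) ` vsupp ell1 v = vsupp ell1 (vact ell1 g v)"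
  proof -
    have "x \<in> (\<lambda>x. g + x) ` vsupp ell1 v" if "v (- g + x) \<noteq> 0" for x
      using that by (intro image_eqI[of _ _ "- g + x"]) (auto simp: add.assoc[symmetric])
    then show ?thesis by (auto simp: add.assoc[symmetric])
  qed
next
  fix v :: "'g \<Rightarrow> complex" and g h assume v: "v \<in> vcarrier ell1"
  show "vact ell1 (g + h) v = vact ell1 g (vact ell1 h v)"
    by (simp add: minus_add flip: add.assoc add_uminus_conv_diff)
qed (auto simp: zero_fun_def plus_fun_def infsum_nonneg scaleC_fun_def scaleC_complex_def norm_mult infsum_cmult_right'
      clinear_on_def fun_eq_iff intro!: ell1_add)

lemma ell1_0_module: "equivariant_module (ell1_0 :: ('g::group_add, 'g \<Rightarrow> complex) xmodule)"
proof -
  interpret L: equivariant_module "ell1 :: ('g, 'g \<Rightarrow> complex) xmodule" by (rule ell1_module)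
  note [simp del] = ell1_sel
  have sub: "csubspace (vcarrier (ell1 :: ('g, 'g \<Rightarrow> complex) xmodule))" by (rule L.subspace)
  have s0: "ell1_sum (0 :: 'g \<Rightarrow> complex) = 0" by (simp add: ell1_sum_def)
  have diff: "f - h \<in> vcarrier ell1 \<and> ell1_sum (f - h) = ell1_sum f - ell1_sum h"
    if "f \<in> vcarrier ell1" "h \<in> vcarrier ell1" for f h :: "'g \<Rightarrow> complex"
  proof -
    have eq: "f - h = f + (-1) *\<^sub>C h" by (simp add: fun_eq_iff scaleC_fun_def scaleC_complex_def)
    have h: "(-1) *\<^sub>C h \<in> vcarrier ell1" using that sub unfolding csubspace_def by blast
    have "f - h \<in> vcarrier ell1" using that h sub unfolding eq csubspace_def by blast
    moreover have "ell1_sum (f - h) = ell1_sum f - ell1_sum h"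
      unfolding eq ell1_sum_add[OF that(1) h] ell1_sum_scale by simp
    ultimately show ?thesis ..
  qed
  show ?thesis
  proof
    show "csubspace (vcarrier (ell1_0 :: ('g, 'g \<Rightarrow> complex) xmodule))"
      using sub by (simp add: csubspace_def s0 ell1_sum_add ell1_sum_scale)
    show "clinear_on (vcarrier (ell1_0 :: ('g, 'g \<Rightarrow> complex) xmodule)) (vact ell1_0 g)" for g
      using L.act_linear[of g] by (simp add: clinear_on_def)
    show "\<exists>v\<in>vcarrier ell1_0. (\<lambda>n. vnorm ell1_0 (u n - v)) \<longlonglongrightarrow> 0"
      if u: "\<And>n. u n \<in> vcarrier ell1_0"
        and c: "\<forall>e>0. \<exists>N. \<forall>m\<ge>N. \<forall>n\<ge>N. vnorm ell1_0 (u m - u n) < e"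
      for u :: "nat \<Rightarrow> 'g \<Rightarrow> complex"
    proof -
      obtain v where v: "v \<in> vcarrier ell1" and lim: "(\<lambda>n. vnorm ell1 (u n - v)) \<longlonglongrightarrow> 0"
        using L.complete[of u] u c by auto
      have "cmod (ell1_sum v) \<le> vnorm ell1 (u n - v)" for n
        using ell1_sum_bound[of "u n - v"] diff[of "u n" v] u[of n] v by simp
      then have "cmod (ell1_sum v) \<le> 0" by (intro LIMSEQ_le_const[OF lim]) blast
      with v lim show ?thesis by auto
    qed
  qed (use L.norm_eq_0 L.supp_limit in \<open>auto simp: L.norm_nonneg L.norm_scale L.norm_triangle
      L.act_closed L.act_zero L.act_add L.act_isometric L.supp_zero L.supp_scale L.supp_act
      ell1_sum_translate dest: L.supp_add[THEN subsetD]\<close>)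
qed

lemma trivial_module_module: "equivariant_module (trivial_module :: ('g::group_add, complex) xmodule)"
proof
  fix u :: "nat \<Rightarrow> complex"
  assume "\<forall>e>0. \<exists>N. \<forall>m\<ge>N. \<forall>n\<ge>N. vnorm (trivial_module :: ('g, complex) xmodule) (u m - u n) < e"
  then have "Cauchy u" by (simp add: Cauchy_def dist_norm)
  then obtain v where "u \<longlonglongrightarrow> v" by (auto simp: Cauchy_convergent_iff convergent_def)
  then have "(\<lambda>n. cmod (u n - v)) \<longlonglongrightarrow> 0" by (simp add: LIM_zero tendsto_norm_zero)
  then show "\<exists>v\<in>vcarrier (trivial_module :: ('g, complex) xmodule).
      (\<lambda>n. vnorm (trivial_module :: ('g, complex) xmodule) (u n - v)) \<longlonglongrightarrow> 0" by auto
qed (auto simp: csubspace_def clinear_on_def scaleC_complex_def norm_mult intro: norm_triangle_ineq)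

section \<open>The bicomplex of cochains\<close>

text \<open>A space with a sequence of seminorms, and the topology these define.\<close>

record 'a seminormed =
  points :: "'a set"
  snorm :: "nat \<Rightarrow> 'a \<Rightarrow> real"

definition seminorm_topology :: "'a::complex_vector seminormed \<Rightarrow> 'a topology" where
  "seminorm_topology E =
     topology_generated_by
       {{v \<in> points E. snorm E i (v - u) < e} |i u e. u \<in> points E \<and> e > 0}"

text \<open>Points of $X^{n+1}$ are lists of length $n+1$.\<close>

definition diag_nbhd :: "real \<Rightarrow> nat \<Rightarrow> 'g::metric_space list set" where
  "diag_nbhd R n = {xs. length xs = Suc n \<and> (\<forall>a\<in>set xs. \<forall>b\<in>set xs. dist a b \<le> R)}"

definition diag_nbhd2 :: "real \<Rightarrow> nat \<Rightarrow> nat \<Rightarrow> ('g::metric_space list \<times> 'g list) set" where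
  "diag_nbhd2 R p q = {(xs, ys). length xs = Suc p \<and> length ys = Suc q \<and>
     (\<forall>a\<in>set xs \<union> set ys. \<forall>b\<in>set xs \<union> set ys. dist a b \<le> R)}"

type_synonym ('g, 'v) cochain = "'g list \<Rightarrow> 'g list \<Rightarrow> 'v"

definition controlled_supports ::
    "('g::metric_space, 'v) xmodule \<Rightarrow> nat \<Rightarrow> nat \<Rightarrow> ('g, 'v) cochain \<Rightarrow> bool" where
  "controlled_supports V p q \<phi> \<longleftrightarrow>
     (\<forall>R>0. \<exists>S>0. \<forall>(xs, ys)\<in>diag_nbhd2 R p q.
        \<forall>z\<in>set xs \<union> set ys. vsupp V (\<phi> xs ys) \<subseteq> ball z S)"

definition equivariant ::
    "('g::group_add, 'v) xmodule \<Rightarrow> nat \<Rightarrow> nat \<Rightarrow> ('g, 'v) cochain \<Rightarrow> bool" where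
  "equivariant V p q \<phi> \<longleftrightarrow>
     (\<forall>g xs ys. length xs = Suc p \<longrightarrow> length ys = Suc q \<longrightarrow>
        vact V g (\<phi> xs ys) = \<phi> (map (\<lambda>x. g + x) xs) (map (\<lambda>y. g + y) ys))"

definition cochain_norms ::
    "('g::metric_space, 'v) xmodule \<Rightarrow> nat \<Rightarrow> nat \<Rightarrow> real \<Rightarrow> ('g, 'v) cochain \<Rightarrow> real set" where
  "cochain_norms V p q R \<phi> = {vnorm V (\<phi> xs ys) |xs ys. xs \<in> diag_nbhd R p \<and> length ys = Suc q}"

text \<open>A function on $X^{p+1}\times X^{q+1}$ is encoded as a function on all pairs of lists that
  vanishes at pairs of the wrong lengths. The \<open>i\<close>-th seminorm is the supremum over the
  neighbourhood of radius $i+1$, so the radii are the positive integers.\<close>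

definition cochains ::
    "('g::{group_add,metric_space}, 'v::complex_vector) xmodule \<Rightarrow> nat \<Rightarrow> nat \<Rightarrow>
      ('g, 'v) cochain seminormed" where
  "cochains V p q =
     \<lparr>points = {\<phi>.
        (\<forall>xs ys. if length xs = Suc p \<and> length ys = Suc q
                 then \<phi> xs ys \<in> vcarrier V else \<phi> xs ys = 0) \<and>
        equivariant V p q \<phi> \<and> controlled_supports V p q \<phi> \<and>
        (\<forall>R>0. bdd_above (cochain_norms V p q R \<phi>))},
      snorm = (\<lambda>i \<phi>. Sup (cochain_norms V p q (real (Suc i)) \<phi>))\<rparr>"

definition omit :: "nat \<Rightarrow> 'a list \<Rightarrow> 'a list" where
  "omit i xs = take i xs @ drop (Suc i) xs"

text \<open>On cochains of bidegree $(p,q)$ the summation ranges are $0,\dots,p+1$ and $0,\dots,q+1$: at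
  lists of other lengths all summands vanish.\<close>

definition diffD :: "('g, 'v::complex_vector) cochain \<Rightarrow> ('g, 'v) cochain" where
  "diffD \<phi> = (\<lambda>xs ys. \<Sum>i<length xs. (-1) ^ i *\<^sub>C \<phi> (omit i xs) ys)"

definition diffd :: "nat \<Rightarrow> ('g, 'v::complex_vector) cochain \<Rightarrow> ('g, 'v) cochain" where
  "diffd p \<phi> = (\<lambda>xs ys. \<Sum>i<length ys. (-1) ^ (i + p) *\<^sub>C \<phi> xs (omit i ys))"

definition push :: "('v \<Rightarrow> 'w) \<Rightarrow> ('g, 'v) cochain \<Rightarrow> ('g, 'w) cochain" where
  "push f \<phi> = (\<lambda>xs ys. f (\<phi> xs ys))"

section \<open>Completions\<close>

definition add_group :: "'a::ab_group_add set \<Rightarrow> 'a monoid" where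
  "add_group E = \<lparr>carrier = E, monoid.mult = (+), one = 0\<rparr>"

definition bounded_seqs :: "'a seminormed \<Rightarrow> (nat \<Rightarrow> 'a) set" where
  "bounded_seqs E = {u. (\<forall>n. u n \<in> points E) \<and> (\<forall>i. \<exists>C. \<forall>n. snorm E i (u n) \<le> C)}"

definition null_seqs :: "'a seminormed \<Rightarrow> (nat \<Rightarrow> 'a) set" where
  "null_seqs E = {u. (\<forall>n. u n \<in> points E) \<and> (\<forall>i. (\<lambda>n. snorm E i (u n)) \<longlonglongrightarrow> 0)}"

definition Q_completion :: "'a::complex_vector seminormed \<Rightarrow> (nat \<Rightarrow> 'a) set monoid" where
  "Q_completion E = add_group (bounded_seqs E) Mod null_seqs E"

definition Q_incl :: "'a::complex_vector seminormed \<Rightarrow> 'a \<Rightarrow> (nat \<Rightarrow> 'a) set" where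
  "Q_incl E \<phi> = null_seqs E #>\<^bsub>add_group (bounded_seqs E)\<^esub> (\<lambda>n. \<phi>)"

text \<open>The map induced on cosets of null sequences by applying \<open>T\<close>, with values in \<open>F\<close>, termwise.\<close>

definition Q_map ::
    "'b::complex_vector seminormed \<Rightarrow> ('a \<Rightarrow> 'b) \<Rightarrow> (nat \<Rightarrow> 'a) set \<Rightarrow> (nat \<Rightarrow> 'b) set" where
  "Q_map F T c = null_seqs F <#>\<^bsub>add_group (bounded_seqs F)\<^esub> ((\<lambda>u n. T (u n)) ` c)"

text \<open>Functionals on a subset of a type are extended by zero to the whole type.\<close>

definition cdual :: "'a::complex_vector seminormed \<Rightarrow> ('a \<Rightarrow> complex) set" where
  "cdual E = {\<alpha>. (\<forall>\<phi>. \<phi> \<notin> points E \<longrightarrow> \<alpha> \<phi> = 0) \<and> clinear_on (points E) \<alpha> \<and>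
                 continuous_map (seminorm_topology E) euclidean \<alpha>}"

definition dual_norm :: "'a seminormed \<Rightarrow> nat \<Rightarrow> ('a \<Rightarrow> complex) \<Rightarrow> ennreal" where
  "dual_norm E i \<alpha> = (SUP \<phi>\<in>{\<phi> \<in> points E. snorm E i \<phi> \<le> 1}. ennreal (cmod (\<alpha> \<phi>)))"

definition bidual :: "'a::complex_vector seminormed \<Rightarrow> (('a \<Rightarrow> complex) \<Rightarrow> complex) set" where
  "bidual E = {\<eta>. (\<forall>\<alpha>. \<alpha> \<notin> cdual E \<longrightarrow> \<eta> \<alpha> = 0) \<and> clinear_on (cdual E) \<eta> \<and>
     (\<forall>i. (SUP \<alpha>\<in>{\<alpha> \<in> cdual E. dual_norm E i \<alpha> \<le> 1}. ennreal (cmod (\<eta> \<alpha>))) < \<infinity>)}"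

definition W_completion ::
    "'a::complex_vector seminormed \<Rightarrow> (('a \<Rightarrow> complex) \<Rightarrow> complex) monoid" where
  "W_completion E = add_group (bidual E)"

definition W_incl :: "'a::complex_vector seminormed \<Rightarrow> 'a \<Rightarrow> (('a \<Rightarrow> complex) \<Rightarrow> complex)" where
  "W_incl E \<phi> = (\<lambda>\<alpha>. if \<alpha> \<in> cdual E then \<alpha> \<phi> else 0)"

definition transp :: "'a seminormed \<Rightarrow> ('a \<Rightarrow> 'b) \<Rightarrow> ('b \<Rightarrow> complex) \<Rightarrow> ('a \<Rightarrow> complex)" where
  "transp E T \<beta> = (\<lambda>\<phi>. if \<phi> \<in> points E then \<beta> (T \<phi>) else 0)"

definition W_map ::
    "'a::complex_vector seminormed \<Rightarrow> 'b::complex_vector seminormed \<Rightarrow> ('a \<Rightarrow> 'b) \<Rightarrow>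
      (('a \<Rightarrow> complex) \<Rightarrow> complex) \<Rightarrow> (('b \<Rightarrow> complex) \<Rightarrow> complex)" where
  "W_map E F T \<eta> = (\<lambda>\<beta>. if \<beta> \<in> cdual F then \<eta> (transp E T \<beta>) else 0)"

section \<open>Cohomology of bicomplexes\<close>

record 'c bicomplex =
  bgrp :: "nat \<Rightarrow> nat \<Rightarrow> 'c monoid"
  bD :: "nat \<Rightarrow> nat \<Rightarrow> 'c \<Rightarrow> 'c"
  bd :: "nat \<Rightarrow> nat \<Rightarrow> 'c \<Rightarrow> 'c"

text \<open>The \<open>p\<close>-th entry of a total cochain of degree \<open>n\<close> has bidegree $(p,n-p)$; a product over a
  finite index set is a direct sum.\<close>

definition total :: "'c bicomplex \<Rightarrow> nat \<Rightarrow> (nat \<Rightarrow> 'c) monoid" where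
  "total B n = product_group {..n} (\<lambda>p. bgrp B p (n - p))"

definition total_diff :: "'c bicomplex \<Rightarrow> nat \<Rightarrow> (nat \<Rightarrow> 'c) \<Rightarrow> (nat \<Rightarrow> 'c)" where
  "total_diff B n c = (\<lambda>p\<in>{..Suc n}.
     (if p = 0 then \<one>\<^bsub>bgrp B p (Suc n - p)\<^esub> else bD B (p - 1) (Suc n - p) (c (p - 1)))
       \<otimes>\<^bsub>bgrp B p (Suc n - p)\<^esub>
     (if p = Suc n then \<one>\<^bsub>bgrp B p (Suc n - p)\<^esub> else bd B p (n - p) (c p)))"

definition cocycles :: "'c bicomplex \<Rightarrow> nat \<Rightarrow> (nat \<Rightarrow> 'c) set" where
  "cocycles B n = kernel (total B n) (total B (Suc n)) (total_diff B n)"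

definition coboundaries :: "'c bicomplex \<Rightarrow> nat \<Rightarrow> (nat \<Rightarrow> 'c) set" where
  "coboundaries B n =
     (if n = 0 then {\<one>\<^bsub>total B n\<^esub>} else total_diff B (n - 1) ` carrier (total B (n - 1)))"

definition cohomology :: "'c bicomplex \<Rightarrow> nat \<Rightarrow> (nat \<Rightarrow> 'c) set monoid" where
  "cohomology B n = ((total B n)\<lparr>carrier := cocycles B n\<rparr>) Mod coboundaries B n"

definition cohomology_class :: "'c bicomplex \<Rightarrow> nat \<Rightarrow> (nat \<Rightarrow> 'c) \<Rightarrow> (nat \<Rightarrow> 'c) set" where
  "cohomology_class B n z = coboundaries B n #>\<^bsub>total B n\<^esub> z"

definition total_map ::
    "(nat \<Rightarrow> nat \<Rightarrow> 'c \<Rightarrow> 'e) \<Rightarrow> nat \<Rightarrow> (nat \<Rightarrow> 'c) \<Rightarrow> (nat \<Rightarrow> 'e)" where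
  "total_map f n c = (\<lambda>p\<in>{..n}. f p (n - p) (c p))"

definition cohomology_map ::
    "'e bicomplex \<Rightarrow> (nat \<Rightarrow> nat \<Rightarrow> 'c \<Rightarrow> 'e) \<Rightarrow> nat \<Rightarrow> (nat \<Rightarrow> 'c) set \<Rightarrow> (nat \<Rightarrow> 'e) set" where
  "cohomology_map B' f n K = coboundaries B' n <#>\<^bsub>total B' n\<^esub> (total_map f n ` K)"

text \<open>The connecting map in degree \<open>n\<close> of a short exact sequence \<open>0 \<rightarrow> A \<rightarrow> B \<rightarrow> C \<rightarrow> 0\<close> of
  bicomplexes with maps \<open>i\<close> and \<open>r\<close>: lift a representative of the class \<open>K\<close> along \<open>r\<close>, apply the
  differential, and pull back along \<open>i\<close>.\<close>

definition connecting ::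
    "'a bicomplex \<Rightarrow> 'b bicomplex \<Rightarrow> (nat \<Rightarrow> nat \<Rightarrow> 'a \<Rightarrow> 'b) \<Rightarrow> (nat \<Rightarrow> nat \<Rightarrow> 'b \<Rightarrow> 'c) \<Rightarrow>
      nat \<Rightarrow> (nat \<Rightarrow> 'c) set \<Rightarrow> (nat \<Rightarrow> 'a) set" where
  "connecting A B i r n K =
     (THE h. \<exists>b\<in>carrier (total B n). \<exists>a\<in>cocycles A (Suc n).
        total_map r n b \<in> K \<and> total_map i (Suc n) a = total_diff B n b \<and>
        h = cohomology_class A (Suc n) a)"

section \<open>Cohomology of the completed bicomplexes\<close>

type_synonym ('g, 'v) Q_cochain = "(nat \<Rightarrow> ('g, 'v) cochain) set"
type_synonym ('g, 'v) W_cochain = "(('g, 'v) cochain \<Rightarrow> complex) \<Rightarrow> complex"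

definition Q_bicomplex ::
    "('g::{group_add,metric_space}, 'v::complex_vector) xmodule \<Rightarrow> ('g, 'v) Q_cochain bicomplex" where
  "Q_bicomplex V =
     \<lparr>bgrp = (\<lambda>p q. Q_completion (cochains V p q)),
      bD = (\<lambda>p q. Q_map (cochains V (Suc p) q) diffD),
      bd = (\<lambda>p q. Q_map (cochains V p (Suc q)) (diffd p))\<rparr>"

definition W_bicomplex ::
    "('g::{group_add,metric_space}, 'v::complex_vector) xmodule \<Rightarrow> ('g, 'v) W_cochain bicomplex" where
  "W_bicomplex V =
     \<lparr>bgrp = (\<lambda>p q. W_completion (cochains V p q)),
      bD = (\<lambda>p q. W_map (cochains V p q) (cochains V (Suc p) q) diffD),
      bd = (\<lambda>p q. W_map (cochains V p q) (cochains V p (Suc q)) (diffd p))\<rparr>"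

definition Q_bimap ::
    "('g::{group_add,metric_space}, 'w::complex_vector) xmodule \<Rightarrow> ('v \<Rightarrow> 'w) \<Rightarrow>
      nat \<Rightarrow> nat \<Rightarrow> ('g, 'v) Q_cochain \<Rightarrow> ('g, 'w) Q_cochain" where
  "Q_bimap V' f p q = Q_map (cochains V' p q) (push f)"

definition W_bimap ::
    "('g::{group_add,metric_space}, 'v::complex_vector) xmodule \<Rightarrow>
      ('g, 'w::complex_vector) xmodule \<Rightarrow> ('v \<Rightarrow> 'w) \<Rightarrow>
      nat \<Rightarrow> nat \<Rightarrow> ('g, 'v) W_cochain \<Rightarrow> ('g, 'w) W_cochain" where
  "W_bimap V V' f p q = W_map (cochains V p q) (cochains V' p q) (push f)"

abbreviation H_Q ::
    "nat \<Rightarrow> ('g::{group_add,metric_space}, 'v::complex_vector) xmodule \<Rightarrow>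
      (nat \<Rightarrow> ('g, 'v) Q_cochain) set monoid" where
  "H_Q n V \<equiv> cohomology (Q_bicomplex V) n"

abbreviation H_W ::
    "nat \<Rightarrow> ('g::{group_add,metric_space}, 'v::complex_vector) xmodule \<Rightarrow>
      (nat \<Rightarrow> ('g, 'v) W_cochain) set monoid" where
  "H_W n V \<equiv> cohomology (W_bicomplex V) n"

definition const_one :: "('g, complex) cochain" where
  "const_one = (\<lambda>xs ys. if length xs = 1 \<and> length ys = 1 then 1 else 0)"

lemma const_one_cochain:
  "const_one \<in> points (cochains (trivial_module :: ('g::{group_add,metric_space}, complex) xmodule) 0 0)"
proof -
  have "bdd_above (cochain_norms (trivial_module :: ('g, complex) xmodule) 0 0 R const_one)" for R
    by (rule bdd_aboveI[of _ 1]) (auto simp: cochain_norms_def const_one_def)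
  then show ?thesis
    by (auto simp: cochains_def equivariant_def controlled_supports_def const_one_def
        intro: exI[of _ 1])
qed

definition one_Q :: "(nat \<Rightarrow> ('g::{group_add,metric_space}, complex) Q_cochain) set" where
  "one_Q = cohomology_class (Q_bicomplex trivial_module) 0
     (\<lambda>p\<in>{..0}. Q_incl (cochains trivial_module 0 0) const_one)"

definition one_W :: "(nat \<Rightarrow> ('g::{group_add,metric_space}, complex) W_cochain) set" where
  "one_W = cohomology_class (W_bicomplex trivial_module) 0
     (\<lambda>p\<in>{..0}. W_incl (cochains trivial_module 0 0) const_one)"

definition pi_star_Q ::
    "nat \<Rightarrow> (nat \<Rightarrow> ('g::{group_add,metric_space}, 'g \<Rightarrow> complex) Q_cochain) set \<Rightarrow>
      (nat \<Rightarrow> ('g, complex) Q_cochain) set" where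
  "pi_star_Q = cohomology_map (Q_bicomplex trivial_module) (Q_bimap trivial_module ell1_sum)"

definition connecting_Q ::
    "nat \<Rightarrow> (nat \<Rightarrow> ('g::{group_add,metric_space}, complex) Q_cochain) set \<Rightarrow>
      (nat \<Rightarrow> ('g, 'g \<Rightarrow> complex) Q_cochain) set" where
  "connecting_Q = connecting (Q_bicomplex ell1_0) (Q_bicomplex ell1)
     (Q_bimap ell1 ell1_incl) (Q_bimap trivial_module ell1_sum)"

definition connecting_W ::
    "nat \<Rightarrow> (nat \<Rightarrow> ('g::{group_add,metric_space}, complex) W_cochain) set \<Rightarrow>
      (nat \<Rightarrow> ('g, 'g \<Rightarrow> complex) W_cochain) set" where
  "connecting_W = connecting (W_bicomplex ell1_0) (W_bicomplex ell1)
     (W_bimap ell1_0 ell1 ell1_incl) (W_bimap ell1 trivial_module ell1_sum)"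

end

theory Submission
  imports Defs
begin

text \<open>Everything reduces to a single kind of object: a cocycle of bidegree $(0,0)$ in a completion of
  the cochains with values in \<open>\<ell>\<^sup>1(G)\<close> that \<open>\<pi>\<close> maps to the constant cochain 1. That \<open>[1]\<close> lies
  in the image of \<open>\<pi>\<close> in cohomology means that such a cocycle exists. As to the connecting map, lift 1 to
  the cochain \<open>(x, y) \<mapsto> \<delta>\<^sub>x\<close>. The boundary of this lift, the Johnson cocycle, has values in \<open>\<ell>\<^sup>1\<^sub>0(G)\<close> and represents the
  class \<open>D[1]\<close>, and it bounds a cochain with values in \<open>\<ell>\<^sup>1\<^sub>0(G)\<close> exactly if the lift can be corrected by
  that cochain to a cocycle. This is the long exact sequence in degree 0. It is worked out for general
  bicomplexes in the locale \<open>connecting_lift\<close> and applies to both completions, because multiplication by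
  \<open>\<delta>\<^sub>x\<close> splits the coefficient sequence by bounded maps, and such a splitting survives completion.
  It remains to go around the circle: amenability, a cocycle in the quotient completion, a cocycle in
  the weak-* completion, amenability.

  A mean on an amenable group yields finitely supported probability functions \<open>f\<^sub>n\<close> whose translates by
  the elements of the ball of radius \<open>n + 1\<close> differ from \<open>f\<^sub>n\<close> by less than \<open>1 / (n + 1)\<close> in \<open>\<ell>\<^sup>1\<close> norm
  (\<open>amenable_imp_almost_invariant\<close>): otherwise a Hahn-Banach functional would separate the translation
  differences from 0, and such a functional is a family of bounded functions contradicting the
  invariance of the mean. The sequence of cochains \<open>(x, y) \<mapsto> x f\<^sub>n\<close> is then a cocycle in the quotient
  completion: it is constant in \<open>y\<close>, and its differences in \<open>x\<close> tend to 0 uniformly on each set of pairs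
  at bounded distance, because balls are finite (\<open>amenable_imp_Q_cocycle\<close>).

  A generalized limit of bounded sequences, again a Hahn-Banach functional, maps the quotient completion
  to the bidual and carries cocycles to cocycles (\<open>Q_cocycle_imp_W_cocycle\<close>).

  Finally, a bounded function \<open>f\<close> on the group is turned into the continuous functional
  \<open>\<phi> \<mapsto> \<langle>f, \<phi>(0, 0)\<rangle>\<close> on cochains, on which an element \<open>\<eta>\<close> of the bidual can be evaluated. By equivariance,
  translating \<open>f\<close> by \<open>g\<close> amounts to moving \<open>(0, 0)\<close> to \<open>(g, g)\<close>, first in one and then in the other
  variable; a cocycle \<open>\<eta>\<close> does not see either move. So \<open>\<eta>\<close> gives a bounded invariant functional with value
  1 at the function 1, and its positive part in the sense of the Riesz decomposition is, up to a factor,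
  an invariant mean (\<open>W_cocycle_imp_amenable\<close>, \<open>amenable_if_bounded_invariant_functional\<close>).\<close>

section \<open>A Hahn-Banach theorem for spaces of real functions\<close>

abbreviation (input) rscale :: "real \<Rightarrow> ('i \<Rightarrow> real) \<Rightarrow> 'i \<Rightarrow> real" where
  "rscale t u \<equiv> (\<lambda>i. t * u i)"

definition rsubspace :: "('i \<Rightarrow> real) set \<Rightarrow> bool" where
  "rsubspace S \<longleftrightarrow> 0 \<in> S \<and> (\<forall>u\<in>S. \<forall>v\<in>S. u + v \<in> S) \<and> (\<forall>t. \<forall>u\<in>S. rscale t u \<in> S)"

definition sublinear_on :: "('i \<Rightarrow> real) set \<Rightarrow> (('i \<Rightarrow> real) \<Rightarrow> real) \<Rightarrow> bool" where
  "sublinear_on S p \<longleftrightarrow>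
     (\<forall>u\<in>S. \<forall>v\<in>S. p (u + v) \<le> p u + p v) \<and> (\<forall>t>0. \<forall>u\<in>S. p (rscale t u) \<le> t * p u)"

definition rlinear_on :: "('i \<Rightarrow> real) set \<Rightarrow> (('i \<Rightarrow> real) \<Rightarrow> real) \<Rightarrow> bool" where
  "rlinear_on S L \<longleftrightarrow>
     (\<forall>u\<in>S. \<forall>v\<in>S. L (u + v) = L u + L v) \<and> (\<forall>t. \<forall>u\<in>S. L (rscale t u) = t * L u)"

lemma rsubspaceD:
  assumes "rsubspace S"
  shows "0 \<in> S" "u \<in> S \<Longrightarrow> v \<in> S \<Longrightarrow> u + v \<in> S" "u \<in> S \<Longrightarrow> rscale t u \<in> S" "u \<in> S \<Longrightarrow> - u \<in> S"
proof -
  show "0 \<in> S" "u \<in> S \<Longrightarrow> v \<in> S \<Longrightarrow> u + v \<in> S" and *: "\<And>t. u \<in> S \<Longrightarrow> rscale t u \<in> S"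
    using assms by (auto simp: rsubspace_def)
  have "- u = rscale (-1) u" by (auto simp: fun_eq_iff)
  then show "u \<in> S \<Longrightarrow> - u \<in> S" using *[of "-1"] by simp
qed

lemma sublinear_on_scale:
  assumes "sublinear_on S p" "rsubspace S" "u \<in> S" "0 < t"
  shows "p (rscale t u) = t * p u"
proof (rule antisym)
  show "p (rscale t u) \<le> t * p u" using assms by (auto simp: sublinear_on_def)
  have "p (rscale (1/t) (rscale t u)) \<le> 1/t * p (rscale t u)"
    using assms rsubspaceD(3)[OF assms(2,3)] unfolding sublinear_on_def
    by (metis zero_less_divide_1_iff)
  then show "t * p u \<le> p (rscale t u)" using assms(4) by (simp add: field_simps)
qed

lemma sublinear_on_zero:
  assumes "sublinear_on S p" "rsubspace S"
  shows "p 0 = 0"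
  using sublinear_on_scale[OF assms rsubspaceD(1)[OF assms(2)], of 2] by (simp add: zero_fun_def)

lemma sublinear_on_neg_ge:
  assumes "sublinear_on S p" "rsubspace S" "u \<in> S"
  shows "- p (- u) \<le> p u"
proof -
  have "p (u + - u) \<le> p u + p (- u)"
    using assms rsubspaceD(4)[OF assms(2,3)] unfolding sublinear_on_def by blast
  then show ?thesis using sublinear_on_zero[OF assms(1,2)] by simp
qed

text \<open>The idea is to descend instead of to extend: a sublinear functional that is minimal for the
  pointwise order is additive. Indeed, replacing \<open>q u\<close> by the infimum of
  \<open>q (u + t y) - t q y\<close> over \<open>t \<ge> 0\<close> gives a smaller sublinear functional; if it is not strictly
  smaller then \<open>q u \<le> q (u + y) - q y\<close>.\<close>

lemma minimal_sublinear_superadditive: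
  assumes S: "rsubspace S" and q: "sublinear_on S q"
    and minimal: "\<And>q'. sublinear_on S q' \<Longrightarrow> (\<And>u. u \<in> S \<Longrightarrow> q' u \<le> q u) \<Longrightarrow> (\<And>u. u \<notin> S \<Longrightarrow> q' u = q u) \<Longrightarrow>
      q' = q"
    and x: "x \<in> S" and y: "y \<in> S"
  shows "q x + q y \<le> q (x + y)"
proof -
  note cl = rsubspaceD[OF S]
  define X where "X u = (\<lambda>t. q (u + rscale t y) - t * q y) ` {0..}" for u
  define q' where "q' u = (if u \<in> S then Inf (X u) else q u)" for u
  have add: "q (u + v) \<le> q u + q v" if "u \<in> S" "v \<in> S" for u v
    using q that by (auto simp: sublinear_on_def)
  have lower: "- q (- u) \<le> q (u + rscale t y) - t * q y" if u: "u \<in> S" and t: "t \<ge> 0" for u t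
  proof -
    have "rscale t y = (u + rscale t y) + - u" by simp
    then have "q (rscale t y) \<le> q (u + rscale t y) + q (- u)"
      using add[OF cl(2)[OF u cl(3)[OF y]] cl(4)[OF u], of t] by simp
    moreover have "q (rscale t y) = t * q y"
      using sublinear_on_scale[OF q S y, of t] sublinear_on_zero[OF q S] t
      by (cases "t = 0") (auto simp: zero_fun_def)
    ultimately show ?thesis by simp
  qed
  have bdd: "bdd_below (X u)" if "u \<in> S" for u
    unfolding X_def using lower[OF that] by (auto intro!: bdd_belowI2)
  have ne: "X u \<noteq> {}" for u by (auto simp: X_def)
  have le: "q' u \<le> q (u + rscale t y) - t * q y" if "u \<in> S" "t \<ge> 0" for u t
    using bdd[OF that(1)] that by (auto simp: q'_def X_def intro!: cInf_lower)
  have ge: "c \<le> q' u" if "u \<in> S" "\<And>t. t \<ge> 0 \<Longrightarrow> c \<le> q (u + rscale t y) - t * q y" for u c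
    using that ne[of u] by (auto simp: q'_def X_def intro!: cInf_greatest)
  have "sublinear_on S q'"
    unfolding sublinear_on_def
  proof (intro conjI ballI allI impI)
    fix u v assume u: "u \<in> S" and v: "v \<in> S"
    have *: "q' (u + v) - (q (v + rscale t y) - t * q y) \<le> q (u + rscale s y) - s * q y"
      if "s \<ge> 0" "t \<ge> 0" for s t
    proof -
      have "q' (u + v) \<le> q (u + v + rscale (s + t) y) - (s + t) * q y"
        by (rule le) (use that u v cl in auto)
      also have "u + v + rscale (s + t) y = (u + rscale s y) + (v + rscale t y)"
        by (auto simp: fun_eq_iff algebra_simps)
      also have "q \<dots> \<le> q (u + rscale s y) + q (v + rscale t y)"
        by (intro add cl u v y)
      finally show ?thesis using distrib_right[of s t "q y"] by linarith
    qed
    have "q' (u + v) - q' u \<le> q (v + rscale t y) - t * q y" if "t \<ge> 0" for t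
      using ge[OF u *[OF _ that]] by simp
    then show "q' (u + v) \<le> q' u + q' v"
      using ge[OF v, of "q' (u + v) - q' u"] by simp
  next
    fix t :: real and u assume t: "t > 0" and u: "u \<in> S"
    have "q' (rscale t u) / t \<le> q (u + rscale s y) - s * q y" if "s \<ge> 0" for s
    proof -
      have "q' (rscale t u) \<le> q (rscale t u + rscale (t * s) y) - (t * s) * q y"
        by (rule le) (use that t u cl in auto)
      also have "rscale t u + rscale (t * s) y = rscale t (u + rscale s y)"
        by (auto simp: fun_eq_iff algebra_simps)
      also have "q \<dots> = t * q (u + rscale s y)"
        by (intro sublinear_on_scale[OF q S _ t] cl u y)
      finally show ?thesis using t by (simp add: field_simps)
    qed
    from ge[OF u this] show "q' (rscale t u) \<le> t * q' u" using t by (simp add: field_simps)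
  qed
  moreover have "q' u \<le> q u" if "u \<in> S" for u
    using le[OF that, of 0] by (simp add: zero_fun_def[symmetric])
  ultimately have "q' = q" by (intro minimal) (auto simp: q'_def)
  moreover have "q' x \<le> q (x + y) - q y" using le[OF x, of 1] by simp
  ultimately show ?thesis by simp
qed

text \<open>Zorn's lemma gives a minimal sublinear functional below \<open>p\<close>. The infimum of a chain of sublinear
  functionals below \<open>p\<close> is finite because they are all at least \<open>- p (- u)\<close> at \<open>u\<close>, and it is subadditive
  because of any two members of the chain one lies below the other.\<close>

theorem hahn_banach:
  assumes S: "rsubspace S" and p: "sublinear_on S p"
  obtains L where "rlinear_on S L" "\<And>u. u \<in> S \<Longrightarrow> L u \<le> p u"
proof -
  note cl = rsubspaceD[OF S]
  define Q where "Q = {q. sublinear_on S q \<and> (\<forall>u\<in>S. q u \<le> p u) \<and> (\<forall>u. u \<notin> S \<longrightarrow> q u = 0)}"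
  have po: "partial_order_on Q (relation_of (\<lambda>a b. b \<le> a) Q)"
    by (rule partial_order_on_relation_ofI) auto
  have "\<exists>m\<in>Q. \<forall>a\<in>Q. a \<le> m \<longrightarrow> a = m"
  proof (rule predicate_Zorn[OF po])
    fix C assume C: "C \<in> Chains (relation_of (\<lambda>a b. b \<le> a) Q)"
    have CQ: "q \<in> Q" if "q \<in> C" for q
      using C that by (auto simp: Chains_def relation_of_def)
    have total: "q \<le> q' \<or> q' \<le> q" if "q \<in> C" "q' \<in> C" for q q'
      using C that by (auto simp: Chains_def relation_of_def)
    have subl: "sublinear_on S q" if "q \<in> C" for q using CQ[OF that] by (simp add: Q_def)
    show "\<exists>u\<in>Q. \<forall>a\<in>C. u \<le> a"
    proof (cases "C = {}")
      case True
      have "(\<lambda>u. if u \<in> S then p u else 0) \<in> Q"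
        using p cl by (auto simp: Q_def sublinear_on_def)
      with True show ?thesis by blast
    next
      case False
      define q where "q u = (if u \<in> S then (INF r\<in>C. r u) else 0)" for u
      have bdd: "bdd_below ((\<lambda>r. r u) ` C)" if u: "u \<in> S" for u
      proof (rule bdd_belowI2)
        fix r assume r: "r \<in> C"
        have "- p (- u) \<le> - r (- u)" using CQ[OF r] cl(4)[OF u] by (auto simp: Q_def)
        also have "\<dots> \<le> r u" by (rule sublinear_on_neg_ge[OF subl[OF r] S u])
        finally show "- p (- u) \<le> r u" .
      qed
      have le: "q u \<le> r u" if "r \<in> C" "u \<in> S" for r u
        using cINF_lower[OF bdd[OF that(2)] that(1)] that by (simp add: q_def)
      have ge: "c \<le> q u" if "u \<in> S" "\<And>r. r \<in> C \<Longrightarrow> c \<le> r u" for u c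
        using cINF_greatest[OF False that(2)] that(1) by (simp add: q_def)
      have "sublinear_on S q"
        unfolding sublinear_on_def
      proof (intro conjI ballI allI impI)
        fix u v assume u: "u \<in> S" and v: "v \<in> S"
        have *: "q (u + v) - r u \<le> r' v" if r: "r \<in> C" and r': "r' \<in> C" for r r'
        proof -
          define s where "s = (if r \<le> r' then r else r')"
          have s: "s \<in> C" "s \<le> r" "s \<le> r'"
            using r r' total[OF r r'] by (auto simp: s_def)
          have "q (u + v) \<le> s (u + v)" by (rule le[OF s(1) cl(2)[OF u v]])
          also have "\<dots> \<le> s u + s v" using subl[OF s(1)] u v by (auto simp: sublinear_on_def)
          also have "\<dots> \<le> r u + r' v" using s by (auto simp: le_fun_def intro: add_mono)
          finally show ?thesis by simp
        qed
        have "q (u + v) - r u \<le> q v" if "r \<in> C" for r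
          by (rule ge[OF v]) (rule *[OF that])
        then show "q (u + v) \<le> q u + q v" using ge[OF u, of "q (u + v) - q v"] by (simp add: algebra_simps)
      next
        fix t :: real and u assume t: "t > 0" and u: "u \<in> S"
        have "q (rscale t u) / t \<le> r u" if "r \<in> C" for r
          using le[OF that cl(3)[OF u], of t] sublinear_on_scale[OF subl[OF that] S u t] t
          by (simp add: field_simps)
        then have "q (rscale t u) / t \<le> q u" by (rule ge[OF u])
        then show "q (rscale t u) \<le> t * q u" using t by (simp add: field_simps)
      qed
      moreover have "q u \<le> p u" if "u \<in> S" for u
      proof -
        obtain r where r: "r \<in> C" using False by blast
        show ?thesis using le[OF r that] CQ[OF r] that by (force simp: Q_def)
      qed
      ultimately have "q \<in> Q" by (auto simp: Q_def q_def)
      moreover have "q \<le> r" if r: "r \<in> C" for r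
        using le[OF r] CQ[OF r] by (auto simp: le_fun_def q_def Q_def)
      ultimately show ?thesis by blast
    qed
  qed
  then obtain L where L: "L \<in> Q" and min: "\<And>q. q \<in> Q \<Longrightarrow> q \<le> L \<Longrightarrow> q = L" by blast
  have subl: "sublinear_on S L" and Lp: "\<And>u. u \<in> S \<Longrightarrow> L u \<le> p u" using L by (auto simp: Q_def)
  have "L x + L y \<le> L (x + y)" if "x \<in> S" "y \<in> S" for x y
  proof (rule minimal_sublinear_superadditive[OF S subl _ that])
    fix q' assume "sublinear_on S q'" and le: "\<And>u. u \<in> S \<Longrightarrow> q' u \<le> L u"
      and out: "\<And>u. u \<notin> S \<Longrightarrow> q' u = L u"
    then show "q' = L" using L Lp by (intro min) (force simp: Q_def le_fun_def)+
  qed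
  then have add: "L (x + y) = L x + L y" if "x \<in> S" "y \<in> S" for x y
    using subl that by (auto simp: sublinear_on_def intro: antisym)
  have neg: "L (- x) = - L x" if "x \<in> S" for x
    using add[OF that cl(4)[OF that]] sublinear_on_zero[OF subl S] by simp
  have "L (rscale t x) = t * L x" if x: "x \<in> S" for t x
  proof -
    consider "t = 0" | "t > 0" | "- t > 0" by linarith
    then show ?thesis
    proof cases
      case 1 then show ?thesis using sublinear_on_zero[OF subl S] by (simp add: zero_fun_def)
    next
      case 2 then show ?thesis by (rule sublinear_on_scale[OF subl S x])
    next
      case 3
      have "L (- rscale (- t) x) = - (- t * L x)"
        unfolding neg[OF cl(3)[OF x]] sublinear_on_scale[OF subl S x 3] ..
      moreover have "- rscale (- t) x = rscale t x" by (auto simp: fun_eq_iff)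
      ultimately show ?thesis by simp
    qed
  qed
  then show ?thesis using add Lp by (intro that[of L]) (auto simp: rlinear_on_def)
qed

section \<open>Generalized limits of bounded sequences\<close>

text \<open>The constant 2 stems from treating real and imaginary parts separately.\<close>

definition generalized_limit :: "((nat \<Rightarrow> complex) \<Rightarrow> complex) \<Rightarrow> bool" where
  "generalized_limit L \<longleftrightarrow>
     (\<forall>s t. Bseq s \<longrightarrow> Bseq t \<longrightarrow> L (\<lambda>n. s n + t n) = L s + L t) \<and>
     (\<forall>c s. Bseq s \<longrightarrow> L (\<lambda>n. c * s n) = c * L s) \<and>
     (\<forall>s C. (\<forall>n. cmod (s n) \<le> C) \<longrightarrow> cmod (L s) \<le> 2 * C) \<and>
     (\<forall>s l. s \<longlonglongrightarrow> l \<longrightarrow> L s = l)"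

text \<open>A linear functional on bounded real sequences that lies below the limes superior is a generalized
  limit. The limes superior is written as the infimum of the eventual upper bounds.\<close>

lemma generalized_limit_exists: "\<exists>L. generalized_limit L"
proof -
  define S where "S = {s :: nat \<Rightarrow> real. Bseq s}"
  define U where "U s = {c. eventually (\<lambda>n. s n \<le> c) sequentially}" for s :: "nat \<Rightarrow> real"
  have "Bseq (\<lambda>n. u n + v n)" if uv: "Bseq u" "Bseq v" for u v :: "nat \<Rightarrow> real"
  proof -
    obtain A B where "\<And>n. norm (u n) \<le> A" "\<And>n. norm (v n) \<le> B"
      using uv unfolding Bseq_def by blast
    then show ?thesis by (intro BseqI'[of _ "A + B"] norm_triangle_le add_mono)
  qed
  then have S: "rsubspace S"
    by (auto simp: rsubspace_def S_def plus_fun_def zero_fun_def intro!: Bseq_mult)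
  have bound: "-K \<le> c" if c: "c \<in> U s" and K: "\<And>n. \<bar>s n\<bar> \<le> K" for c s K
  proof -
    obtain N where "s N \<le> c" using c by (auto simp: U_def eventually_sequentially)
    with K[of N] show ?thesis by linarith
  qed
  have bdd: "bdd_below (U s)" if "s \<in> S" for s
    using that bound[of _ s] by (auto simp: S_def Bseq_def bdd_below_def)
  have ne: "U s \<noteq> {}" if "s \<in> S" for s
    using that by (auto simp: S_def Bseq_def U_def abs_le_iff intro!: always_eventually)
  have "sublinear_on S (\<lambda>s. Inf (U s))"
    unfolding sublinear_on_def
  proof (intro conjI ballI allI impI)
    fix s t assume s: "s \<in> S" and t: "t \<in> S"
    have "Inf (U (s + t)) \<le> c + d" if "c \<in> U s" "d \<in> U t" for c d
    proof (rule cInf_lower[OF _ bdd[OF rsubspaceD(2)[OF S s t]]])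
      show "c + d \<in> U (s + t)" using that by (auto simp: U_def elim: eventually_elim2)
    qed
    then have "Inf (U (s + t)) - c \<le> Inf (U t)" if "c \<in> U s" for c
      using that by (intro cInf_greatest[OF ne[OF t]]) (metis add.commute diff_le_eq)
    then have "Inf (U (s + t)) - Inf (U t) \<le> Inf (U s)"
      by (intro cInf_greatest[OF ne[OF s]]) (metis add.commute diff_le_eq)
    then show "Inf (U (s + t)) \<le> Inf (U s) + Inf (U t)" by simp
  next
    fix t :: real and s assume t: "t > 0" and s: "s \<in> S"
    have "Inf (U (rscale t s)) / t \<le> c" if "c \<in> U s" for c
    proof -
      have "Inf (U (rscale t s)) \<le> t * c"
        by (rule cInf_lower[OF _ bdd[OF rsubspaceD(3)[OF S s]]]) (use that t in \<open>auto simp: U_def\<close>)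
      then show ?thesis using t by (simp add: field_simps)
    qed
    from cInf_greatest[OF ne[OF s] this] show "Inf (U (rscale t s)) \<le> t * Inf (U s)"
      using t by (simp add: field_simps)
  qed
  from hahn_banach[OF S this] obtain M where lin: "rlinear_on S M" and le: "\<And>s. s \<in> S \<Longrightarrow> M s \<le> Inf (U s)"
    by blast
  have upper: "M s \<le> c" if "s \<in> S" "eventually (\<lambda>n. s n \<le> c) sequentially" for s c
    using le[OF that(1)] cInf_lower[OF _ bdd[OF that(1)], of c] that(2) by (force simp: U_def)
  have neg: "M (- s) = - M s" if "s \<in> S" for s
  proof -
    have "M (rscale (-1) s) = -1 * M s" using lin that unfolding rlinear_on_def by blast
    moreover have "rscale (-1) s = - s" by (auto simp: fun_eq_iff)
    ultimately show ?thesis by simp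
  qed
  have lower: "c \<le> M s" if "s \<in> S" "eventually (\<lambda>n. c \<le> s n) sequentially" for s c
    using upper[OF rsubspaceD(4)[OF S that(1)], of "- c"] that neg[OF that(1)] by simp
  have lim: "M s = l" if "s \<longlonglongrightarrow> l" for s l
  proof -
    have s: "s \<in> S" using convergent_imp_Bseq that by (auto simp: S_def convergent_def)
    have "M s \<le> l + e \<and> l - e \<le> M s" if "e > 0" for e
      using order_tendstoD[OF \<open>s \<longlonglongrightarrow> l\<close>, of "l + e"] order_tendstoD[OF \<open>s \<longlonglongrightarrow> l\<close>, of "l - e"] that s
      by (intro conjI upper lower) (auto elim: eventually_mono)
    then show ?thesis
      by (metis antisym_conv diff_le_eq field_le_epsilon)
  qed
  define L where "L s = Complex (M (\<lambda>n. Re (s n))) (M (\<lambda>n. Im (s n)))" for s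
  have re: "(\<lambda>n. Re (s n)) \<in> S" and im: "(\<lambda>n. Im (s n)) \<in> S" if "Bseq s" for s
    using that abs_Re_le_cmod abs_Im_le_cmod
    unfolding S_def Bseq_def by (auto, meson order_trans abs_Re_le_cmod, meson order_trans abs_Im_le_cmod)
  have Madd: "M (\<lambda>n. s n + t n) = M s + M t" if "s \<in> S" "t \<in> S" for s t
    using lin that unfolding rlinear_on_def plus_fun_def by blast
  have Mscale: "M (\<lambda>n. c * s n) = c * M s" if "s \<in> S" for s c
    using lin that unfolding rlinear_on_def by blast
  have Msc: "(\<lambda>n. c * s n) \<in> S" if "s \<in> S" for s c using rsubspaceD(3)[OF S that] .
  have "L (\<lambda>n. c * s n) = c * L s" if "Bseq s" for c s
  proof -
    have "M (\<lambda>n. Re (c * s n)) = Re c * M (\<lambda>n. Re (s n)) - Im c * M (\<lambda>n. Im (s n))"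
      using Madd[OF Msc[OF re[OF that], of "Re c"] Msc[OF im[OF that], of "- Im c"]]
        Mscale[OF re[OF that], of "Re c"] Mscale[OF im[OF that], of "- Im c"] by simp
    moreover have "M (\<lambda>n. Im (c * s n)) = Re c * M (\<lambda>n. Im (s n)) + Im c * M (\<lambda>n. Re (s n))"
      using Madd[OF Msc[OF im[OF that], of "Re c"] Msc[OF re[OF that], of "Im c"]]
        Mscale[OF im[OF that], of "Re c"] Mscale[OF re[OF that], of "Im c"] by simp
    ultimately show ?thesis unfolding L_def by (auto simp: complex_eq_iff)
  qed
  moreover have "cmod (L s) \<le> 2 * C" if "\<forall>n. cmod (s n) \<le> C" for s C
  proof -
    have B: "Bseq s" using that by (auto intro: BseqI')
    have "\<bar>Re (s n)\<bar> \<le> C" "\<bar>Im (s n)\<bar> \<le> C" for n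
      using that abs_Re_le_cmod[of "s n"] abs_Im_le_cmod[of "s n"] by (meson order_trans)+
    then have "\<bar>M (\<lambda>n. Re (s n))\<bar> \<le> C" "\<bar>M (\<lambda>n. Im (s n))\<bar> \<le> C"
      using upper[OF re[OF B], of C] lower[OF re[OF B], of "-C"] upper[OF im[OF B], of C] lower[OF im[OF B], of "-C"]
      by (auto simp: abs_le_iff minus_le_iff intro!: always_eventually)
    then show ?thesis using cmod_le[of "L s"] by (simp add: L_def)
  qed
  moreover have "L s = l" if "s \<longlonglongrightarrow> l" for s l
    using lim[OF tendsto_Re[OF that]] lim[OF tendsto_Im[OF that]] by (simp add: L_def)
  moreover have "L (\<lambda>n. s n + t n) = L s + L t" if "Bseq s" "Bseq t" for s t
    using Madd[OF re re] Madd[OF im im] that by (simp add: L_def complex_eq_iff)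
  ultimately have "generalized_limit L" unfolding generalized_limit_def by blast
  then show ?thesis by blast
qed

section \<open>Almost invariant functions on amenable groups\<close>

lemma sum_fun_apply:
  fixes f :: "'a \<Rightarrow> 'b \<Rightarrow> 'c::comm_monoid_add"
  shows "(\<Sum>a\<in>A. f a) x = (\<Sum>a\<in>A. f a x)"
  by (induction A rule: infinite_finite_induct) auto

lemma rlinear_on_sum:
  assumes "rsubspace S" "rlinear_on S L" "finite A" "\<And>a. a \<in> A \<Longrightarrow> u a \<in> S"
  shows "(\<Sum>a\<in>A. u a) \<in> S \<and> L (\<Sum>a\<in>A. u a) = (\<Sum>a\<in>A. L (u a))"
  using assms(3,4)
proof (induction A)
  case empty
  have "L (rscale 0 0) = 0 * L 0"
    using assms(2) rsubspaceD(1)[OF assms(1)] unfolding rlinear_on_def by blast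
  then show ?case using rsubspaceD(1)[OF assms(1)] by (simp add: zero_fun_def)
next
  case (insert a A)
  then have "u a \<in> S" "(\<Sum>a\<in>A. u a) \<in> S" "L (\<Sum>a\<in>A. u a) = (\<Sum>a\<in>A. L (u a))" by auto
  then show ?case
    using assms(2) rsubspaceD(2)[OF assms(1)]
    unfolding sum.insert[OF insert(1,2)] rlinear_on_def by metis
qed

lemma invariant_meanD:
  assumes "invariant_mean m"
  shows "bounded (range f) \<Longrightarrow> bounded (range h) \<Longrightarrow> m (\<lambda>x. f x + h x) = m f + m h"
    "bounded (range f) \<Longrightarrow> m (\<lambda>x. c * f x) = c * m f"
    "bounded (range f) \<Longrightarrow> (\<And>x. 0 \<le> f x) \<Longrightarrow> 0 \<le> m f"
    "m (\<lambda>x. 1) = 1"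
    "bounded (range f) \<Longrightarrow> m (\<lambda>x. f (g + x)) = m f"
  using assms unfolding invariant_mean_def by blast+

text \<open>A mean kills every sum of functions \<open>h g (g + x) - h g x\<close> and is positive.\<close>

lemma amenable_no_positive_coboundary:
  fixes h :: "'g::group_add \<Rightarrow> 'g \<Rightarrow> real"
  assumes "amenable TYPE('g)" "finite F" and bdd: "\<And>g x. \<bar>h g x\<bar> \<le> 1" and "e > 0"
  obtains x where "(\<Sum>g\<in>F. h g (g + x) - h g x) < e"
proof -
  obtain m :: "('g \<Rightarrow> real) \<Rightarrow> real" where "invariant_mean m" using assms(1) by (auto simp: amenable_def)
  note m = invariant_meanD[OF this]
  have b: "bounded (range (h g))" for g using bdd by (auto simp: bounded_iff)
  have b': "bounded (range (\<lambda>x. h g (g' + x)))" for g g' using bdd by (auto simp: bounded_iff)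
  have bc: "bounded (range (\<lambda>x::'g. c))" for c :: real by simp
  have bm: "bounded (range (\<lambda>x. -1 * h g x))" for g using bdd by (auto simp: bounded_iff)
  have *: "bounded (range (\<lambda>x. \<Sum>g\<in>A. h g (g + x) - h g x)) \<and> m (\<lambda>x. \<Sum>g\<in>A. h g (g + x) - h g x) = 0"
    if "finite A" for A
    using that
  proof (induction A)
    case empty
    show ?case using m(2)[OF bc, of 0 0] by simp
  next
    case (insert g A)
    have d: "bounded (range (\<lambda>x. h g (g + x) + -1 * h g x))" by (rule bounded_plus_comp[OF b' bm])
    have "m (\<lambda>x. h g (g + x) + -1 * h g x) = 0"
      unfolding m(1)[OF b' bm] m(2)[OF b] m(5)[OF b] by simp
    with insert m(1)[OF d, of "\<lambda>x. \<Sum>g\<in>A. h g (g + x) - h g x"] bounded_plus_comp[OF d]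
    show ?case by simp
  qed
  define s where "s x = (\<Sum>g\<in>F. h g (g + x) - h g x)" for x
  have s: "bounded (range s)" "m s = 0" using *[OF assms(2)] unfolding s_def by blast+
  have "\<exists>x. s x < e"
  proof (rule ccontr)
    assume "\<not> (\<exists>x. s x < e)"
    then have ge: "0 \<le> s x + (- e) * 1" for x by (simp add: not_less)
    have b2: "bounded (range (\<lambda>x::'g. (- e) * (1::real)))" by simp
    have "0 \<le> m (\<lambda>x. s x + (- e) * 1)"
      by (rule m(3)[OF bounded_plus_comp[OF s(1) b2] ge])
    also have "\<dots> = m s + - e * m (\<lambda>x. 1)"
      unfolding m(1)[OF s(1) b2] m(2)[OF bc] ..
    finally show False using s m(4) assms(4) by simp
  qed
  then show ?thesis using that by (auto simp: s_def)
qed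

text \<open>If every probability function were moved by at least \<open>e\<close> by some element of \<open>F\<close>, the set of the
  translation differences \<open>\<delta> f\<close> would have distance at least \<open>e\<close> from 0 in a space of type \<open>\<ell>\<^sup>1\<close>. A
  functional separating it from 0 consists of bounded functions \<open>h g\<close> that contradict the previous lemma. The separation is encoded in
  the sublinear functional \<open>p\<close>: a linear functional \<open>L \<le> p\<close> is bounded by the norm and satisfies
  \<open>L (\<delta> f) \<ge> e\<close> for all probability functions \<open>f\<close>. So that \<open>p\<close> is homogeneous, its infimum runs over the
  cone \<open>W\<close> spanned by these functions.\<close>

lemma amenable_imp_almost_invariant:
  fixes F :: "'g::group_add set"
  assumes am: "amenable TYPE('g)" and F: "finite F" and e: "e > 0"
  obtains f :: "'g \<Rightarrow> real" where "finite {x. f x \<noteq> 0}" "\<And>x. 0 \<le> f x" "(\<Sum>\<^sub>\<infinity>x. f x) = 1"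
    "\<And>g. g \<in> F \<Longrightarrow> (\<Sum>\<^sub>\<infinity>x. \<bar>f (- g + x) - f x\<bar>) < e"
proof (rule ccontr)
  note found = that
  assume neg: "\<not> thesis"
  define fin where "fin f \<longleftrightarrow> finite {x. f x \<noteq> 0}" for f :: "'g \<Rightarrow> real"
  have sm: "f summable_on UNIV" if "fin f" for f
    using that unfolding fin_def by (intro finite_nonzero_values_imp_summable_on) auto
  have fin_comp: "fin (\<lambda>x. k (f x))" if "fin f" "k 0 = 0" for f k
    using that unfolding fin_def by (metis (mono_tags, lifting) finite_subset mem_Collect_eq subsetI)
  have fin_add: "fin (\<lambda>x. f x + h x)" if "fin f" "fin h" for f h
    using that unfolding fin_def
    by (intro finite_subset[of "{x. f x + h x \<noteq> 0}" "{x. f x \<noteq> 0} \<union> {x. h x \<noteq> 0}"]) auto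
  have fin_translate: "fin (\<lambda>x. f (- g + x))" if "fin f" for f g
  proof -
    have "{x. f (- g + x) \<noteq> 0} \<subseteq> (+) g ` {x. f x \<noteq> 0}"
      by (auto intro!: image_eqI[of _ _ "- g + x" for x] simp: add.assoc[symmetric])
    then show ?thesis using that unfolding fin_def by (meson finite_imageI finite_subset)
  qed
  define l1 where "l1 f = (\<Sum>\<^sub>\<infinity>x. \<bar>f x\<bar>)" for f :: "'g \<Rightarrow> real"
  have l1_nonneg: "0 \<le> l1 f" for f by (simp add: l1_def infsum_nonneg)
  have l1_add: "l1 (\<lambda>x. f x + h x) \<le> l1 f + l1 h" if "fin f" "fin h" for f h
  proof -
    have "l1 (\<lambda>x. f x + h x) \<le> (\<Sum>\<^sub>\<infinity>x. \<bar>f x\<bar> + \<bar>h x\<bar>)"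
      unfolding l1_def
      by (rule infsum_mono) (use that in \<open>auto intro!: sm fin_add fin_comp[of _ abs] fin_comp[of "\<lambda>x. f x + h x" abs]\<close>)
    also have "\<dots> = l1 f + l1 h"
      unfolding l1_def by (rule infsum_add) (use that in \<open>auto intro!: sm fin_comp[of _ abs]\<close>)
    finally show ?thesis .
  qed
  have l1_scale: "l1 (\<lambda>x. c * f x) = \<bar>c\<bar> * l1 f" for c f
    by (simp add: l1_def abs_mult infsum_cmult_right')
  define S where "S = {u :: 'g \<times> 'g \<Rightarrow> real. finite {i. u i \<noteq> 0}}"
  have S: "rsubspace S"
    unfolding rsubspace_def
  proof (intro conjI ballI allI)
    fix u v assume "u \<in> S" "v \<in> S"
    then show "u + v \<in> S"
      unfolding S_def by (auto intro: finite_subset[of _ "{i. u i \<noteq> 0} \<union> {i. v i \<noteq> 0}"])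
  next
    fix u t assume "u \<in> S"
    then show "rscale t u \<in> S"
      unfolding S_def by (auto intro: finite_subset[of _ "{i. u i \<noteq> 0}"])
  qed (auto simp: S_def)
  note cl = rsubspaceD[OF S]
  have section_fin: "fin (\<lambda>y. u (g, y))" if "u \<in> S" for u g
  proof -
    have "{y. u (g, y) \<noteq> 0} \<subseteq> snd ` {i. u i \<noteq> 0}" by force
    then show ?thesis using that unfolding fin_def S_def by (auto dest: finite_subset)
  qed
  \<comment> \<open>Functions on \<open>F \<times> G\<close>, one for each element of \<open>F\<close>, are treated as functions on \<open>G \<times> G\<close>.\<close>
  define N where "N u = (\<Sum>g\<in>F. l1 (\<lambda>y. u (g, y)))" for u :: "'g \<times> 'g \<Rightarrow> real"
  have N_add: "N (u + v) \<le> N u + N v" if "u \<in> S" "v \<in> S" for u v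
    unfolding N_def sum.distrib[symmetric]
    by (rule sum_mono) (use that in \<open>auto intro!: l1_add section_fin\<close>)
  have N_scale: "N (rscale c u) = \<bar>c\<bar> * N u" for c u
    unfolding N_def sum_distrib_left by (simp add: l1_scale)
  have N_neg: "N (- u) = N u" for u
    using N_scale[of "-1" u] by (simp add: fun_Compl_def)
  define W where "W = {f :: 'g \<Rightarrow> real. fin f \<and> (\<forall>x. 0 \<le> f x)}"
  define mass where "mass f = (\<Sum>\<^sub>\<infinity>x. f x)" for f :: "'g \<Rightarrow> real"
  define \<delta> where "\<delta> f = (\<lambda>(g, y). if g \<in> F then f (- g + y) - f y else 0)" for f :: "'g \<Rightarrow> real"
  have \<delta>S: "\<delta> f \<in> S" if "fin f" for f
  proof -
    have "{i. \<delta> f i \<noteq> 0} \<subseteq> (\<Union>g\<in>F. Pair g ` ({y. f (- g + y) \<noteq> 0} \<union> {y. f y \<noteq> 0}))"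
      by (auto simp: \<delta>_def split: if_splits)
    moreover have "finite (\<Union>g\<in>F. Pair g ` ({y. f (- g + y) \<noteq> 0} \<union> {y. f y \<noteq> 0}))"
      using F that fin_translate[OF that] by (auto simp: fin_def)
    ultimately show ?thesis unfolding S_def by (auto dest: finite_subset)
  qed
  have N\<delta>: "N (\<delta> f) = (\<Sum>g\<in>F. l1 (\<lambda>y. f (- g + y) - f y))" for f
    unfolding N_def by (rule sum.cong) (auto simp: \<delta>_def)
  have prob: "e \<le> N (\<delta> f)" if "f \<in> W" "mass f = 1" for f
  proof -
    have "\<not> (\<forall>g\<in>F. l1 (\<lambda>y. f (- g + y) - f y) < e)"
      using neg found[of f] that by (auto simp: W_def mass_def fin_def l1_def)
    then obtain g where g: "g \<in> F" "e \<le> l1 (\<lambda>y. f (- g + y) - f y)"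
      by (auto simp: not_less)
    note g(2)
    also have "l1 (\<lambda>y. f (- g + y) - f y) \<le> N (\<delta> f)"
      unfolding N\<delta> by (rule member_le_sum[OF g(1)]) (auto simp: l1_nonneg F)
    finally show ?thesis .
  qed
  have mass_nonneg: "0 \<le> mass f" if "f \<in> W" for f
    using that by (auto simp: mass_def W_def intro!: infsum_nonneg)
  have W_scale: "rscale t f \<in> W" if "f \<in> W" "t \<ge> 0" for t f
    using that fin_comp[of f "(*) t"] by (auto simp: W_def)
  have W_add: "f + h \<in> W" if "f \<in> W" "h \<in> W" for f h
    using that fin_add[of f h] by (auto simp: W_def plus_fun_def)
  have mass_scale: "mass (rscale t f) = t * mass f" for t f
    by (simp add: mass_def infsum_cmult_right')
  have mass_add: "mass (f + h) = mass f + mass h" if "f \<in> W" "h \<in> W" for f h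
    using that by (auto simp: mass_def W_def plus_fun_def intro!: infsum_add sm)
  have \<delta>_scale: "\<delta> (rscale t f) = rscale t (\<delta> f)" for t f
    by (auto simp: \<delta>_def fun_eq_iff algebra_simps)
  have \<delta>_add: "\<delta> (f + h) = \<delta> f + \<delta> h" for f h
    by (auto simp: \<delta>_def fun_eq_iff algebra_simps)
  have cone: "e * mass f \<le> N (\<delta> f)" if f: "f \<in> W" for f
  proof (cases "mass f = 0")
    case True then show ?thesis by (simp add: N_def sum_nonneg l1_nonneg)
  next
    case False
    with mass_nonneg[OF f] have pos: "mass f > 0" by simp
    have "e \<le> N (\<delta> (rscale (1 / mass f) f))"
      by (rule prob[OF W_scale[OF f]]) (use pos in \<open>auto simp only: mass_scale, auto\<close>)
    then show ?thesis using pos unfolding \<delta>_scale N_scale by (simp add: field_simps)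
  qed
  define X where "X u = (\<lambda>f. N (u + \<delta> f) - e * mass f) ` W" for u
  define p where "p u = Inf (X u)" for u
  have W0: "(\<lambda>x. 0) \<in> W" by (auto simp: W_def fin_def)
  have \<delta>0: "\<delta> (\<lambda>x. 0) = 0" by (auto simp: \<delta>_def fun_eq_iff)
  have mass0: "mass (\<lambda>x. 0) = 0" by (simp add: mass_def)
  have finW: "fin f" if "f \<in> W" for f using that by (simp add: W_def)
  have bdd: "bdd_below (X u)" if u: "u \<in> S" for u
    unfolding X_def
  proof (rule bdd_belowI2)
    fix f assume f: "f \<in> W"
    have "N (\<delta> f) = N ((u + \<delta> f) + - u)" by simp
    also have "\<dots> \<le> N (u + \<delta> f) + N (- u)"
      by (intro N_add cl u \<delta>S finW f)
    finally show "- N u \<le> N (u + \<delta> f) - e * mass f" using cone[OF f] by (simp add: N_neg)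
  qed
  have p_le: "p u \<le> N (u + \<delta> f) - e * mass f" if "u \<in> S" "f \<in> W" for u f
    unfolding p_def by (rule cInf_lower[OF _ bdd[OF that(1)]]) (use that in \<open>auto simp: X_def\<close>)
  have p_ge: "c \<le> p u" if "\<And>f. f \<in> W \<Longrightarrow> c \<le> N (u + \<delta> f) - e * mass f" for u c
    unfolding p_def by (rule cInf_greatest) (use that W0 in \<open>auto simp: X_def\<close>)
  have "sublinear_on S p"
    unfolding sublinear_on_def
  proof (intro conjI ballI allI impI)
    fix u v assume u: "u \<in> S" and v: "v \<in> S"
    have *: "p (u + v) - (N (v + \<delta> h) - e * mass h) \<le> N (u + \<delta> f) - e * mass f"
      if f: "f \<in> W" and h: "h \<in> W" for f h
    proof -
      have "p (u + v) \<le> N (u + v + \<delta> (f + h)) - e * mass (f + h)"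
        by (rule p_le[OF cl(2)[OF u v] W_add[OF f h]])
      also have "u + v + \<delta> (f + h) = (u + \<delta> f) + (v + \<delta> h)"
        unfolding \<delta>_add by (simp only: ac_simps)
      also have "N \<dots> \<le> N (u + \<delta> f) + N (v + \<delta> h)"
        by (intro N_add cl u v \<delta>S finW f h)
      finally show ?thesis
        unfolding mass_add[OF f h] distrib_left[of e] by linarith
    qed
    have "p (u + v) - p u \<le> N (v + \<delta> h) - e * mass h" if h: "h \<in> W" for h
      using p_ge[OF *[OF _ h]] by linarith
    from p_ge[OF this] show "p (u + v) \<le> p u + p v" by linarith
  next
    fix t :: real and u assume t: "t > 0" and u: "u \<in> S"
    have "p (rscale t u) / t \<le> N (u + \<delta> f) - e * mass f" if f: "f \<in> W" for f
    proof -
      have "p (rscale t u) \<le> N (rscale t u + \<delta> (rscale t f)) - e * mass (rscale t f)"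
        by (rule p_le) (use u f t in \<open>auto intro!: cl W_scale\<close>)
      also have "rscale t u + \<delta> (rscale t f) = rscale t (u + \<delta> f)"
        unfolding \<delta>_scale by (auto simp: fun_eq_iff algebra_simps)
      also have "N (rscale t (u + \<delta> f)) - e * mass (rscale t f) = (N (u + \<delta> f) - e * mass f) * t"
        unfolding N_scale mass_scale abs_of_pos[OF t] left_diff_distrib by (simp only: ac_simps)
      finally show ?thesis using t by (simp only: pos_divide_le_eq)
    qed
    from p_ge[OF this] show "p (rscale t u) \<le> t * p u" using t by (simp add: field_simps)
  qed
  from hahn_banach[OF S this] obtain L where lin: "rlinear_on S L" and Lp: "\<And>u. u \<in> S \<Longrightarrow> L u \<le> p u"
    by blast
  have L_neg: "L (- u) = - L u" if "u \<in> S" for u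
  proof -
    have "L (rscale (-1) u) = -1 * L u" using lin that unfolding rlinear_on_def by blast
    moreover have "rscale (-1) u = - u" by (auto simp: fun_eq_iff)
    ultimately show ?thesis by simp
  qed
  have L_add: "L (u + v) = L u + L v" if "u \<in> S" "v \<in> S" for u v
    using lin that unfolding rlinear_on_def by blast
  have L\<delta>: "e * mass f \<le> L (\<delta> f)" if f: "f \<in> W" for f
  proof -
    have "L (- \<delta> f) \<le> N (- \<delta> f + \<delta> f) - e * mass f"
      using Lp[OF cl(4)[OF \<delta>S[OF finW[OF f]]]] p_le[OF cl(4)[OF \<delta>S[OF finW[OF f]]] f] by linarith
    moreover have "N (- \<delta> f + \<delta> f) = 0" by (simp add: N_def l1_def)
    ultimately show ?thesis using L_neg[OF \<delta>S[OF finW[OF f]]] by simp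
  qed
  have L_le: "L u \<le> N u" if "u \<in> S" for u
    using Lp[OF that] p_le[OF that W0] by (simp add: \<delta>0 mass0)
  define E where "E i = (\<lambda>j. if j = i then 1 else (0::real))" for i :: "'g \<times> 'g"
  \<comment> \<open>\<open>L\<close> is given on finitely supported functions by its values at the point masses.\<close>
  define h where "h g y = L (E (g, y))" for g y
  have ES: "E i \<in> S" for i by (auto simp: E_def S_def)
  have NE: "N (E (g, y)) \<le> 1" for g y
  proof -
    have "l1 (\<lambda>z. E (g, y) (g', z)) = (if g' = g then 1 else 0)" for g'
    proof (cases "g' = g")
      case True
      have "(\<Sum>\<^sub>\<infinity>z. \<bar>if z = y then 1 else (0::real)\<bar>) = (\<Sum>\<^sub>\<infinity>z\<in>{y}. 1)"
        by (rule infsum_cong_neutral) auto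
      with True show ?thesis by (simp add: l1_def E_def)
    qed (simp add: l1_def E_def)
    then show ?thesis using F by (simp add: N_def)
  qed
  have h: "\<bar>h g y\<bar> \<le> 1" for g y
    using L_le[OF ES[of "(g, y)"]] L_le[OF cl(4)[OF ES[of "(g, y)"]]] NE[of g y]
    unfolding N_neg L_neg[OF ES] h_def by linarith
  have "e \<le> (\<Sum>g\<in>F. h g (g + x) - h g x)" for x
  proof -
    define s where "s y = (if y = x then 1 else (0::real))" for y
    have s: "s \<in> W" by (auto simp: W_def s_def fin_def)
    have "mass s = (\<Sum>\<^sub>\<infinity>z\<in>{x}. 1)"
      unfolding mass_def s_def by (rule infsum_cong_neutral) auto
    then have "e \<le> L (\<delta> s)" using L\<delta>[OF s] by simp
    also have "\<delta> s = (\<Sum>g\<in>F. E (g, g + x) + - E (g, x))"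
    proof
      fix i :: "'g \<times> 'g"
      obtain k y where i: "i = (k, y)" by (cases i)
      have eq: "- k + y = x \<longleftrightarrow> y = k + x" by (metis add.assoc add.left_neutral add.right_inverse left_minus)
      have "(\<Sum>g\<in>F. E (g, g + x) + - E (g, x)) i = (\<Sum>g\<in>F. if g = k then s (- k + y) - s y else 0)"
        unfolding i sum_fun_apply by (rule sum.cong) (auto simp: E_def s_def eq)
      then show "\<delta> s i = (\<Sum>g\<in>F. E (g, g + x) + - E (g, x)) i"
        using F by (simp add: \<delta>_def i)
    qed
    also have "L \<dots> = (\<Sum>g\<in>F. L (E (g, g + x) + - E (g, x)))"
      by (intro rlinear_on_sum[OF S lin F, THEN conjunct2] cl ES)
    also have "\<dots> = (\<Sum>g\<in>F. h g (g + x) - h g x)"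
      unfolding h_def L_add[OF ES cl(4)[OF ES]] L_neg[OF ES] by simp
    finally show ?thesis .
  qed
  with amenable_no_positive_coboundary[where h = h, OF am F h e] show False by (meson not_less)
qed

section \<open>Means from bounded invariant functionals\<close>

text \<open>The positive part of a bounded functional, whose value at \<open>f \<ge> 0\<close> is the supremum of the functional
  over \<open>0 \<le> h \<le> f\<close>, is linear and positive. It inherits invariance, since translation permutes the sets
  over which the suprema are taken, and its value at 1 is at least that of the given functional, so
  that it can be normalized.\<close>

lemma amenable_if_bounded_invariant_functional:
  fixes n :: "('g::group_add \<Rightarrow> real) \<Rightarrow> real"
  assumes add: "\<And>f h. bounded (range f) \<Longrightarrow> bounded (range h) \<Longrightarrow> n (\<lambda>x. f x + h x) = n f + n h"
    and scale: "\<And>c f. bounded (range f) \<Longrightarrow> n (\<lambda>x. c * f x) = c * n f"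
    and bound: "\<And>f. (\<And>x. \<bar>f x\<bar> \<le> 1) \<Longrightarrow> n f \<le> C"
    and one: "n (\<lambda>x. 1) = 1"
    and invariant: "\<And>g f. bounded (range f) \<Longrightarrow> n (\<lambda>x. f (g + x)) = n f"
  shows "amenable TYPE('g)"
proof -
  have bddI: "bounded (range f)" if "\<And>x. \<bar>f x\<bar> \<le> K" for f :: "'g \<Rightarrow> real" and K
    using that by (auto simp: bounded_iff)
  have bddE: "\<exists>K>0. \<forall>x. \<bar>f x\<bar> \<le> K" if "bounded (range f)" for f :: "'g \<Rightarrow> real"
    using that by (auto simp: bounded_pos)
  define pos where "pos f \<longleftrightarrow> bounded (range f) \<and> (\<forall>x. 0 \<le> f x)" for f :: "'g \<Rightarrow> real"
  define X where "X f = n ` {h. \<forall>x. 0 \<le> h x \<and> h x \<le> f x}" for f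
  define P where "P f = Sup (X f)" for f
  have sub: "bounded (range h)" if "pos f" "\<forall>x. 0 \<le> h x \<and> h x \<le> f x" for f h
  proof -
    obtain K where "\<And>x. \<bar>f x\<bar> \<le> K" using bddE[of f] \<open>pos f\<close> by (auto simp: pos_def)
    then show ?thesis using that(2) by (intro bddI[of _ K]) (smt (verit))
  qed
  have bddX: "bdd_above (X f)" if f: "pos f" for f
  proof -
    obtain K where K: "K > 0" "\<And>x. \<bar>f x\<bar> \<le> K" using bddE[of f] f by (auto simp: pos_def)
    have "n h \<le> K * C" if h: "\<forall>x. 0 \<le> h x \<and> h x \<le> f x" for h
    proof -
      have "n (\<lambda>x. 1 / K * h x) \<le> C"
      proof (rule bound)
        fix x show "\<bar>1 / K * h x\<bar> \<le> 1" using h[rule_format, of x] K(2)[of x] K(1) by simp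
      qed
      then show ?thesis
        using K(1) unfolding scale[OF sub[OF f h], of "1/K"] by (simp add: field_simps)
    qed
    then show ?thesis by (auto simp: X_def bdd_above_def)
  qed
  have neX: "X f \<noteq> {}" if "pos f" for f
    using that by (auto simp: X_def pos_def)
  have le_P: "n h \<le> P f" if "pos f" "\<forall>x. 0 \<le> h x \<and> h x \<le> f x" for f h
    unfolding P_def by (rule cSup_upper[OF _ bddX[OF that(1)]]) (use that in \<open>auto simp: X_def\<close>)
  have P_le: "P f \<le> c" if "pos f" "\<And>h. \<forall>x. 0 \<le> h x \<and> h x \<le> f x \<Longrightarrow> n h \<le> c" for f c
    unfolding P_def by (rule cSup_least[OF neX[OF that(1)]]) (use that in \<open>auto simp: X_def\<close>)
  have pos_add: "pos (\<lambda>x. f x + h x)" if "pos f" "pos h" for f h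
    using that bounded_plus_comp[of f UNIV h] by (auto simp: pos_def)
  have pos_scale: "pos (\<lambda>x. c * f x)" if "pos f" "c \<ge> 0" for f c
    using that bounded_scaling[of "range f" c] by (auto simp: pos_def image_image)
  have n0: "n (\<lambda>x. 0) = 0" using scale[of "\<lambda>x. 0" 0] by simp
  have P_nonneg: "0 \<le> P f" if "pos f" for f
    using le_P[OF that, of "\<lambda>x. 0"] that n0 by (auto simp: pos_def)
  have P_add: "P (\<lambda>x. f x + h x) = P f + P h" if f: "pos f" and h: "pos h" for f h
  proof (rule antisym)
    show "P (\<lambda>x. f x + h x) \<le> P f + P h"
    proof (rule P_le[OF pos_add[OF f h]])
      fix k assume k: "\<forall>x. 0 \<le> k x \<and> k x \<le> f x + h x"
      \<comment> \<open>The Riesz decomposition of \<open>k \<le> f + h\<close> into parts below \<open>f\<close> and below \<open>h\<close>.\<close>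
      define a where "a x = min (k x) (f x)" for x
      define b where "b x = k x - a x" for x
      have a: "\<forall>x. 0 \<le> a x \<and> a x \<le> f x" using k f by (auto simp: a_def pos_def)
      have b: "\<forall>x. 0 \<le> b x \<and> b x \<le> h x"
        using k f h by (auto simp: a_def b_def pos_def min_def algebra_simps)
      have "n k = n (\<lambda>x. a x + b x)" by (simp add: b_def)
      also have "\<dots> = n a + n b" by (intro add sub[OF f a] sub[OF h b])
      also have "\<dots> \<le> P f + P h" by (intro add_mono le_P f h a b)
      finally show "n k \<le> P f + P h" .
    qed
    have "P f \<le> P (\<lambda>x. f x + h x) - n b" if b: "\<forall>x. 0 \<le> b x \<and> b x \<le> h x" for b
    proof (rule P_le[OF f])
      fix a assume a: "\<forall>x. 0 \<le> a x \<and> a x \<le> f x"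
      have "n a + n b = n (\<lambda>x. a x + b x)" by (intro add[symmetric] sub[OF f a] sub[OF h b])
      also have "\<dots> \<le> P (\<lambda>x. f x + h x)"
        by (intro le_P pos_add f h) (use a b in \<open>auto intro: add_mono\<close>)
      finally show "n a \<le> P (\<lambda>x. f x + h x) - n b" by simp
    qed
    then have "P h \<le> P (\<lambda>x. f x + h x) - P f" by (intro P_le[OF h]) (auto simp: algebra_simps)
    then show "P f + P h \<le> P (\<lambda>x. f x + h x)" by simp
  qed
  have P_scale_le: "P (\<lambda>x. c * f x) \<le> c * P f" if f: "pos f" and c: "c > 0" for f c
  proof (rule P_le[OF pos_scale[OF f]])
    show "0 \<le> c" using c by simp
    fix k assume k: "\<forall>x. 0 \<le> k x \<and> k x \<le> c * f x"
    have "n (\<lambda>x. 1 / c * k x) \<le> P f"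
      by (rule le_P[OF f]) (use k c in \<open>auto simp: field_simps\<close>)
    moreover have "bounded (range k)" using sub[OF pos_scale[OF f] k] c by simp
    ultimately have "1 / c * n k \<le> P f" using scale[of k "1/c"] by simp
    then show "n k \<le> c * P f" using c by (simp add: field_simps)
  qed
  have P_scale: "P (\<lambda>x. c * f x) = c * P f" if f: "pos f" and c: "c \<ge> 0" for f c
  proof (cases "c = 0")
    case True
    have "P (\<lambda>x. 0) = 0" using P_add[of "\<lambda>x. 0" "\<lambda>x. 0"] by (auto simp: pos_def)
    with True show ?thesis by simp
  next
    case False
    with c have c: "c > 0" by simp
    have "P (\<lambda>x. 1 / c * (c * f x)) \<le> 1 / c * P (\<lambda>x. c * f x)"
      by (rule P_scale_le) (use c pos_scale[OF f] in auto)
    then have "c * P f \<le> P (\<lambda>x. c * f x)" using c by (simp add: field_simps)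
    with P_scale_le[OF f c] show ?thesis by simp
  qed
  have translate: "bounded (range (\<lambda>x. f (g + x)))" if "bounded (range f)" for f :: "'g \<Rightarrow> real" and g
    by (rule bounded_subset[OF that]) auto
  have pos_translate: "pos (\<lambda>x. f (g + x))" if "pos f" for f g
    using that translate[of f g] by (auto simp: pos_def)
  have P_translate_le: "P (\<lambda>x. f (g + x)) \<le> P f" if f: "pos f" for f g
  proof (rule P_le[OF pos_translate[OF f]])
    fix k assume k: "\<forall>x. 0 \<le> k x \<and> k x \<le> f (g + x)"
    have "n (\<lambda>x. k (- g + x)) = n k"
      by (rule invariant[OF sub[OF pos_translate[OF f] k]])
    moreover have "n (\<lambda>x. k (- g + x)) \<le> P f"
    proof (rule le_P[OF f], intro allI)
      fix x show "0 \<le> k (- g + x) \<and> k (- g + x) \<le> f x"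
        using k[rule_format, of "- g + x"] by (simp add: add.assoc[symmetric])
    qed
    ultimately show "n k \<le> P f" by simp
  qed
  have P_translate: "P (\<lambda>x. f (g + x)) = P f" if f: "pos f" for f g
    using P_translate_le[OF f, of g] P_translate_le[OF pos_translate[OF f, of g], of "- g"]
    by (simp add: add.assoc[symmetric])
  have P1: "1 \<le> P (\<lambda>x. 1)" using le_P[of "\<lambda>x. 1" "\<lambda>x. 1"] one by (auto simp: pos_def)
  define M where "M f = P (\<lambda>x. max (f x) 0) - P (\<lambda>x. max (- f x) 0)" for f
  have pp: "pos (\<lambda>x. max (f x) 0)" and pm: "pos (\<lambda>x. max (- f x) 0)" if f: "bounded (range f)" for f
  proof -
    obtain K where K: "\<And>x. \<bar>f x\<bar> \<le> K" using bddE[OF f] by auto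
    have "\<bar>max (f x) 0\<bar> \<le> K \<and> \<bar>max (- f x) 0\<bar> \<le> K" for x using K[of x] by (auto simp: max_def)
    then show "pos (\<lambda>x. max (f x) 0)" "pos (\<lambda>x. max (- f x) 0)"
      by (auto simp: pos_def intro!: bddI[of _ K])
  qed
  \<comment> \<open>Any decomposition into nonnegative functions gives \<open>M\<close>, which makes linearity immediate.\<close>
  have M_diff: "M f = P a - P b" if f: "bounded (range f)" and a: "pos a" and b: "pos b"
    and eq: "\<And>x. f x = a x - b x" for f a b
  proof -
    have "(\<lambda>x. max (f x) 0 + b x) = (\<lambda>x. a x + max (- f x) 0)" by (auto simp: eq max_def)
    then have "P (\<lambda>x. max (f x) 0) + P b = P a + P (\<lambda>x. max (- f x) 0)"
      using P_add[OF pp[OF f] b] P_add[OF a pm[OF f]] by simp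
    then show ?thesis by (simp add: M_def)
  qed
  define m where "m f = M f / P (\<lambda>x. 1)" for f
  have "invariant_mean m"
    unfolding invariant_mean_def
  proof (intro conjI allI impI)
    fix f h :: "'g \<Rightarrow> real" assume f: "bounded (range f)" and h: "bounded (range h)"
    have "M (\<lambda>x. f x + h x) = P (\<lambda>x. max (f x) 0 + max (h x) 0) - P (\<lambda>x. max (- f x) 0 + max (- h x) 0)"
      by (intro M_diff pos_add pp pm f h) (auto intro: bounded_plus_comp f h)
    also have "\<dots> = M f + M h"
      unfolding P_add[OF pp[OF f] pp[OF h]] P_add[OF pm[OF f] pm[OF h]] by (simp add: M_def)
    finally show "m (\<lambda>x. f x + h x) = m f + m h" by (simp add: m_def add_divide_distrib)
  next
    fix c and f :: "'g \<Rightarrow> real" assume f: "bounded (range f)"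
    have cf: "bounded (range (\<lambda>x. c * f x))"
      using bounded_scaling[OF f, of c] by (simp add: image_image)
    have "M (\<lambda>x. c * f x) = c * M f"
    proof (cases "c \<ge> 0")
      case True
      have "M (\<lambda>x. c * f x) = P (\<lambda>x. c * max (f x) 0) - P (\<lambda>x. c * max (- f x) 0)"
        by (intro M_diff cf pos_scale pp pm f True) (auto simp: max_def algebra_simps)
      then show ?thesis
        unfolding P_scale[OF pp[OF f] True] P_scale[OF pm[OF f] True] by (simp add: M_def algebra_simps)
    next
      case False
      then have c: "- c \<ge> 0" by simp
      have "M (\<lambda>x. c * f x) = P (\<lambda>x. - c * max (- f x) 0) - P (\<lambda>x. - c * max (f x) 0)"
        by (intro M_diff cf pos_scale pp pm f c) (auto simp: max_def algebra_simps)
      then show ?thesis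
        unfolding P_scale[OF pp[OF f] c] P_scale[OF pm[OF f] c] by (simp add: M_def algebra_simps)
    qed
    then show "m (\<lambda>x. c * f x) = c * m f" by (simp add: m_def)
  next
    fix f :: "'g \<Rightarrow> real" assume f: "bounded (range f)" and nonneg: "\<forall>x. 0 \<le> f x"
    then have "M f = P f - P (\<lambda>x. 0)" by (intro M_diff) (auto simp: pos_def)
    moreover have "P (\<lambda>x. 0) = 0" using P_scale[of "\<lambda>x. 0" 0] by (auto simp: pos_def)
    ultimately show "0 \<le> m f"
      using P_nonneg[of f] f nonneg P1 by (simp add: m_def pos_def)
  next
    have "M (\<lambda>x. 1) = P (\<lambda>x. 1) - P (\<lambda>x. 0)" by (intro M_diff) (auto simp: pos_def)
    moreover have "P (\<lambda>x. 0) = 0" using P_scale[of "\<lambda>x. 0" 0] by (auto simp: pos_def)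
    ultimately show "m (\<lambda>x. 1) = 1" using P1 by (simp add: m_def)
  next
    fix g and f :: "'g \<Rightarrow> real" assume f: "bounded (range f)"
    show "m (\<lambda>x. f (g + x)) = m f"
      using P_translate[OF pp[OF f], of g] P_translate[OF pm[OF f], of g] by (simp add: m_def M_def)
  qed
  then show ?thesis by (auto simp: amenable_def)
qed

section \<open>Seminormed spaces and their duals\<close>

lemma scaleC_0_left [simp]: "0 *\<^sub>C (x::'a::complex_vector) = 0"
  using scaleC_add_left[of 0 0 x] by simp

lemma scaleC_0_right [simp]: "c *\<^sub>C (0::'a::complex_vector) = 0"
  using scaleC_add_right[of c 0 "0::'a"] by simp

lemma scaleC_minus_one: "(-1) *\<^sub>C x = - (x::'a::complex_vector)"
  using scaleC_add_left[of "-1" 1 x] by (simp add: scaleC_one eq_neg_iff_add_eq_0)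

lemma csubspaceD:
  assumes "csubspace E"
  shows "0 \<in> E" "u \<in> E \<Longrightarrow> v \<in> E \<Longrightarrow> u + v \<in> E" "u \<in> E \<Longrightarrow> c *\<^sub>C u \<in> E"
    "u \<in> E \<Longrightarrow> - u \<in> E" "u \<in> E \<Longrightarrow> v \<in> E \<Longrightarrow> u - v \<in> E"
proof -
  show "0 \<in> E" and add: "\<And>u v. u \<in> E \<Longrightarrow> v \<in> E \<Longrightarrow> u + v \<in> E" and sc: "\<And>c u. u \<in> E \<Longrightarrow> c *\<^sub>C u \<in> E"
    using assms by (auto simp: csubspace_def)
  show neg: "- u \<in> E" if "u \<in> E" for u
    using sc[OF that, of "-1"] by (simp add: scaleC_minus_one)
  show "u - v \<in> E" if "u \<in> E" "v \<in> E"
    using add[OF that(1) neg[OF that(2)]] by simp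
qed

lemma clinear_on_zero: "csubspace E \<Longrightarrow> clinear_on E T \<Longrightarrow> T 0 = 0"
  using csubspaceD(1)[of E] unfolding clinear_on_def by (metis scaleC_0_left)

lemma clinear_on_diff:
  assumes "csubspace E" "clinear_on E T" "u \<in> E" "v \<in> E"
  shows "T (u - v) = T u - T v"
proof -
  have "T (u + (-1) *\<^sub>C v) = T u + (-1) *\<^sub>C T v"
    using assms csubspaceD(3)[OF assms(1,4)] unfolding clinear_on_def by metis
  then show ?thesis by (simp add: scaleC_minus_one)
qed

locale seminormed_space =
  fixes E :: "'a::complex_vector seminormed"
  assumes subspace: "csubspace (points E)"
    and snorm_nonneg: "u \<in> points E \<Longrightarrow> 0 \<le> snorm E i u"
    and snorm_scale: "u \<in> points E \<Longrightarrow> snorm E i (c *\<^sub>C u) = cmod c * snorm E i u"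
    and snorm_triangle: "u \<in> points E \<Longrightarrow> v \<in> points E \<Longrightarrow> snorm E i (u + v) \<le> snorm E i u + snorm E i v"
    and snorm_mono: "u \<in> points E \<Longrightarrow> i \<le> j \<Longrightarrow> snorm E i u \<le> snorm E j u"
begin

lemmas closed = csubspaceD[OF subspace]

lemma snorm_zero: "snorm E i 0 = 0"
  using snorm_scale[OF closed(1), of i 0] by simp

lemma snorm_neg: "u \<in> points E \<Longrightarrow> snorm E i (- u) = snorm E i u"
  using snorm_scale[of u i "-1"] by (simp add: scaleC_minus_one)

lemma topspace_seminorm_topology: "topspace (seminorm_topology E) = points E"
proof -
  have "u \<in> \<Union>{{v \<in> points E. snorm E i (v - u) < e} |i u e. u \<in> points E \<and> e > 0}"
    if "u \<in> points E" for u
  proof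
    show "u \<in> {v \<in> points E. snorm E 0 (v - u) < 1}" using that by (simp add: snorm_zero)
    show "{v \<in> points E. snorm E 0 (v - u) < 1} \<in> {{v \<in> points E. snorm E i (v - u) < e} |i u e. u \<in> points E \<and> e > 0}"
      using that zero_less_one by blast
  qed
  then show ?thesis
    unfolding seminorm_topology_def topology_generated_by_topspace by auto
qed

text \<open>The balls around a point are a neighbourhood basis, not just a subbasis, because the seminorms
  increase with the index.\<close>

lemma openin_seminorm_topology:
  "openin (seminorm_topology E) U \<longleftrightarrow>
     U \<subseteq> points E \<and> (\<forall>u\<in>U. \<exists>i e. e > 0 \<and> {v \<in> points E. snorm E i (v - u) < e} \<subseteq> U)" (is "?L \<longleftrightarrow> ?R")
proof
  assume L: ?L
  let ?B = "{{v \<in> points E. snorm E i (v - u) < e} |i u e. u \<in> points E \<and> e > 0}"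
  have "generate_topology_on ?B U"
    using L by (simp add: seminorm_topology_def openin_topology_generated_by_iff)
  then have "\<forall>u\<in>U. \<exists>i e. e > 0 \<and> {v \<in> points E. snorm E i (v - u) < e} \<subseteq> U"
  proof induction
    case Empty then show ?case by simp
  next
    case (Int a b)
    show ?case
    proof
      fix u assume u: "u \<in> a \<inter> b"
      obtain i e where 1: "e > 0" "{v \<in> points E. snorm E i (v - u) < e} \<subseteq> a"
        using Int u by blast
      obtain j d where 2: "d > 0" "{v \<in> points E. snorm E j (v - u) < d} \<subseteq> b"
        using Int u by blast
      have up: "u \<in> points E"
      proof -
        have "generate_topology_on ?B (a \<inter> b)" using Int by (intro generate_topology_on.Int)
        then have "a \<inter> b \<subseteq> topspace (seminorm_topology E)"
          by (intro openin_subset) (simp add: seminorm_topology_def openin_topology_generated_by_iff)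
        with u show ?thesis by (auto simp: topspace_seminorm_topology)
      qed
      have "{v \<in> points E. snorm E (max i j) (v - u) < min e d} \<subseteq> a \<inter> b"
      proof
        fix v assume v: "v \<in> {v \<in> points E. snorm E (max i j) (v - u) < min e d}"
        then have "snorm E i (v - u) \<le> snorm E (max i j) (v - u)"
          "snorm E j (v - u) \<le> snorm E (max i j) (v - u)"
          using up by (auto intro!: snorm_mono closed)
        with v 1 2 show "v \<in> a \<inter> b" by (auto dest!: subsetD)
      qed
      then show "\<exists>i e. e > 0 \<and> {v \<in> points E. snorm E i (v - u) < e} \<subseteq> a \<inter> b"
        using 1 2 by (intro exI[of _ "max i j"] exI[of _ "min e d"]) auto
    qed
  next
    case (UN K) then show ?case by (meson Union_iff Union_upper subset_trans)
  next
    case (Basis s)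
    then obtain i w e where s: "s = {v \<in> points E. snorm E i (v - w) < e}" "w \<in> points E" "e > 0" by blast
    show ?case
    proof
      fix u assume u: "u \<in> s"
      have "snorm E i (v - w) < e" if v: "v \<in> points E" "snorm E i (v - u) < e - snorm E i (u - w)" for v
        using snorm_triangle[of "v - u" "u - w" i] v u s closed(5) by auto
      then show "\<exists>i e. e > 0 \<and> {v \<in> points E. snorm E i (v - u) < e} \<subseteq> s"
        using u s by (intro exI[of _ i] exI[of _ "e - snorm E i (u - w)"]) auto
    qed
  qed
  with openin_subset[OF L] show ?R by (simp add: topspace_seminorm_topology)
next
  assume R: ?R
  show ?L
    unfolding openin_subopen[of _ U]
  proof
    fix u assume u: "u \<in> U"
    then obtain i e where e: "e > 0" "{v \<in> points E. snorm E i (v - u) < e} \<subseteq> U" using R by blast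
    have "openin (seminorm_topology E) {v \<in> points E. snorm E i (v - u) < e}"
      unfolding seminorm_topology_def using e u R
      by (intro topology_generated_by_Basis) blast
    moreover have "u \<in> {v \<in> points E. snorm E i (v - u) < e}" using u R e by (auto simp: snorm_zero)
    ultimately show "\<exists>T. openin (seminorm_topology E) T \<and> u \<in> T \<and> T \<subseteq> U" using e by blast
  qed
qed

text \<open>Scale \<open>u\<close> to seminorm \<open>e / 2\<close>, which lies strictly inside the ball; hence the constant 2. If the
  seminorm of \<open>u\<close> vanishes, the ball contains all multiples of \<open>u\<close>.\<close>

lemma clinear_bound_from_ball:
  assumes lin: "clinear_on (points E) (\<alpha> :: 'a \<Rightarrow> complex)" and e: "e > 0"
    and ball: "\<And>v. v \<in> points E \<Longrightarrow> snorm E i v < e \<Longrightarrow> cmod (\<alpha> v) \<le> K" and u: "u \<in> points E"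
  shows "cmod (\<alpha> u) \<le> 2 * K / e * snorm E i u"
proof -
  have scaled: "t * cmod (\<alpha> u) \<le> K" if t: "t \<ge> 0" "t * snorm E i u < e" for t
  proof -
    have "cmod (\<alpha> (complex_of_real t *\<^sub>C u)) \<le> K"
      using t by (intro ball closed u) (simp add: snorm_scale u)
    moreover have "\<alpha> (complex_of_real t *\<^sub>C u) = t * \<alpha> u"
      using lin u by (auto simp: clinear_on_def scaleC_complex_def)
    ultimately show ?thesis using t by (simp add: norm_mult)
  qed
  show ?thesis
  proof (cases "snorm E i u = 0")
    case True
    have "t * cmod (\<alpha> u) \<le> K" if "t \<ge> 0" for t using scaled[of t] that True e by simp
    then have "cmod (\<alpha> u) = 0"
    proof -
      have K: "K \<ge> 0" using scaled[of 0] e by simp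
      have "\<not> cmod (\<alpha> u) > 0"
      proof
        assume a: "cmod (\<alpha> u) > 0"
        have "(K + 1) / cmod (\<alpha> u) * cmod (\<alpha> u) \<le> K"
          using a K \<open>\<And>t. t \<ge> 0 \<Longrightarrow> t * cmod (\<alpha> u) \<le> K\<close>[of "(K + 1) / cmod (\<alpha> u)"] by simp
        with a show False by simp
      qed
      then show ?thesis by simp
    qed
    with True show ?thesis by simp
  next
    case False
    then have pos: "snorm E i u > 0" using snorm_nonneg[OF u, of i] by simp
    from scaled[of "e / (2 * snorm E i u)"] show ?thesis using pos e by (simp add: field_simps)
  qed
qed

lemma cdual_iff:
  "\<alpha> \<in> cdual E \<longleftrightarrow> (\<forall>\<phi>. \<phi> \<notin> points E \<longrightarrow> \<alpha> \<phi> = 0) \<and> clinear_on (points E) \<alpha> \<and>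
     (\<exists>i C. \<forall>\<phi>\<in>points E. cmod (\<alpha> \<phi>) \<le> C * snorm E i \<phi>)"
proof -
  have "continuous_map (seminorm_topology E) euclidean \<alpha> \<longleftrightarrow>
        (\<exists>i C. \<forall>\<phi>\<in>points E. cmod (\<alpha> \<phi>) \<le> C * snorm E i \<phi>)" (is "?L \<longleftrightarrow> ?R")
    if lin: "clinear_on (points E) \<alpha>"
  proof
    assume L: ?L
    have "openin (seminorm_topology E) {u \<in> points E. \<alpha> u \<in> ball 0 1}"
      using openin_continuous_map_preimage[OF L, of "ball 0 1"] by (simp add: topspace_seminorm_topology)
    moreover have "0 \<in> {u \<in> points E. \<alpha> u \<in> ball 0 1}"
      using clinear_on_zero[OF subspace lin] closed(1) by simp
    ultimately have "\<exists>i e. e > 0 \<and> {v \<in> points E. snorm E i (v - 0) < e} \<subseteq> {u \<in> points E. \<alpha> u \<in> ball 0 1}"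
      unfolding openin_seminorm_topology by blast
    then obtain i e where "e > 0" "\<And>v. v \<in> points E \<Longrightarrow> snorm E i v < e \<Longrightarrow> cmod (\<alpha> v) < 1"
      by auto
    then show ?R using clinear_bound_from_ball[OF lin, of e i 1] by (metis less_imp_le)
  next
    assume ?R
    then obtain i C where C: "\<And>\<phi>. \<phi> \<in> points E \<Longrightarrow> cmod (\<alpha> \<phi>) \<le> C * snorm E i \<phi>" by blast
    show ?L
      unfolding continuous_map_def topspace_seminorm_topology openin_seminorm_topology
    proof (intro conjI allI impI ballI)
      fix U :: "complex set" and u assume U: "openin euclidean U" and u: "u \<in> {x \<in> points E. \<alpha> x \<in> U}"
      then obtain d where d: "d > 0" "\<And>z. dist z (\<alpha> u) < d \<Longrightarrow> z \<in> U"
        by (auto simp: open_dist)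
      have "{v \<in> points E. snorm E i (v - u) < d / (\<bar>C\<bar> + 1)} \<subseteq> {x \<in> points E. \<alpha> x \<in> U}"
      proof safe
        fix v assume v: "v \<in> points E" "snorm E i (v - u) < d / (\<bar>C\<bar> + 1)"
        have up: "u \<in> points E" using u by simp
        have "cmod (\<alpha> v - \<alpha> u) \<le> C * snorm E i (v - u)"
          using C[OF closed(5)[OF v(1) up]] clinear_on_diff[OF subspace lin v(1) up] by simp
        also have "\<dots> \<le> (\<bar>C\<bar> + 1) * snorm E i (v - u)"
          by (intro mult_right_mono snorm_nonneg closed v up) auto
        also have "\<dots> < d" using v(2) by (simp add: field_simps)
        finally show "\<alpha> v \<in> U" by (intro d) (simp add: dist_norm)
      qed
      then show "\<exists>i e. e > 0 \<and> {v \<in> points E. snorm E i (v - u) < e} \<subseteq> {x \<in> points E. \<alpha> x \<in> U}"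
        using d by (intro exI[of _ i] exI[of _ "d / (\<bar>C\<bar> + 1)"]) auto
    qed auto
  qed
  then show ?thesis by (auto simp: cdual_def)
qed

end

section \<open>Bounded linear maps\<close>

text \<open>Continuity of a linear map, in the form of an estimate of the seminorms.\<close>

locale bounded_map = E: seminormed_space E + F: seminormed_space F
  for E :: "'a::complex_vector seminormed" and F :: "'b::complex_vector seminormed" +
  fixes T :: "'a \<Rightarrow> 'b"
  assumes maps: "u \<in> points E \<Longrightarrow> T u \<in> points F"
    and linear: "clinear_on (points E) T"
    and estimate: "\<exists>i C. \<forall>u\<in>points E. snorm F j (T u) \<le> C * snorm E i u"
begin

lemma add: "u \<in> points E \<Longrightarrow> v \<in> points E \<Longrightarrow> T (u + v) = T u + T v"
  and scale: "u \<in> points E \<Longrightarrow> T (c *\<^sub>C u) = c *\<^sub>C T u"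
  using linear by (auto simp: clinear_on_def)

lemma bound:
  obtains i C where "C > 0" "\<And>u. u \<in> points E \<Longrightarrow> snorm F j (T u) \<le> C * snorm E i u"
proof -
  obtain i C where C: "\<And>u. u \<in> points E \<Longrightarrow> snorm F j (T u) \<le> C * snorm E i u"
    using estimate by blast
  have "snorm F j (T u) \<le> (\<bar>C\<bar> + 1) * snorm E i u" if "u \<in> points E" for u
    by (rule order_trans[OF C[OF that] mult_right_mono]) (use E.snorm_nonneg[OF that] in auto)
  then show ?thesis by (intro that[of "\<bar>C\<bar> + 1"]) auto
qed

lemma cong:
  assumes "\<And>u. u \<in> points E \<Longrightarrow> T' u = T u"
  shows "bounded_map E F T'"
  using maps linear estimate
  by unfold_locales (simp_all add: assms E.closed clinear_on_def cong: ball_cong)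

lemma comp:
  assumes "bounded_map F G S"
  shows "bounded_map E G (\<lambda>u. S (T u))"
proof -
  interpret S: bounded_map F G S by fact
  show ?thesis
  proof
    show "clinear_on (points E) (\<lambda>u. S (T u))"
      by (simp add: clinear_on_def maps add scale S.add S.scale)
    fix j
    obtain i C where 1: "C > 0" "\<And>u. u \<in> points F \<Longrightarrow> snorm G j (S u) \<le> C * snorm F i u"
      using S.bound by blast
    obtain k C' where 2: "C' > 0" "\<And>u. u \<in> points E \<Longrightarrow> snorm F i (T u) \<le> C' * snorm E k u"
      using bound by blast
    have "snorm G j (S (T u)) \<le> (C * C') * snorm E k u" if "u \<in> points E" for u
      using order_trans[OF 1(2)[OF maps[OF that]] mult_left_mono[OF 2(2)[OF that]]] 1(1)
      by (simp add: mult.assoc)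
    then show "\<exists>i C. \<forall>u\<in>points E. snorm G j (S (T u)) \<le> C * snorm E i u" by blast
  qed (intro S.maps maps)
qed

lemma plus:
  assumes "bounded_map E F S"
  shows "bounded_map E F (\<lambda>u. T u + S u)"
proof -
  interpret S: bounded_map E F S by fact
  show ?thesis
  proof
    show "clinear_on (points E) (\<lambda>u. T u + S u)"
      by (simp add: clinear_on_def add scale S.add S.scale scaleC_add_right add_ac)
    fix j
    obtain i C where 1: "C > 0" "\<And>u. u \<in> points E \<Longrightarrow> snorm F j (T u) \<le> C * snorm E i u"
      using bound by blast
    obtain k C' where 2: "C' > 0" "\<And>u. u \<in> points E \<Longrightarrow> snorm F j (S u) \<le> C' * snorm E k u"
      using S.bound by blast
    have "snorm F j (T u + S u) \<le> (C + C') * snorm E (max i k) u" if u: "u \<in> points E" for u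
    proof -
      have "snorm F j (T u + S u) \<le> snorm F j (T u) + snorm F j (S u)"
        by (intro F.snorm_triangle maps S.maps u)
      also have "\<dots> \<le> C * snorm E i u + C' * snorm E k u" by (intro add_mono 1 2 u)
      also have "\<dots> \<le> C * snorm E (max i k) u + C' * snorm E (max i k) u"
        using 1(1) 2(1) u by (intro add_mono mult_left_mono E.snorm_mono) auto
      finally show ?thesis by (simp add: distrib_right)
    qed
    then show "\<exists>i C. \<forall>u\<in>points E. snorm F j (T u + S u) \<le> C * snorm E i u" by blast
  qed (intro F.closed maps S.maps)
qed

lemma scaled: "bounded_map E F (\<lambda>u. c *\<^sub>C T u)"
proof
  show "clinear_on (points E) (\<lambda>u. c *\<^sub>C T u)"
    by (simp add: clinear_on_def add scale scaleC_add_right scaleC_scaleC mult.commute)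
  fix j
  obtain i C where 1: "C > 0" "\<And>u. u \<in> points E \<Longrightarrow> snorm F j (T u) \<le> C * snorm E i u"
    using bound by blast
  have "snorm F j (c *\<^sub>C T u) \<le> (cmod c * C) * snorm E i u" if u: "u \<in> points E" for u
    using mult_left_mono[OF 1(2)[OF u], of "cmod c"] by (simp add: F.snorm_scale maps[OF u] mult.assoc)
  then show "\<exists>i C. \<forall>u\<in>points E. snorm F j (c *\<^sub>C T u) \<le> C * snorm E i u" by blast
qed (intro F.closed maps)

end

lemma (in seminormed_space) bounded_map_id: "bounded_map E E (\<lambda>u. u)"
proof
  fix j show "\<exists>i C. \<forall>u\<in>points E. snorm E j u \<le> C * snorm E i u"
    by (intro exI[of _ j] exI[of _ 1]) simp
qed (simp_all add: clinear_on_def)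

lemma bounded_map_sum:
  assumes "seminormed_space E" "seminormed_space F" and "\<And>k. k < (n::nat) \<Longrightarrow> bounded_map E F (T k)"
  shows "bounded_map E F (\<lambda>u. \<Sum>k<n. T k u)"
  using assms(3)
proof (induction n)
  case 0
  interpret E: seminormed_space E by fact
  interpret F: seminormed_space F by fact
  show ?case
    by unfold_locales (auto simp: clinear_on_def F.closed F.snorm_zero intro!: exI[of _ "0::real"])
next
  case (Suc n)
  then show ?case using bounded_map.plus[OF _ Suc.prems[of n]] by simp
qed

section \<open>The quotient completion\<close>

definition Q_class :: "'a::complex_vector seminormed \<Rightarrow> (nat \<Rightarrow> 'a) \<Rightarrow> (nat \<Rightarrow> 'a) set" where
  "Q_class E u = null_seqs E #>\<^bsub>add_group (bounded_seqs E)\<^esub> u"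

lemma Q_incl_eq: "Q_incl E \<phi> = Q_class E (\<lambda>n. \<phi>)"
  by (simp add: Q_incl_def Q_class_def)

lemma add_group_sel [simp]:
  "carrier (add_group S) = S" "x \<otimes>\<^bsub>add_group S\<^esub> y = x + y" "\<one>\<^bsub>add_group S\<^esub> = 0"
  by (auto simp: add_group_def)

lemma add_group_comm_group:
  assumes "0 \<in> S" "\<And>x y. x \<in> S \<Longrightarrow> y \<in> S \<Longrightarrow> x + y \<in> S" "\<And>x. x \<in> S \<Longrightarrow> - x \<in> S"
  shows "comm_group (add_group S)"
proof (rule comm_groupI)
  fix x assume "x \<in> carrier (add_group S)"
  then show "\<exists>y\<in>carrier (add_group S). y \<otimes>\<^bsub>add_group S\<^esub> x = \<one>\<^bsub>add_group S\<^esub>"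
    using assms(3) by (auto intro!: bexI[of _ "- x"])
qed (use assms in \<open>auto simp: add_ac\<close>)

lemma add_group_inv:
  assumes "comm_group (add_group S)" "x \<in> S" "- x \<in> S"
  shows "inv\<^bsub>add_group S\<^esub> x = - x"
  using group.inv_equality[OF comm_group.axioms(2)[OF assms(1)], of "- x" x] assms(2,3) by simp

lemma Q_class_eq: "Q_class E u = {k + u |k. k \<in> null_seqs E}"
  by (auto simp: Q_class_def r_coset_def)

context seminormed_space
begin

lemma null_seqs_bounded: "null_seqs E \<subseteq> bounded_seqs E"
proof
  fix u assume u: "u \<in> null_seqs E"
  have "\<exists>C. \<forall>n. snorm E i (u n) \<le> C" for i
  proof -
    have "convergent (\<lambda>n. snorm E i (u n))" using u by (auto simp: null_seqs_def convergent_def)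
    then obtain C where "\<And>n. norm (snorm E i (u n)) \<le> C" by (metis convergent_imp_Bseq Bseq_def)
    then show ?thesis by (metis abs_le_D1 real_norm_def)
  qed
  with u show "u \<in> bounded_seqs E" by (auto simp: null_seqs_def bounded_seqs_def)
qed

lemma bounded_seqs_points: "u \<in> bounded_seqs E \<Longrightarrow> u n \<in> points E"
  by (auto simp: bounded_seqs_def)

lemma bounded_seqs_closed:
  "0 \<in> bounded_seqs E" "u \<in> bounded_seqs E \<Longrightarrow> v \<in> bounded_seqs E \<Longrightarrow> u + v \<in> bounded_seqs E"
  "u \<in> bounded_seqs E \<Longrightarrow> - u \<in> bounded_seqs E"
proof -
  show "0 \<in> bounded_seqs E" by (auto simp: bounded_seqs_def closed snorm_zero)
  show "u + v \<in> bounded_seqs E" if u: "u \<in> bounded_seqs E" and v: "v \<in> bounded_seqs E"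
  proof -
    have "\<exists>K. \<forall>n. snorm E i (u n + v n) \<le> K" for i
    proof -
      obtain C C' where "\<And>n. snorm E i (u n) \<le> C" "\<And>n. snorm E i (v n) \<le> C'"
        using u v unfolding bounded_seqs_def by blast
      then have "snorm E i (u n + v n) \<le> C + C'" for n
        using snorm_triangle[OF bounded_seqs_points[OF u, of n] bounded_seqs_points[OF v, of n], of i]
        by (meson add_mono order_trans)
      then show ?thesis by blast
    qed
    then show ?thesis using u v by (auto simp: bounded_seqs_def closed)
  qed
  show "u \<in> bounded_seqs E \<Longrightarrow> - u \<in> bounded_seqs E"
    by (auto simp: bounded_seqs_def closed snorm_neg)
qed

lemma null_seqs_closed:
  "0 \<in> null_seqs E" "u \<in> null_seqs E \<Longrightarrow> v \<in> null_seqs E \<Longrightarrow> u + v \<in> null_seqs E"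
  "u \<in> null_seqs E \<Longrightarrow> - u \<in> null_seqs E"
proof -
  show "0 \<in> null_seqs E" by (auto simp: null_seqs_def closed snorm_zero)
  show "u + v \<in> null_seqs E" if u: "u \<in> null_seqs E" and v: "v \<in> null_seqs E"
  proof -
    have "(\<lambda>n. snorm E i (u n + v n)) \<longlonglongrightarrow> 0" for i
    proof (rule tendsto_sandwich[where f = "\<lambda>n. 0", OF _ _ tendsto_const])
      show "(\<lambda>n. snorm E i (u n) + snorm E i (v n)) \<longlonglongrightarrow> 0"
        using u v tendsto_add[of "\<lambda>n. snorm E i (u n)" 0 sequentially "\<lambda>n. snorm E i (v n)" 0]
        by (auto simp: null_seqs_def)
      show "\<forall>\<^sub>F n in sequentially. 0 \<le> snorm E i (u n + v n)"
        using u v by (intro always_eventually allI snorm_nonneg closed) (auto simp: null_seqs_def)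
      show "\<forall>\<^sub>F n in sequentially. snorm E i (u n + v n) \<le> snorm E i (u n) + snorm E i (v n)"
        using u v by (intro always_eventually allI snorm_triangle) (auto simp: null_seqs_def)
    qed
    then show ?thesis using u v by (auto simp: null_seqs_def closed)
  qed
  show "u \<in> null_seqs E \<Longrightarrow> - u \<in> null_seqs E"
    by (auto simp: null_seqs_def closed snorm_neg)
qed

lemma bounded_seqs_group: "comm_group (add_group (bounded_seqs E))"
  by (intro add_group_comm_group bounded_seqs_closed)

lemma null_seqs_normal: "null_seqs E \<lhd> add_group (bounded_seqs E)"
proof (rule comm_group.subgroup_imp_normal[OF bounded_seqs_group])
  show "subgroup (null_seqs E) (add_group (bounded_seqs E))"
  proof (rule group.subgroupI[OF comm_group.axioms(2)[OF bounded_seqs_group]])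
    fix u assume u: "u \<in> null_seqs E"
    then have "u \<in> bounded_seqs E" using null_seqs_bounded by blast
    then show "inv\<^bsub>add_group (bounded_seqs E)\<^esub> u \<in> null_seqs E"
      using u by (simp add: add_group_inv[OF bounded_seqs_group] bounded_seqs_closed null_seqs_closed)
  qed (use null_seqs_bounded null_seqs_closed in auto)
qed

lemma Q_completion_group: "group (Q_completion E)"
  unfolding Q_completion_def by (rule normal.factorgroup_is_group[OF null_seqs_normal])

lemma carrier_Q_completion: "carrier (Q_completion E) = Q_class E ` bounded_seqs E"
  by (auto simp: Q_completion_def FactGroup_def RCOSETS_def Q_class_def)

lemma Q_class_add:
  assumes "u \<in> bounded_seqs E" "v \<in> bounded_seqs E"
  shows "Q_class E u \<otimes>\<^bsub>Q_completion E\<^esub> Q_class E v = Q_class E (u + v)"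
  using normal.rcos_sum[OF null_seqs_normal, of u v] assms
  by (simp add: Q_completion_def FactGroup_def Q_class_def)

lemma Q_class_eq_iff: "Q_class E u = Q_class E v \<longleftrightarrow> u - v \<in> null_seqs E"
proof
  assume "Q_class E u = Q_class E v"
  moreover have "0 + u \<in> Q_class E u" using null_seqs_closed(1) unfolding Q_class_eq by blast
  ultimately obtain k where "k \<in> null_seqs E" "u = k + v" unfolding Q_class_eq by auto
  then show "u - v \<in> null_seqs E" by simp
next
  assume d: "u - v \<in> null_seqs E"
  have "k + u \<in> Q_class E v" if "k \<in> null_seqs E" for k
    using null_seqs_closed(2)[OF that d] unfolding Q_class_eq
    by (intro CollectI exI[of _ "k + (u - v)"]) (simp add: algebra_simps)
  moreover have "k + v \<in> Q_class E u" if "k \<in> null_seqs E" for k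
    using null_seqs_closed(2)[OF that null_seqs_closed(3)[OF d]] unfolding Q_class_eq
    by (intro CollectI exI[of _ "k + - (u - v)"]) (simp add: algebra_simps)
  ultimately show "Q_class E u = Q_class E v" unfolding Q_class_eq by auto
qed

lemma Q_completion_one: "\<one>\<^bsub>Q_completion E\<^esub> = Q_class E (\<lambda>n. 0)"
proof -
  have *: "(\<lambda>n. 0::'a) = 0" by (simp add: zero_fun_def)
  show ?thesis unfolding * by (simp add: Q_completion_def FactGroup_def Q_class_eq)
qed

lemma Q_class_eq_one_iff: "Q_class E u = \<one>\<^bsub>Q_completion E\<^esub> \<longleftrightarrow> u \<in> null_seqs E"
proof -
  have "u - (\<lambda>n. 0) = u" by (auto simp: fun_eq_iff)
  then show ?thesis unfolding Q_completion_one Q_class_eq_iff by simp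
qed

lemma const_bounded_seq: "\<phi> \<in> points E \<Longrightarrow> (\<lambda>n. \<phi>) \<in> bounded_seqs E"
  by (auto simp: bounded_seqs_def)

end

context bounded_map
begin

lemma bounded_seqs:
  assumes u: "u \<in> bounded_seqs E"
  shows "(\<lambda>n. T (u n)) \<in> bounded_seqs F"
proof -
  have "\<exists>K. \<forall>n. snorm F j (T (u n)) \<le> K" for j
  proof -
    obtain i C where C: "C > 0" "\<And>u. u \<in> points E \<Longrightarrow> snorm F j (T u) \<le> C * snorm E i u"
      using bound by blast
    obtain K where "\<And>n. snorm E i (u n) \<le> K" using u unfolding bounded_seqs_def by blast
    then have "snorm F j (T (u n)) \<le> C * K" for n
      using order_trans[OF C(2)[OF E.bounded_seqs_points[OF u]] mult_left_mono] C(1) by (meson less_imp_le)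
    then show ?thesis by blast
  qed
  then show ?thesis using maps[OF E.bounded_seqs_points[OF u]] by (auto simp: bounded_seqs_def)
qed

lemma null_seqs:
  assumes u: "u \<in> null_seqs E"
  shows "(\<lambda>n. T (u n)) \<in> null_seqs F"
proof -
  have up: "u n \<in> points E" for n using u by (auto simp: null_seqs_def)
  have "(\<lambda>n. snorm F j (T (u n))) \<longlonglongrightarrow> 0" for j
  proof -
    obtain i C where C: "C > 0" "\<And>u. u \<in> points E \<Longrightarrow> snorm F j (T u) \<le> C * snorm E i u"
      using bound by blast
    have "(\<lambda>n. C * snorm E i (u n)) \<longlonglongrightarrow> 0"
      using u by (auto simp: null_seqs_def intro: tendsto_mult_right_zero)
    then show ?thesis
      by (rule tendsto_sandwich[OF _ _ tendsto_const, rotated 2])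
         (auto intro!: always_eventually C up F.snorm_nonneg maps)
  qed
  then show ?thesis using maps[OF up] by (auto simp: null_seqs_def)
qed

text \<open>The null sequences that \<open>Q_map\<close> adds absorb the images of null sequences.\<close>

lemma Q_map_class:
  assumes u: "u \<in> bounded_seqs E"
  shows "Q_map F T (Q_class E u) = Q_class F (\<lambda>n. T (u n))"
proof -
  have *: "(\<lambda>n. T ((k + u) n)) = (\<lambda>n. T (k n)) + (\<lambda>n. T (u n))" if "k \<in> null_seqs E" for k
    using u that add by (auto simp: fun_eq_iff null_seqs_def bounded_seqs_def)
  show ?thesis
  proof (intro equalityI subsetI)
    fix x assume "x \<in> Q_map F T (Q_class E u)"
    then obtain m k where m: "m \<in> null_seqs F" and k: "k \<in> null_seqs E" and x: "x = m + (\<lambda>n. T ((k + u) n))"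
      by (auto simp: Q_map_def Q_class_eq set_mult_def)
    have "x = (m + (\<lambda>n. T (k n))) + (\<lambda>n. T (u n))" unfolding x *[OF k] by (simp only: add.assoc)
    moreover have "m + (\<lambda>n. T (k n)) \<in> null_seqs F"
      by (intro F.null_seqs_closed(2) m null_seqs[OF k])
    ultimately show "x \<in> Q_class F (\<lambda>n. T (u n))" unfolding Q_class_eq by blast
  next
    fix x assume "x \<in> Q_class F (\<lambda>n. T (u n))"
    then obtain m where m: "m \<in> null_seqs F" "x = m + (\<lambda>n. T (u n))" by (auto simp: Q_class_eq)
    have "0 + u \<in> Q_class E u" using E.null_seqs_closed(1) unfolding Q_class_eq by blast
    with m show "x \<in> Q_map F T (Q_class E u)" by (auto simp: Q_map_def set_mult_def)
  qed
qed

lemma Q_map_hom: "Q_map F T \<in> hom (Q_completion E) (Q_completion F)"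
proof (rule homI)
  fix x assume "x \<in> carrier (Q_completion E)"
  then show "Q_map F T x \<in> carrier (Q_completion F)"
    using bounded_seqs by (auto simp: E.carrier_Q_completion F.carrier_Q_completion Q_map_class)
next
  fix x y assume "x \<in> carrier (Q_completion E)" "y \<in> carrier (Q_completion E)"
  then obtain u v where u: "u \<in> bounded_seqs E" "x = Q_class E u" and v: "v \<in> bounded_seqs E" "y = Q_class E v"
    by (auto simp: E.carrier_Q_completion)
  have "(\<lambda>n. T ((u + v) n)) = (\<lambda>n. T (u n)) + (\<lambda>n. T (v n))"
    using u v add by (auto simp: fun_eq_iff bounded_seqs_def)
  then show "Q_map F T (x \<otimes>\<^bsub>Q_completion E\<^esub> y) = Q_map F T x \<otimes>\<^bsub>Q_completion F\<^esub> Q_map F T y"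
    using bounded_seqs[OF u(1)] bounded_seqs[OF v(1)] u(1) v(1) unfolding u(2) v(2)
    by (simp add: E.Q_class_add F.Q_class_add Q_map_class E.bounded_seqs_closed)
qed

end

section \<open>The dual\<close>

text \<open>With the scalars as target, continuous functionals are a special case of bounded maps.\<close>

definition scalars :: "complex seminormed" where
  "scalars = \<lparr>points = UNIV, snorm = (\<lambda>i. cmod)\<rparr>"

lemma scalars_sel [simp]: "points scalars = UNIV" "snorm scalars i = cmod"
  by (simp_all add: scalars_def)

lemma scalars_seminormed_space: "seminormed_space scalars"
  by unfold_locales (simp_all add: csubspace_def scaleC_complex_def norm_mult norm_triangle_ineq)

context seminormed_space
begin

lemma cdual_iff_bounded_map:
  "\<alpha> \<in> cdual E \<longleftrightarrow> (\<forall>\<phi>. \<phi> \<notin> points E \<longrightarrow> \<alpha> \<phi> = 0) \<and> bounded_map E scalars \<alpha>"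
  by (simp add: cdual_iff bounded_map_def bounded_map_axioms_def seminormed_space_axioms scalars_seminormed_space)

lemma cdualD:
  assumes "\<alpha> \<in> cdual E"
  shows "bounded_map E scalars \<alpha>" and "u \<notin> points E \<Longrightarrow> \<alpha> u = 0" and "clinear_on (points E) \<alpha>"
    and "u \<in> points E \<Longrightarrow> v \<in> points E \<Longrightarrow> \<alpha> (u + v) = \<alpha> u + \<alpha> v"
  using assms by (auto simp: cdual_iff_bounded_map bounded_map.add dest: bounded_map.linear)

lemma cdual_bound:
  assumes "\<alpha> \<in> cdual E"
  obtains i C where "C > 0" "\<And>u. u \<in> points E \<Longrightarrow> cmod (\<alpha> u) \<le> C * snorm E i u"
  by (rule bounded_map.bound[OF cdualD(1)[OF assms]]) (rule that, simp_all)

lemma cdual_zero: "\<alpha> \<in> cdual E \<Longrightarrow> \<alpha> 0 = 0"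
  using clinear_on_zero[OF subspace cdualD(3)] .

lemma cdual_subspace: "csubspace (cdual E)"
  unfolding csubspace_def
proof (intro conjI ballI allI)
  show "0 \<in> cdual E"
    by (auto simp: cdual_iff clinear_on_def scaleC_complex_def intro!: exI[of _ "0::real"])
next
  fix \<alpha> \<beta> assume a: "\<alpha> \<in> cdual E" and b: "\<beta> \<in> cdual E"
  show "\<alpha> + \<beta> \<in> cdual E"
    using bounded_map.plus[OF cdualD(1)[OF a] cdualD(1)[OF b]] cdualD(2)[OF a] cdualD(2)[OF b]
    by (simp add: cdual_iff_bounded_map plus_fun_def)
next
  fix c \<alpha> assume a: "\<alpha> \<in> cdual E"
  show "c *\<^sub>C \<alpha> \<in> cdual E"
    using bounded_map.scaled[OF cdualD(1)[OF a], of c] cdualD(2)[OF a]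
    by (simp add: cdual_iff_bounded_map scaleC_fun_def)
qed

end

section \<open>The bidual\<close>

context seminormed_space
begin

lemma dual_norm_le_1_iff: "dual_norm E i \<alpha> \<le> 1 \<longleftrightarrow> (\<forall>\<phi>\<in>points E. snorm E i \<phi> \<le> 1 \<longrightarrow> cmod (\<alpha> \<phi>) \<le> 1)"
  by (auto simp: dual_norm_def SUP_le_iff)

lemma bidual_iff:
  "\<eta> \<in> bidual E \<longleftrightarrow> (\<forall>\<alpha>. \<alpha> \<notin> cdual E \<longrightarrow> \<eta> \<alpha> = 0) \<and> clinear_on (cdual E) \<eta> \<and>
     (\<forall>i. \<exists>C. \<forall>\<alpha>\<in>cdual E. dual_norm E i \<alpha> \<le> 1 \<longrightarrow> cmod (\<eta> \<alpha>) \<le> C)"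
proof -
  have "(SUP \<alpha>\<in>{\<alpha> \<in> cdual E. dual_norm E i \<alpha> \<le> 1}. ennreal (cmod (\<eta> \<alpha>))) < \<infinity> \<longleftrightarrow>
      (\<exists>C. \<forall>\<alpha>\<in>cdual E. dual_norm E i \<alpha> \<le> 1 \<longrightarrow> cmod (\<eta> \<alpha>) \<le> C)" (is "?S < \<infinity> \<longleftrightarrow> ?R") for i
  proof
    assume "?S < \<infinity>"
    then obtain C where C: "C \<ge> 0" "?S = ennreal C" by (cases ?S) auto
    have "cmod (\<eta> \<alpha>) \<le> C" if "\<alpha> \<in> cdual E" "dual_norm E i \<alpha> \<le> 1" for \<alpha>
    proof -
      have "ennreal (cmod (\<eta> \<alpha>)) \<le> ?S" using that by (intro SUP_upper) auto
      then show ?thesis unfolding C(2) using C(1) by (simp add: ennreal_le_iff)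
    qed
    then show ?R by blast
  next
    assume ?R
    then obtain C where "\<And>\<alpha>. \<alpha> \<in> cdual E \<Longrightarrow> dual_norm E i \<alpha> \<le> 1 \<Longrightarrow> cmod (\<eta> \<alpha>) \<le> C" by blast
    then have "?S \<le> ennreal C" by (intro SUP_least) (auto intro: ennreal_leI)
    then show "?S < \<infinity>" by (simp add: le_less_trans ennreal_less_top)
  qed
  then show ?thesis unfolding bidual_def by auto
qed

lemma bidualD:
  assumes "\<eta> \<in> bidual E"
  shows "\<alpha> \<notin> cdual E \<Longrightarrow> \<eta> \<alpha> = 0"
    and "\<alpha> \<in> cdual E \<Longrightarrow> \<beta> \<in> cdual E \<Longrightarrow> \<eta> (\<alpha> + \<beta>) = \<eta> \<alpha> + \<eta> \<beta>"
    and "\<alpha> \<in> cdual E \<Longrightarrow> \<eta> (c *\<^sub>C \<alpha>) = c * \<eta> \<alpha>"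
  using assms by (auto simp: bidual_iff clinear_on_def scaleC_complex_def)

lemma dual_norm_le_1_bound:
  assumes "\<alpha> \<in> cdual E" "dual_norm E i \<alpha> \<le> 1" "u \<in> points E"
  shows "cmod (\<alpha> u) \<le> 2 * snorm E i u"
  using clinear_bound_from_ball[OF cdualD(3)[OF assms(1)], of 1 i 1 u] assms(2,3)
  by (auto simp: dual_norm_le_1_iff)

lemma bidual_scaled_bound:
  assumes \<eta>: "\<eta> \<in> bidual E"
  obtains K where "\<And>\<alpha> C. \<alpha> \<in> cdual E \<Longrightarrow> C > 0 \<Longrightarrow> (\<And>u. u \<in> points E \<Longrightarrow> cmod (\<alpha> u) \<le> C * snorm E i u) \<Longrightarrow>
    cmod (\<eta> \<alpha>) \<le> C * K"
proof -
  obtain K where K: "\<And>\<alpha>. \<alpha> \<in> cdual E \<Longrightarrow> dual_norm E i \<alpha> \<le> 1 \<Longrightarrow> cmod (\<eta> \<alpha>) \<le> K"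
    using \<eta> unfolding bidual_iff by blast
  have "cmod (\<eta> \<alpha>) \<le> C * K" if a: "\<alpha> \<in> cdual E" and C: "C > 0"
    and bound: "\<And>u. u \<in> points E \<Longrightarrow> cmod (\<alpha> u) \<le> C * snorm E i u" for \<alpha> C
  proof -
    have "dual_norm E i (complex_of_real (1 / C) *\<^sub>C \<alpha>) \<le> 1"
      unfolding dual_norm_le_1_iff
    proof (intro ballI impI)
      fix u assume u: "u \<in> points E" "snorm E i u \<le> 1"
      have "cmod (\<alpha> u) \<le> C * 1" using order_trans[OF bound[OF u(1)] mult_left_mono[OF u(2)]] C by simp
      then show "cmod ((complex_of_real (1 / C) *\<^sub>C \<alpha>) u) \<le> 1"
        using C by (simp add: scaleC_fun_def scaleC_complex_def norm_divide)
    qed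
    then have "cmod (\<eta> (complex_of_real (1 / C) *\<^sub>C \<alpha>)) \<le> K"
      by (intro K csubspaceD(3)[OF cdual_subspace] a)
    then show ?thesis
      unfolding bidualD(3)[OF \<eta> a] using C by (simp add: norm_divide field_simps)
  qed
  then show ?thesis using that by blast
qed

lemma bidual_closed:
  "0 \<in> bidual E" "\<eta> \<in> bidual E \<Longrightarrow> \<theta> \<in> bidual E \<Longrightarrow> \<eta> + \<theta> \<in> bidual E" "\<eta> \<in> bidual E \<Longrightarrow> - \<eta> \<in> bidual E"
proof -
  show "0 \<in> bidual E" by (auto simp: bidual_iff clinear_on_def)
  show "\<eta> + \<theta> \<in> bidual E" if h: "\<eta> \<in> bidual E" and t: "\<theta> \<in> bidual E"
  proof -
    have "\<exists>C. \<forall>\<alpha>\<in>cdual E. dual_norm E i \<alpha> \<le> 1 \<longrightarrow> cmod ((\<eta> + \<theta>) \<alpha>) \<le> C" for i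
    proof -
      obtain C C' where "\<And>\<alpha>. \<alpha> \<in> cdual E \<Longrightarrow> dual_norm E i \<alpha> \<le> 1 \<Longrightarrow> cmod (\<eta> \<alpha>) \<le> C"
        "\<And>\<alpha>. \<alpha> \<in> cdual E \<Longrightarrow> dual_norm E i \<alpha> \<le> 1 \<Longrightarrow> cmod (\<theta> \<alpha>) \<le> C'"
        using h t unfolding bidual_iff by meson
      then have "cmod ((\<eta> + \<theta>) \<alpha>) \<le> C + C'" if "\<alpha> \<in> cdual E" "dual_norm E i \<alpha> \<le> 1" for \<alpha>
        using that by (simp add: norm_triangle_le add_mono)
      then show ?thesis by blast
    qed
    then show ?thesis
      using bidualD[OF h] bidualD[OF t]
      unfolding bidual_iff by (auto simp: clinear_on_def scaleC_complex_def algebra_simps)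
  qed
  show "- \<eta> \<in> bidual E" if "\<eta> \<in> bidual E"
    using that unfolding bidual_iff by (auto simp: clinear_on_def scaleC_complex_def)
qed

lemma W_completion_group: "group (W_completion E)"
  unfolding W_completion_def by (intro comm_group.axioms(2) add_group_comm_group bidual_closed)

end

lemma transp_add: "transp E T (\<alpha> + \<beta>) = transp E T \<alpha> + transp E T \<beta>"
  and transp_scale: "transp E T (c *\<^sub>C \<alpha>) = c *\<^sub>C transp E T \<alpha>"
  by (simp_all add: transp_def fun_eq_iff scaleC_fun_def)

context bounded_map
begin

lemma transp_cdual: "\<beta> \<in> cdual F \<Longrightarrow> transp E T \<beta> \<in> cdual E"
  using bounded_map.cong[OF comp[OF F.cdualD(1)], of \<beta> "transp E T \<beta>"]
  by (simp add: E.cdual_iff_bounded_map transp_def)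

lemma W_map_bidual:
  assumes \<eta>: "\<eta> \<in> bidual E"
  shows "W_map E F T \<eta> \<in> bidual F"
proof -
  have "\<exists>K. \<forall>\<beta>\<in>cdual F. dual_norm F j \<beta> \<le> 1 \<longrightarrow> cmod (W_map E F T \<eta> \<beta>) \<le> K" for j
  proof -
    obtain i C where C: "C > 0" "\<And>u. u \<in> points E \<Longrightarrow> snorm F j (T u) \<le> C * snorm E i u"
      using bound by blast
    obtain K where K: "\<And>\<alpha> C. \<alpha> \<in> cdual E \<Longrightarrow> C > 0 \<Longrightarrow>
        (\<And>u. u \<in> points E \<Longrightarrow> cmod (\<alpha> u) \<le> C * snorm E i u) \<Longrightarrow> cmod (\<eta> \<alpha>) \<le> C * K"
      using E.bidual_scaled_bound[OF \<eta>] by blast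
    have "cmod (W_map E F T \<eta> \<beta>) \<le> (2 * C) * K" if \<beta>: "\<beta> \<in> cdual F" "dual_norm F j \<beta> \<le> 1" for \<beta>
    proof -
      have "cmod (transp E T \<beta> u) \<le> (2 * C) * snorm E i u" if u: "u \<in> points E" for u
        using order_trans[OF F.dual_norm_le_1_bound[OF \<beta> maps[OF u]]] C(2)[OF u] u by (simp add: transp_def)
      then show ?thesis using K[OF transp_cdual[OF \<beta>(1)], of "2 * C"] C(1) \<beta>(1) by (simp add: W_map_def)
    qed
    then show ?thesis by blast
  qed
  moreover have "clinear_on (cdual F) (W_map E F T \<eta>)"
    using transp_cdual E.bidualD[OF \<eta>] csubspaceD[OF F.cdual_subspace]
    by (simp add: clinear_on_def W_map_def transp_add transp_scale scaleC_complex_def)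
  ultimately show ?thesis
    unfolding F.bidual_iff by (simp add: W_map_def)
qed

lemma W_map_hom: "W_map E F T \<in> hom (W_completion E) (W_completion F)"
proof (rule homI)
  fix \<eta> \<theta>
  show "W_map E F T (\<eta> \<otimes>\<^bsub>W_completion E\<^esub> \<theta>) = W_map E F T \<eta> \<otimes>\<^bsub>W_completion F\<^esub> W_map E F T \<theta>"
    by (simp add: W_completion_def W_map_def fun_eq_iff)
qed (simp add: W_completion_def W_map_bidual)

lemma W_map_comp:
  assumes S: "bounded_map F G S"
  shows "W_map F G S (W_map E F T \<eta>) = W_map E G (\<lambda>u. S (T u)) \<eta>"
proof
  fix \<beta>
  have "transp E T (transp F S \<beta>) = transp E (\<lambda>u. S (T u)) \<beta>"
    using maps by (auto simp: transp_def fun_eq_iff)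
  then show "W_map F G S (W_map E F T \<eta>) \<beta> = W_map E G (\<lambda>u. S (T u)) \<eta> \<beta>"
    using bounded_map.transp_cdual[OF S] by (simp add: W_map_def)
qed

lemma W_map_plus:
  assumes "bounded_map E F S" and \<eta>: "\<eta> \<in> bidual E"
  shows "W_map E F (\<lambda>u. T u + S u) \<eta> = W_map E F T \<eta> + W_map E F S \<eta>"
proof
  fix \<beta>
  interpret S: bounded_map E F S by fact
  have "transp E (\<lambda>u. T u + S u) \<beta> = transp E T \<beta> + transp E S \<beta>" if "\<beta> \<in> cdual F"
    using F.cdualD(4)[OF that] maps S.maps by (auto simp: transp_def fun_eq_iff)
  then show "W_map E F (\<lambda>u. T u + S u) \<eta> \<beta> = (W_map E F T \<eta> + W_map E F S \<eta>) \<beta>"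
    using E.bidualD(2)[OF \<eta> transp_cdual S.transp_cdual] by (simp add: W_map_def)
qed

lemma W_map_incl:
  assumes "\<phi> \<in> points E"
  shows "W_map E F T (W_incl E \<phi>) = W_incl F (T \<phi>)"
proof
  fix \<beta>
  have "transp E T \<beta> \<phi> = \<beta> (T \<phi>)" using assms by (simp add: transp_def)
  then show "W_map E F T (W_incl E \<phi>) \<beta> = W_incl F (T \<phi>) \<beta>"
    using transp_cdual[of \<beta>] by (simp add: W_map_def W_incl_def)
qed

end

lemma W_map_cong: "(\<And>u. u \<in> points E \<Longrightarrow> T u = S u) \<Longrightarrow> W_map E F T \<eta> = W_map E F S \<eta>"
proof -
  assume "\<And>u. u \<in> points E \<Longrightarrow> T u = S u"
  then have *: "transp E T \<beta> = transp E S \<beta>" for \<beta> by (auto simp: transp_def fun_eq_iff)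
  show ?thesis unfolding W_map_def * ..
qed

lemma (in seminormed_space) W_map_id:
  assumes "\<eta> \<in> bidual E"
  shows "W_map E E (\<lambda>u. u) \<eta> = \<eta>"
proof
  fix \<beta>
  have "transp E (\<lambda>u. u) \<beta> = \<beta>" if "\<beta> \<in> cdual E"
    using cdualD(2)[OF that] by (auto simp: transp_def fun_eq_iff)
  then show "W_map E E (\<lambda>u. u) \<eta> \<beta> = \<eta> \<beta>"
    using bidualD(1)[OF assms] by (auto simp: W_map_def)
qed

context seminormed_space
begin

lemma W_map_zero:
  assumes "seminormed_space F" and \<eta>: "\<eta> \<in> bidual E" and T: "\<And>u. u \<in> points E \<Longrightarrow> T u = 0"
  shows "W_map E F T \<eta> = 0"
proof
  fix \<beta>
  have "transp E T \<beta> = 0" if "\<beta> \<in> cdual F"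
    using seminormed_space.cdual_zero[OF assms(1) that] T by (auto simp: transp_def fun_eq_iff)
  moreover have "\<eta> 0 = 0"
    using bidualD(3)[OF \<eta>, of 0 0] csubspaceD(1)[OF cdual_subspace] by simp
  ultimately show "W_map E F T \<eta> \<beta> = 0 \<beta>" by (simp add: W_map_def)
qed

lemma W_incl_bidual:
  assumes "\<phi> \<in> points E"
  shows "W_incl E \<phi> \<in> bidual E"
proof -
  have "\<exists>C. \<forall>\<alpha>\<in>cdual E. dual_norm E i \<alpha> \<le> 1 \<longrightarrow> cmod (W_incl E \<phi> \<alpha>) \<le> C" for i
    using dual_norm_le_1_bound[OF _ _ assms] by (auto simp: W_incl_def)
  then show ?thesis
    using csubspaceD[OF cdual_subspace]
    unfolding bidual_iff by (auto simp: W_incl_def clinear_on_def scaleC_fun_def)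
qed

lemma W_incl_zero: "W_incl E 0 = 0"
  using cdual_zero by (simp add: W_incl_def fun_eq_iff)

end

text \<open>A generalized limit turns a bounded sequence into an element of the bidual. This maps the
  quotient completion to the weak-* completion, compatibly with bounded linear maps.\<close>

definition bidual_limit :: "((nat \<Rightarrow> complex) \<Rightarrow> complex) \<Rightarrow> 'a::complex_vector seminormed \<Rightarrow> (nat \<Rightarrow> 'a) \<Rightarrow>
    ('a \<Rightarrow> complex) \<Rightarrow> complex" where
  "bidual_limit L E u = (\<lambda>\<alpha>. if \<alpha> \<in> cdual E then L (\<lambda>n. \<alpha> (u n)) else 0)"

lemma generalized_limitD:
  assumes "generalized_limit L"
  shows "Bseq s \<Longrightarrow> Bseq t \<Longrightarrow> L (\<lambda>n. s n + t n) = L s + L t"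
    "Bseq s \<Longrightarrow> L (\<lambda>n. c * s n) = c * L s" "(\<And>n. cmod (s n) \<le> C) \<Longrightarrow> cmod (L s) \<le> 2 * C"
    "s \<longlonglongrightarrow> l \<Longrightarrow> L s = l"
proof -
  note L = assms[unfolded generalized_limit_def]
  show "Bseq s \<Longrightarrow> Bseq t \<Longrightarrow> L (\<lambda>n. s n + t n) = L s + L t"
    by (rule L[THEN conjunct1, rule_format, of s t])
  show "Bseq s \<Longrightarrow> L (\<lambda>n. c * s n) = c * L s"
    by (rule L[THEN conjunct2, THEN conjunct1, rule_format, of s c])
  show "(\<And>n. cmod (s n) \<le> C) \<Longrightarrow> cmod (L s) \<le> 2 * C"
    by (rule L[THEN conjunct2, THEN conjunct2, THEN conjunct1, rule_format, of s C])
  show "s \<longlonglongrightarrow> l \<Longrightarrow> L s = l"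
    by (rule L[THEN conjunct2, THEN conjunct2, THEN conjunct2, rule_format, of s l])
qed

context seminormed_space
begin

lemma cdual_Bseq:
  assumes "u \<in> bounded_seqs E" "\<alpha> \<in> cdual E"
  shows "Bseq (\<lambda>n. \<alpha> (u n))"
proof -
  have "(\<lambda>n. \<alpha> (u n)) \<in> bounded_seqs scalars"
    by (rule bounded_map.bounded_seqs[OF cdualD(1)[OF assms(2)] assms(1)])
  then obtain C where "\<And>n. cmod (\<alpha> (u n)) \<le> C" by (auto simp: bounded_seqs_def)
  then show ?thesis by (rule BseqI')
qed

lemma bidual_limit_bidual:
  assumes L: "generalized_limit L" and u: "u \<in> bounded_seqs E"
  shows "bidual_limit L E u \<in> bidual E"
proof -
  note b = cdual_Bseq[OF u]
  have "\<exists>C. \<forall>\<alpha>\<in>cdual E. dual_norm E i \<alpha> \<le> 1 \<longrightarrow> cmod (bidual_limit L E u \<alpha>) \<le> C" for i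
  proof -
    obtain K where K: "\<And>n. snorm E i (u n) \<le> K" using u unfolding bounded_seqs_def by blast
    have "cmod (bidual_limit L E u \<alpha>) \<le> 2 * (2 * K)" if a: "\<alpha> \<in> cdual E" "dual_norm E i \<alpha> \<le> 1" for \<alpha>
    proof -
      have "cmod (\<alpha> (u n)) \<le> 2 * K" for n
        using dual_norm_le_1_bound[OF a bounded_seqs_points[OF u, of n]] K[of n] by simp
      from generalized_limitD(3)[OF L this] show ?thesis using a by (simp add: bidual_limit_def)
    qed
    then show ?thesis by blast
  qed
  moreover have "clinear_on (cdual E) (bidual_limit L E u)"
    using csubspaceD[OF cdual_subspace] generalized_limitD(1)[OF L b b] generalized_limitD(2)[OF L b]
    by (simp add: clinear_on_def bidual_limit_def scaleC_fun_def scaleC_complex_def)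
  ultimately show ?thesis unfolding bidual_iff by (simp add: bidual_limit_def)
qed

lemma bidual_limit_eq_incl:
  assumes L: "generalized_limit L" and \<phi>: "\<phi> \<in> points E"
    and u: "\<And>n. u n \<in> points E" "(\<lambda>n. u n - \<phi>) \<in> null_seqs E"
  shows "bidual_limit L E u = W_incl E \<phi>"
proof
  fix \<alpha>
  show "bidual_limit L E u \<alpha> = W_incl E \<phi> \<alpha>"
  proof (cases "\<alpha> \<in> cdual E")
    case True
    obtain i C where C: "C > 0" "\<And>u. u \<in> points E \<Longrightarrow> cmod (\<alpha> u) \<le> C * snorm E i u"
      using cdual_bound[OF True] by blast
    have lim: "(\<lambda>n. C * snorm E i (u n - \<phi>)) \<longlonglongrightarrow> 0"
      using u(2) by (intro tendsto_mult_right_zero) (simp add: null_seqs_def)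
    have "cmod (\<alpha> (u n) - \<alpha> \<phi>) \<le> C * snorm E i (u n - \<phi>)" for n
      using C(2)[OF closed(5)[OF u(1)[of n] \<phi>]] clinear_on_diff[OF subspace cdualD(3)[OF True] u(1)[of n] \<phi>] by simp
    then have "(\<lambda>n. \<alpha> (u n) - \<alpha> \<phi>) \<longlonglongrightarrow> 0"
      by (intro Lim_null_comparison[OF always_eventually lim] allI)
    then have "(\<lambda>n. \<alpha> (u n)) \<longlonglongrightarrow> \<alpha> \<phi>" by (rule LIM_zero_cancel)
    then show ?thesis
      using generalized_limitD(4)[OF L] True by (simp add: bidual_limit_def W_incl_def)
  qed (simp add: bidual_limit_def W_incl_def)
qed

end

lemma (in bounded_map) W_map_bidual_limit:
  assumes u: "u \<in> bounded_seqs E"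
  shows "W_map E F T (bidual_limit L E u) = bidual_limit L F (\<lambda>n. T (u n))"
proof
  fix \<beta>
  have "(\<lambda>n. transp E T \<beta> (u n)) = (\<lambda>n. \<beta> (T (u n)))"
    using u by (simp add: transp_def bounded_seqs_def)
  then show "W_map E F T (bidual_limit L E u) \<beta> = bidual_limit L F (\<lambda>n. T (u n)) \<beta>"
    using transp_cdual[of \<beta>] by (simp add: W_map_def bidual_limit_def)
qed

section \<open>The connecting map in degree zero\<close>

definition cochain0 :: "'c \<Rightarrow> nat \<Rightarrow> 'c" where
  "cochain0 x = (\<lambda>p\<in>{..0}. x)"

text \<open>The first component has bidegree $(0,1)$, the second $(1,0)$.\<close>

definition cochain1 :: "'c \<Rightarrow> 'c \<Rightarrow> nat \<Rightarrow> 'c" where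
  "cochain1 x y = (\<lambda>p\<in>{..Suc 0}. if p = 0 then x else y)"

lemma cochain0_apply: "cochain0 x p = (if p = 0 then x else undefined)"
  and cochain1_apply: "cochain1 x y p = (if p = 0 then x else if p = Suc 0 then y else undefined)"
  by (auto simp: cochain0_def cochain1_def)

lemma cochain0_eq_iff: "cochain0 x = cochain0 y \<longleftrightarrow> x = y"
  by (metis cochain0_apply)

lemma cochain1_eq_iff: "cochain1 x y = cochain1 x' y' \<longleftrightarrow> x = x' \<and> y = y'"
  by (metis cochain1_apply nat.distinct(1))

lemma total_mult_0: "cochain0 x \<otimes>\<^bsub>total B 0\<^esub> cochain0 y = cochain0 (x \<otimes>\<^bsub>bgrp B 0 0\<^esub> y)"
  by (auto simp: total_def cochain0_apply fun_eq_iff)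

lemma total_mult_1: "cochain1 x y \<otimes>\<^bsub>total B (Suc 0)\<^esub> cochain1 x' y' =
    cochain1 (x \<otimes>\<^bsub>bgrp B 0 (Suc 0)\<^esub> x') (y \<otimes>\<^bsub>bgrp B (Suc 0) 0\<^esub> y')"
  by (auto simp: total_def cochain1_apply fun_eq_iff le_Suc_eq)

lemma total_one_0: "\<one>\<^bsub>total B 0\<^esub> = cochain0 \<one>\<^bsub>bgrp B 0 0\<^esub>"
  and total_one_1: "\<one>\<^bsub>total B (Suc 0)\<^esub> = cochain1 \<one>\<^bsub>bgrp B 0 (Suc 0)\<^esub> \<one>\<^bsub>bgrp B (Suc 0) 0\<^esub>"
  by (auto simp: total_def cochain0_apply cochain1_apply fun_eq_iff le_Suc_eq)

lemma total_map_0: "total_map f 0 (cochain0 x) = cochain0 (f 0 0 x)"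
  and total_map_1: "total_map f (Suc 0) (cochain1 x y) = cochain1 (f 0 (Suc 0) x) (f (Suc 0) 0 y)"
  by (auto simp: total_map_def cochain0_apply cochain1_apply fun_eq_iff le_Suc_eq)

locale group_bicomplex =
  fixes B :: "'b bicomplex"
  assumes grp: "group (bgrp B p q)"
    and bD_hom: "bD B p q \<in> hom (bgrp B p q) (bgrp B (Suc p) q)"
    and bd_hom: "bd B p q \<in> hom (bgrp B p q) (bgrp B p (Suc q))"
begin

lemma bD_closed: "x \<in> carrier (bgrp B p q) \<Longrightarrow> bD B p q x \<in> carrier (bgrp B (Suc p) q)"
  and bd_closed: "x \<in> carrier (bgrp B p q) \<Longrightarrow> bd B p q x \<in> carrier (bgrp B p (Suc q))"
  and bD_mult: "x \<in> carrier (bgrp B p q) \<Longrightarrow> y \<in> carrier (bgrp B p q) \<Longrightarrow>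
    bD B p q (x \<otimes>\<^bsub>bgrp B p q\<^esub> y) = bD B p q x \<otimes>\<^bsub>bgrp B (Suc p) q\<^esub> bD B p q y"
  and bd_mult: "x \<in> carrier (bgrp B p q) \<Longrightarrow> y \<in> carrier (bgrp B p q) \<Longrightarrow>
    bd B p q (x \<otimes>\<^bsub>bgrp B p q\<^esub> y) = bd B p q x \<otimes>\<^bsub>bgrp B p (Suc q)\<^esub> bd B p q y"
  using bD_hom[of p q] bd_hom[of p q] by (auto simp: hom_def)

lemma bD_group_hom: "group_hom (bgrp B p q) (bgrp B (Suc p) q) (bD B p q)"
  and bd_group_hom: "group_hom (bgrp B p q) (bgrp B p (Suc q)) (bd B p q)"
  by (auto simp: group_hom_def group_hom_axioms_def grp bD_hom bd_hom)

lemma one_closed: "\<one>\<^bsub>bgrp B p q\<^esub> \<in> carrier (bgrp B p q)"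
  by (intro monoid.one_closed group.is_monoid grp)

lemma total_group: "group (total B n)"
  by (simp add: total_def grp)

lemma carrier_total_0: "carrier (total B 0) = cochain0 ` carrier (bgrp B 0 0)"
proof
  show "carrier (total B 0) \<subseteq> cochain0 ` carrier (bgrp B 0 0)"
  proof
    fix c assume c: "c \<in> carrier (total B 0)"
    then have "c = cochain0 (c 0)"
      by (auto simp: total_def PiE_def extensional_def fun_eq_iff cochain0_apply)
    with c show "c \<in> cochain0 ` carrier (bgrp B 0 0)" by (auto simp: total_def PiE_def)
  qed
qed (auto simp: total_def cochain0_apply PiE_def extensional_def)

lemma carrier_total_1:
  "carrier (total B (Suc 0)) = {cochain1 x y |x y. x \<in> carrier (bgrp B 0 (Suc 0)) \<and> y \<in> carrier (bgrp B (Suc 0) 0)}"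
proof (intro equalityI subsetI)
  fix c assume c: "c \<in> carrier (total B (Suc 0))"
  then have "c = cochain1 (c 0) (c (Suc 0))"
    by (auto simp: total_def PiE_def extensional_def fun_eq_iff cochain1_apply)
  moreover have "c 0 \<in> carrier (bgrp B 0 (Suc 0))" "c (Suc 0) \<in> carrier (bgrp B (Suc 0) 0)"
    using c by (force simp: total_def PiE_def)+
  ultimately show "c \<in> {cochain1 x y |x y. x \<in> carrier (bgrp B 0 (Suc 0)) \<and> y \<in> carrier (bgrp B (Suc 0) 0)}"
    by blast
qed (auto simp: total_def cochain1_apply PiE_def extensional_def le_Suc_eq)

lemma total_diff_0:
  assumes "x \<in> carrier (bgrp B 0 0)"
  shows "total_diff B 0 (cochain0 x) = cochain1 (bd B 0 0 x) (bD B 0 0 x)"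
proof
  fix p :: nat
  consider "p = 0" | "p = Suc 0" | "p > Suc 0" by linarith
  then show "total_diff B 0 (cochain0 x) p = cochain1 (bd B 0 0 x) (bD B 0 0 x) p"
    using bD_closed[OF assms] bd_closed[OF assms]
    by cases (simp_all add: total_diff_def monoid.l_one monoid.r_one group.is_monoid grp cochain0_apply cochain1_apply)
qed

lemma cochain1_closed:
  "x \<in> carrier (bgrp B 0 (Suc 0)) \<Longrightarrow> y \<in> carrier (bgrp B (Suc 0) 0) \<Longrightarrow> cochain1 x y \<in> carrier (total B (Suc 0))"
  by (auto simp: carrier_total_1)

lemma cocycles_0:
  "cocycles B 0 = cochain0 ` {x \<in> carrier (bgrp B 0 0).
     bD B 0 0 x = \<one>\<^bsub>bgrp B (Suc 0) 0\<^esub> \<and> bd B 0 0 x = \<one>\<^bsub>bgrp B 0 (Suc 0)\<^esub>}"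
proof -
  have "total_diff B 0 (cochain0 x) = \<one>\<^bsub>total B (Suc 0)\<^esub> \<longleftrightarrow>
      bD B 0 0 x = \<one>\<^bsub>bgrp B (Suc 0) 0\<^esub> \<and> bd B 0 0 x = \<one>\<^bsub>bgrp B 0 (Suc 0)\<^esub>"
    if "x \<in> carrier (bgrp B 0 0)" for x
    unfolding total_diff_0[OF that]
    by (auto simp: total_one_1 cochain1_eq_iff)
  then show ?thesis
    by (auto simp: cocycles_def kernel_def carrier_total_0)
qed

lemma cohomology_class_0:
  assumes "x \<in> carrier (bgrp B 0 0)"
  shows "cohomology_class B 0 (cochain0 x) = {cochain0 x}"
  using assms by (simp add: cohomology_class_def coboundaries_def total_one_0 r_coset_def total_mult_0
      monoid.l_one group.is_monoid grp)

lemma carrier_cohomology_0: "carrier (cohomology B 0) = (\<lambda>c. {c}) ` cocycles B 0"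
proof -
  have "coboundaries B 0 #>\<^bsub>total B 0\<lparr>carrier := cocycles B 0\<rparr>\<^esub> c = {c}" if c: "c \<in> cocycles B 0" for c
  proof -
    obtain x where x: "x \<in> carrier (bgrp B 0 0)" "c = cochain0 x"
      using c unfolding cocycles_0 by blast
    then show ?thesis
      using cohomology_class_0[OF x(1)] by (simp add: cohomology_class_def r_coset_def)
  qed
  then show ?thesis
    by (auto simp: cohomology_def FactGroup_def RCOSETS_def)
qed

lemma total_diff_hom_0: "group_hom (total B 0) (total B (Suc 0)) (total_diff B 0)"
proof -
  have "total_diff B 0 \<in> hom (total B 0) (total B (Suc 0))"
  proof (rule homI)
    fix x y assume "x \<in> carrier (total B 0)" "y \<in> carrier (total B 0)"
    then obtain u v where u: "u \<in> carrier (bgrp B 0 0)" "x = cochain0 u"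
      and v: "v \<in> carrier (bgrp B 0 0)" "y = cochain0 v"
      by (auto simp: carrier_total_0)
    have uv: "u \<otimes>\<^bsub>bgrp B 0 0\<^esub> v \<in> carrier (bgrp B 0 0)"
      using u v by (intro monoid.m_closed group.is_monoid grp)
    show "total_diff B 0 (x \<otimes>\<^bsub>total B 0\<^esub> y) = total_diff B 0 x \<otimes>\<^bsub>total B (Suc 0)\<^esub> total_diff B 0 y"
      unfolding u(2) v(2) total_mult_0 total_diff_0[OF uv] total_diff_0[OF u(1)] total_diff_0[OF v(1)]
        total_mult_1 bD_mult[OF u(1) v(1)] bd_mult[OF u(1) v(1)] ..
  next
    fix x assume "x \<in> carrier (total B 0)"
    then obtain u where u: "u \<in> carrier (bgrp B 0 0)" "x = cochain0 u"
      by (auto simp: carrier_total_0)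
    show "total_diff B 0 x \<in> carrier (total B (Suc 0))"
      unfolding u(2) total_diff_0[OF u(1)] by (intro cochain1_closed bD_closed bd_closed u)
  qed
  then show ?thesis by (simp add: group_hom_def group_hom_axioms_def total_group)
qed

lemma coboundaries_1: "coboundaries B (Suc 0) = total_diff B 0 ` cochain0 ` carrier (bgrp B 0 0)"
  by (simp add: coboundaries_def carrier_total_0)

lemma coboundaries_1_subgroup: "subgroup (coboundaries B (Suc 0)) (total B (Suc 0))"
  using group_hom.img_is_subgroup[OF total_diff_hom_0] by (simp add: coboundaries_def)

lemma cocycle_1I:
  assumes y: "y \<in> carrier (bgrp B (Suc 0) 0)"
    and "bD B (Suc 0) 0 y = \<one>\<^bsub>bgrp B (Suc (Suc 0)) 0\<^esub>" "bd B (Suc 0) 0 y = \<one>\<^bsub>bgrp B (Suc 0) (Suc 0)\<^esub>"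
  shows "cochain1 \<one>\<^bsub>bgrp B 0 (Suc 0)\<^esub> y \<in> cocycles B (Suc 0)"
proof -
  have D1: "bD B 0 (Suc 0) \<one>\<^bsub>bgrp B 0 (Suc 0)\<^esub> = \<one>\<^bsub>bgrp B (Suc 0) (Suc 0)\<^esub>"
    "bd B 0 (Suc 0) \<one>\<^bsub>bgrp B 0 (Suc 0)\<^esub> = \<one>\<^bsub>bgrp B 0 (Suc (Suc 0))\<^esub>"
    by (intro group_hom.hom_one bD_group_hom bd_group_hom)+
  have "total_diff B (Suc 0) (cochain1 \<one>\<^bsub>bgrp B 0 (Suc 0)\<^esub> y) = \<one>\<^bsub>total B (Suc (Suc 0))\<^esub>"
  proof
    fix p :: nat
    consider "p = 0" | "p = Suc 0" | "p = Suc (Suc 0)" | "p > Suc (Suc 0)" by linarith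
    then show "total_diff B (Suc 0) (cochain1 \<one>\<^bsub>bgrp B 0 (Suc 0)\<^esub> y) p = \<one>\<^bsub>total B (Suc (Suc 0))\<^esub> p"
      by cases (simp_all add: total_diff_def total_def cochain1_apply assms D1 monoid.l_one group.is_monoid grp one_closed)
  qed
  then show ?thesis
    using cochain1_closed[OF one_closed y] by (simp add: cocycles_def kernel_def)
qed

end

text \<open>A sequence \<open>0 \<rightarrow> A \<rightarrow> B \<rightarrow> C \<rightarrow> 0\<close> exact in the bidegrees that matter for the connecting map
  in degree 0, together with an element \<open>z\<close> of \<open>C\<close> and a lift \<open>b\<close> of it to \<open>B\<close> whose boundary is an
  explicit cocycle of \<open>A\<close> concentrated in bidegree $(1,0)$. The lift makes the class defining the
  connecting map exist; uniqueness follows from exactness.\<close>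

locale connecting_lift = A: group_bicomplex A + B: group_bicomplex B + C: group_bicomplex C
  for A :: "'a bicomplex" and B :: "'b bicomplex" and C :: "'c bicomplex" +
  fixes i :: "nat \<Rightarrow> nat \<Rightarrow> 'a \<Rightarrow> 'b" and r :: "nat \<Rightarrow> nat \<Rightarrow> 'b \<Rightarrow> 'c" and z :: 'c and b :: 'b and a :: 'a
  assumes i_hom: "i p q \<in> hom (bgrp A p q) (bgrp B p q)"
    and i_inj: "inj_on (i p q) (carrier (bgrp A p q))"
    and r_hom: "r 0 0 \<in> hom (bgrp B 0 0) (bgrp C 0 0)"
    and exact: "x \<in> carrier (bgrp B 0 0) \<Longrightarrow> r 0 0 x = \<one>\<^bsub>bgrp C 0 0\<^esub> \<Longrightarrow>
      \<exists>c\<in>carrier (bgrp A 0 0). i 0 0 c = x"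
    and r_i: "c \<in> carrier (bgrp A 0 0) \<Longrightarrow> r 0 0 (i 0 0 c) = \<one>\<^bsub>bgrp C 0 0\<^esub>"
    and i_bD: "c \<in> carrier (bgrp A 0 0) \<Longrightarrow> i (Suc 0) 0 (bD A 0 0 c) = bD B 0 0 (i 0 0 c)"
    and i_bd: "c \<in> carrier (bgrp A 0 0) \<Longrightarrow> i 0 (Suc 0) (bd A 0 0 c) = bd B 0 0 (i 0 0 c)"
    and z: "z \<in> carrier (bgrp C 0 0)"
    and b: "b \<in> carrier (bgrp B 0 0)" "r 0 0 b = z" "bd B 0 0 b = \<one>\<^bsub>bgrp B 0 (Suc 0)\<^esub>"
    and a: "a \<in> carrier (bgrp A (Suc 0) 0)" "i (Suc 0) 0 a = bD B 0 0 b"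
      "bD A (Suc 0) 0 a = \<one>\<^bsub>bgrp A (Suc (Suc 0)) 0\<^esub>" "bd A (Suc 0) 0 a = \<one>\<^bsub>bgrp A (Suc 0) (Suc 0)\<^esub>"
begin

lemma i_group_hom: "group_hom (bgrp A p q) (bgrp B p q) (i p q)"
  by (auto simp: group_hom_def group_hom_axioms_def A.grp B.grp i_hom)

lemma i_closed: "x \<in> carrier (bgrp A p q) \<Longrightarrow> i p q x \<in> carrier (bgrp B p q)"
  using i_hom by (auto simp: hom_def)

abbreviation "lift_boundary \<equiv> cochain1 \<one>\<^bsub>bgrp A 0 (Suc 0)\<^esub> a"

lemma total_map_i_inj:
  assumes "x \<in> carrier (total A (Suc 0))" "y \<in> carrier (total A (Suc 0))"
    "total_map i (Suc 0) x = total_map i (Suc 0) y"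
  shows "x = y"
  using assms inj_onD[OF i_inj]
  by (auto simp: A.carrier_total_1 total_map_1 cochain1_eq_iff)

lemma total_map_i_diff:
  assumes "c \<in> carrier (bgrp A 0 0)"
  shows "total_map i (Suc 0) (total_diff A 0 (cochain0 c)) = total_diff B 0 (cochain0 (i 0 0 c))"
  unfolding A.total_diff_0[OF assms] B.total_diff_0[OF i_closed[OF assms]] total_map_1
    i_bD[OF assms] i_bd[OF assms] ..

lemma total_map_i_mult:
  assumes "x \<in> carrier (total A (Suc 0))" "y \<in> carrier (total A (Suc 0))"
  shows "total_map i (Suc 0) (x \<otimes>\<^bsub>total A (Suc 0)\<^esub> y) =
    total_map i (Suc 0) x \<otimes>\<^bsub>total B (Suc 0)\<^esub> total_map i (Suc 0) y"
proof -
  have "i p q (u \<otimes>\<^bsub>bgrp A p q\<^esub> v) = i p q u \<otimes>\<^bsub>bgrp B p q\<^esub> i p q v"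
    if "u \<in> carrier (bgrp A p q)" "v \<in> carrier (bgrp A p q)" for p q u v
    using i_hom[of p q] that by (auto simp: hom_def)
  then show ?thesis
    using assms by (auto simp: A.carrier_total_1 total_map_1 total_mult_1)
qed

lemma lift_boundary: "total_map i (Suc 0) lift_boundary = total_diff B 0 (cochain0 b)"
  unfolding B.total_diff_0[OF b(1)] total_map_1 b(3) a(2) group_hom.hom_one[OF i_group_hom] ..

lemma lift_boundary_cocycle: "lift_boundary \<in> cocycles A (Suc 0)"
  using a by (intro A.cocycle_1I)

lemma cocycle_total: "x \<in> cocycles A (Suc 0) \<Longrightarrow> x \<in> carrier (total A (Suc 0))"
  by (simp add: cocycles_def kernel_def)

text \<open>Two lifts of \<open>z\<close> differ by an element of the kernel of \<open>r\<close>, which has the form \<open>i c\<close>. As \<open>i\<close> is injective,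
  the preimages in \<open>A\<close> of their boundaries then differ by the boundary of \<open>c\<close>.\<close>

lemma other_lift:
  assumes y: "y \<in> carrier (bgrp B 0 0)" "r 0 0 y = z"
    and x: "x \<in> carrier (total A (Suc 0))" "total_map i (Suc 0) x = total_diff B 0 (cochain0 y)"
  shows "\<exists>c\<in>carrier (bgrp A 0 0). y = i 0 0 c \<otimes>\<^bsub>bgrp B 0 0\<^esub> b \<and>
    x = total_diff A 0 (cochain0 c) \<otimes>\<^bsub>total A (Suc 0)\<^esub> lift_boundary"
proof -
  interpret G: group "bgrp B 0 0" by (rule B.grp)
  interpret R: group_hom "bgrp B 0 0" "bgrp C 0 0" "r 0 0"
    by (auto simp: group_hom_def group_hom_axioms_def B.grp C.grp r_hom)
  interpret T: group_hom "total B 0" "total B (Suc 0)" "total_diff B 0" by (rule B.total_diff_hom_0)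
  interpret TA: group_hom "total A 0" "total A (Suc 0)" "total_diff A 0" by (rule A.total_diff_hom_0)
  have "r 0 0 (y \<otimes>\<^bsub>bgrp B 0 0\<^esub> inv\<^bsub>bgrp B 0 0\<^esub> b) = \<one>\<^bsub>bgrp C 0 0\<^esub>"
    using y b z by (simp add: group.r_inv[OF C.grp])
  then obtain c where c: "c \<in> carrier (bgrp A 0 0)" "i 0 0 c = y \<otimes>\<^bsub>bgrp B 0 0\<^esub> inv\<^bsub>bgrp B 0 0\<^esub> b"
    using exact y(1) b(1) by (meson G.inv_closed G.m_closed)
  have yc: "y = i 0 0 c \<otimes>\<^bsub>bgrp B 0 0\<^esub> b" using c y b by (simp add: G.m_assoc)
  have c0: "cochain0 c \<in> carrier (total A 0)" using c by (auto simp: A.carrier_total_0)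
  have "cochain0 y = cochain0 (i 0 0 c) \<otimes>\<^bsub>total B 0\<^esub> cochain0 b"
    by (simp only: yc total_mult_0)
  moreover have "cochain0 (i 0 0 c) \<in> carrier (total B 0)" "cochain0 b \<in> carrier (total B 0)"
    using i_closed[OF c(1)] b by (auto simp: B.carrier_total_0)
  ultimately have "total_diff B 0 (cochain0 y) =
      total_diff B 0 (cochain0 (i 0 0 c)) \<otimes>\<^bsub>total B (Suc 0)\<^esub> total_diff B 0 (cochain0 b)"
    by (simp only: T.hom_mult)
  also have "\<dots> = total_map i (Suc 0) (total_diff A 0 (cochain0 c) \<otimes>\<^bsub>total A (Suc 0)\<^esub> lift_boundary)"
    unfolding total_map_i_diff[OF c(1), symmetric] lift_boundary[symmetric]
    by (rule total_map_i_mult[symmetric, OF TA.hom_closed[OF c0] cocycle_total[OF lift_boundary_cocycle]])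
  finally have "x = total_diff A 0 (cochain0 c) \<otimes>\<^bsub>total A (Suc 0)\<^esub> lift_boundary"
    using x TA.hom_closed[OF c0] cocycle_total[OF lift_boundary_cocycle]
    by (intro total_map_i_inj TA.H.m_closed) auto
  with c yc show ?thesis by blast
qed

lemma connecting_eq:
  "connecting A B i r 0 (cohomology_class C 0 (cochain0 z)) = cohomology_class A (Suc 0) lift_boundary"
  unfolding connecting_def
proof (rule the_equality)
  have rb: "total_map r 0 (cochain0 b) = cochain0 z"
    by (simp only: total_map_0 b(2))
  show "\<exists>b\<in>carrier (total B 0). \<exists>a\<in>cocycles A (Suc 0). total_map r 0 b \<in> cohomology_class C 0 (cochain0 z) \<and>
      total_map i (Suc 0) a = total_diff B 0 b \<and>
      cohomology_class A (Suc 0) lift_boundary = cohomology_class A (Suc 0) a"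
    using b(1) lift_boundary lift_boundary_cocycle rb
    by (intro bexI[of _ "cochain0 b"] bexI[of _ lift_boundary])
       (auto simp: C.cohomology_class_0[OF z] B.carrier_total_0)
  fix h
  assume "\<exists>b\<in>carrier (total B 0). \<exists>a\<in>cocycles A (Suc 0). total_map r 0 b \<in> cohomology_class C 0 (cochain0 z) \<and>
      total_map i (Suc 0) a = total_diff B 0 b \<and> h = cohomology_class A (Suc 0) a"
  then obtain y x where y: "y \<in> carrier (bgrp B 0 0)" "total_map r 0 (cochain0 y) = cochain0 z"
    and x: "x \<in> cocycles A (Suc 0)" "total_map i (Suc 0) x = total_diff B 0 (cochain0 y)"
    and h: "h = cohomology_class A (Suc 0) x"
    by (auto simp: C.cohomology_class_0[OF z] B.carrier_total_0)
  have "r 0 0 y = z" using y(2) by (simp add: total_map_0 cochain0_eq_iff)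
  from other_lift[OF y(1) this cocycle_total[OF x(1)] x(2)]
  obtain c where c: "c \<in> carrier (bgrp A 0 0)"
    "x = total_diff A 0 (cochain0 c) \<otimes>\<^bsub>total A (Suc 0)\<^esub> lift_boundary" by blast
  have "total_diff A 0 (cochain0 c) \<in> coboundaries A (Suc 0)" using c by (auto simp: A.coboundaries_1)
  then have "x \<in> coboundaries A (Suc 0) #>\<^bsub>total A (Suc 0)\<^esub> lift_boundary"
    unfolding c(2) by (auto simp: r_coset_def)
  from group.repr_independence[OF A.total_group this cocycle_total[OF lift_boundary_cocycle] A.coboundaries_1_subgroup]
  show "h = cohomology_class A (Suc 0) lift_boundary"
    unfolding h cohomology_class_def by simp
qed

text \<open>If the boundary of the lift \<open>b\<close> is also the boundary of \<open>c\<close> in \<open>A\<close>, then \<open>- i c + b\<close> is a cocycle that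
  still lifts \<open>z\<close>, and conversely.\<close>

lemma connecting_trivial_iff:
  "connecting A B i r 0 (cohomology_class C 0 (cochain0 z)) = \<one>\<^bsub>cohomology A (Suc 0)\<^esub> \<longleftrightarrow>
    (\<exists>y\<in>carrier (bgrp B 0 0). bD B 0 0 y = \<one>\<^bsub>bgrp B (Suc 0) 0\<^esub> \<and> bd B 0 0 y = \<one>\<^bsub>bgrp B 0 (Suc 0)\<^esub> \<and>
      r 0 0 y = z)" (is "_ \<longleftrightarrow> ?R")
proof -
  interpret G: group "bgrp B 0 0" by (rule B.grp)
  interpret TA: group "total A (Suc 0)" by (rule A.total_group)
  interpret T: group_hom "total A 0" "total A (Suc 0)" "total_diff A 0" by (rule A.total_diff_hom_0)
  interpret TB: group_hom "total B 0" "total B (Suc 0)" "total_diff B 0" by (rule B.total_diff_hom_0)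
  interpret R: group_hom "bgrp B 0 0" "bgrp C 0 0" "r 0 0"
    by (auto simp: group_hom_def group_hom_axioms_def B.grp C.grp r_hom)
  note a' = cocycle_total[OF lift_boundary_cocycle]
  have "connecting A B i r 0 (cohomology_class C 0 (cochain0 z)) = \<one>\<^bsub>cohomology A (Suc 0)\<^esub> \<longleftrightarrow>
      coboundaries A (Suc 0) #>\<^bsub>total A (Suc 0)\<^esub> lift_boundary = coboundaries A (Suc 0)"
    unfolding connecting_eq by (simp add: cohomology_def cohomology_class_def FactGroup_def)
  also have "\<dots> \<longleftrightarrow> lift_boundary \<in> coboundaries A (Suc 0)"
    using TA.coset_join1[OF _ a' A.coboundaries_1_subgroup]
      TA.coset_join2[OF a' A.coboundaries_1_subgroup] by (rule iffI)
  also have "\<dots> \<longleftrightarrow> ?R"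
  proof
    assume ?R
    then obtain y where y: "y \<in> carrier (bgrp B 0 0)" "r 0 0 y = z"
      and cocycle: "cochain0 y \<in> cocycles B 0" by (auto simp: B.cocycles_0)
    from cocycle have "total_diff B 0 (cochain0 y) = \<one>\<^bsub>total B (Suc 0)\<^esub>"
      by (simp add: cocycles_def kernel_def)
    moreover have "total_map i (Suc 0) \<one>\<^bsub>total A (Suc 0)\<^esub> = \<one>\<^bsub>total B (Suc 0)\<^esub>"
      by (simp only: total_one_1 total_map_1 group_hom.hom_one[OF i_group_hom])
    ultimately obtain c where c: "c \<in> carrier (bgrp A 0 0)"
      "\<one>\<^bsub>total A (Suc 0)\<^esub> = total_diff A 0 (cochain0 c) \<otimes>\<^bsub>total A (Suc 0)\<^esub> lift_boundary"
      using other_lift[OF y TA.one_closed] by metis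
    have c0: "total_diff A 0 (cochain0 c) \<in> coboundaries A (Suc 0)" using c by (auto simp: A.coboundaries_1)
    have tc: "total_diff A 0 (cochain0 c) \<in> carrier (total A (Suc 0))"
      using c0 subgroup.subset[OF A.coboundaries_1_subgroup] by blast
    have "lift_boundary = inv\<^bsub>total A (Suc 0)\<^esub> total_diff A 0 (cochain0 c)"
      using TA.inv_equality[OF c(2)[symmetric] a' tc] TA.inv_inv[OF a'] by simp
    then show "lift_boundary \<in> coboundaries A (Suc 0)"
      using subgroup.m_inv_closed[OF A.coboundaries_1_subgroup c0] by simp
  next
    assume "lift_boundary \<in> coboundaries A (Suc 0)"
    then obtain c where c: "c \<in> carrier (bgrp A 0 0)" "lift_boundary = total_diff A 0 (cochain0 c)"
      by (auto simp: A.coboundaries_1)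
    define y where "y = inv\<^bsub>bgrp B 0 0\<^esub> (i 0 0 c) \<otimes>\<^bsub>bgrp B 0 0\<^esub> b"
    have ic: "i 0 0 c \<in> carrier (bgrp B 0 0)" by (rule i_closed[OF c(1)])
    have y: "y \<in> carrier (bgrp B 0 0)" unfolding y_def using ic b by simp
    have "r 0 0 y = z"
      unfolding y_def using ic b z r_i[OF c(1)] C.grp[of 0 0] by (simp add: monoid.inv_one group.is_monoid)
    moreover have "total_diff B 0 (cochain0 (i 0 0 c)) = total_diff B 0 (cochain0 b)"
      using lift_boundary unfolding c(2) total_map_i_diff[OF c(1)] .
    then have *: "bD B 0 0 (i 0 0 c) = bD B 0 0 b" "bd B 0 0 (i 0 0 c) = bd B 0 0 b"
      unfolding B.total_diff_0[OF ic] B.total_diff_0[OF b(1)]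
cochain1_eq_iff by simp_all
    interpret D: group_hom "bgrp B 0 0" "bgrp B (Suc 0) 0" "bD B 0 0" by (rule B.bD_group_hom)
    interpret d: group_hom "bgrp B 0 0" "bgrp B 0 (Suc 0)" "bd B 0 0" by (rule B.bd_group_hom)
    have "bD B 0 0 y = \<one>\<^bsub>bgrp B (Suc 0) 0\<^esub>" "bd B 0 0 y = \<one>\<^bsub>bgrp B 0 (Suc 0)\<^esub>"
      unfolding y_def using ic b(1) * by simp_all
    ultimately show ?R using y by blast
  qed
  finally show ?thesis .
qed

text \<open>In degree 0 there are no coboundaries, so that classes are single cocycles.\<close>

lemma in_image_iff:
  "cohomology_class C 0 (cochain0 z) \<in> cohomology_map C r 0 ` carrier (cohomology B 0) \<longleftrightarrow>
    (\<exists>y\<in>carrier (bgrp B 0 0). bD B 0 0 y = \<one>\<^bsub>bgrp B (Suc 0) 0\<^esub> \<and> bd B 0 0 y = \<one>\<^bsub>bgrp B 0 (Suc 0)\<^esub> \<and>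
      r 0 0 y = z)"
proof -
  have *: "cohomology_map C r 0 {cochain0 y} = {cochain0 (r 0 0 y)}" if "y \<in> carrier (bgrp B 0 0)" for y
  proof -
    have ry: "r 0 0 y \<in> carrier (bgrp C 0 0)" using r_hom that by (auto simp: hom_def)
    have "cohomology_map C r 0 {cochain0 y} = cohomology_class C 0 (cochain0 (r 0 0 y))"
      by (auto simp: cohomology_map_def cohomology_class_def set_mult_def r_coset_def total_map_0)
    then show ?thesis by (simp add: C.cohomology_class_0[OF ry])
  qed
  show ?thesis
    unfolding C.cohomology_class_0[OF z] B.carrier_cohomology_0 B.cocycles_0
    by (auto simp: * image_iff cochain0_eq_iff)
qed

end

section \<open>Cochains\<close>

lemma (in equivariant_module) act_0: "vact V g 0 = 0"
  using clinear_on_zero[OF subspace act_linear] .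

lemma (in equivariant_module) norm_zero: "vnorm V 0 = 0"
  using norm_scale[of 0 0] csubspaceD(1)[OF subspace] by simp

lemma points_cochains_iff:
  "\<phi> \<in> points (cochains V p q) \<longleftrightarrow>
    (\<forall>xs ys. length xs = Suc p \<longrightarrow> length ys = Suc q \<longrightarrow> \<phi> xs ys \<in> vcarrier V) \<and>
    (\<forall>xs ys. \<not> (length xs = Suc p \<and> length ys = Suc q) \<longrightarrow> \<phi> xs ys = 0) \<and>
    equivariant V p q \<phi> \<and> controlled_supports V p q \<phi> \<and>
    (\<forall>R>0. \<exists>C. \<forall>xs\<in>diag_nbhd R p. \<forall>ys. length ys = Suc q \<longrightarrow> vnorm V (\<phi> xs ys) \<le> C)"
proof -
  have "bdd_above (cochain_norms V p q R \<phi>) \<longleftrightarrow>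
      (\<exists>C. \<forall>xs\<in>diag_nbhd R p. \<forall>ys. length ys = Suc q \<longrightarrow> vnorm V (\<phi> xs ys) \<le> C)" for R
    unfolding bdd_above_def cochain_norms_def by (rule iff_exI) blast
  moreover have "(\<forall>xs ys. if length xs = Suc p \<and> length ys = Suc q then \<phi> xs ys \<in> vcarrier V else \<phi> xs ys = 0) \<longleftrightarrow>
      (\<forall>xs ys. length xs = Suc p \<longrightarrow> length ys = Suc q \<longrightarrow> \<phi> xs ys \<in> vcarrier V) \<and>
      (\<forall>xs ys. \<not> (length xs = Suc p \<and> length ys = Suc q) \<longrightarrow> \<phi> xs ys = 0)"
    unfolding if_bool_eq_conj by blast
  ultimately show ?thesis
    unfolding cochains_def seminormed.select_convs mem_Collect_eq by (simp only: conj_assoc)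
qed

lemma cochainD:
  assumes "\<phi> \<in> points (cochains V p q)"
  shows "length xs = Suc p \<Longrightarrow> length ys = Suc q \<Longrightarrow> \<phi> xs ys \<in> vcarrier V"
    "length xs \<noteq> Suc p \<or> length ys \<noteq> Suc q \<Longrightarrow> \<phi> xs ys = 0"
    "length xs = Suc p \<Longrightarrow> length ys = Suc q \<Longrightarrow>
      vact V g (\<phi> xs ys) = \<phi> (map (\<lambda>x. g + x) xs) (map (\<lambda>y. g + y) ys)"
    "controlled_supports V p q \<phi>"
    "R > 0 \<Longrightarrow> \<exists>C. \<forall>xs\<in>diag_nbhd R p. \<forall>ys. length ys = Suc q \<longrightarrow> vnorm V (\<phi> xs ys) \<le> C"
proof -
  note \<phi> = assms[unfolded points_cochains_iff equivariant_def]
  show "length xs = Suc p \<Longrightarrow> length ys = Suc q \<Longrightarrow> \<phi> xs ys \<in> vcarrier V"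
    using \<phi>[THEN conjunct1] by blast
  show "length xs \<noteq> Suc p \<or> length ys \<noteq> Suc q \<Longrightarrow> \<phi> xs ys = 0"
    using \<phi>[THEN conjunct2, THEN conjunct1] by blast
  show "length xs = Suc p \<Longrightarrow> length ys = Suc q \<Longrightarrow>
      vact V g (\<phi> xs ys) = \<phi> (map (\<lambda>x. g + x) xs) (map (\<lambda>y. g + y) ys)"
    using \<phi>[THEN conjunct2, THEN conjunct2, THEN conjunct1] by simp
  show "controlled_supports V p q \<phi>" using \<phi> by simp
  show "R > 0 \<Longrightarrow> \<exists>C. \<forall>xs\<in>diag_nbhd R p. \<forall>ys. length ys = Suc q \<longrightarrow> vnorm V (\<phi> xs ys) \<le> C"
    using \<phi> by simp
qed

lemma snorm_cochains_upper:
  assumes "\<phi> \<in> points (cochains V p q)" "xs \<in> diag_nbhd (real (Suc i)) p" "length ys = Suc q"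
  shows "vnorm V (\<phi> xs ys) \<le> snorm (cochains V p q) i \<phi>"
  unfolding cochains_def seminormed.select_convs
proof (rule cSup_upper)
  show "vnorm V (\<phi> xs ys) \<in> cochain_norms V p q (real (Suc i)) \<phi>"
    unfolding cochain_norms_def using assms(2,3) by blast
  have "\<forall>R>0. bdd_above (cochain_norms V p q R \<phi>)" using assms(1) by (simp add: cochains_def)
  then show "bdd_above (cochain_norms V p q (real (Suc i)) \<phi>)" by simp
qed

lemma snorm_cochains_least:
  fixes V :: "('g::{group_add,metric_space}, 'v::complex_vector) xmodule"
  assumes "\<And>xs ys. xs \<in> diag_nbhd (real (Suc i)) p \<Longrightarrow> length ys = Suc q \<Longrightarrow> vnorm V (\<phi> xs ys) \<le> C"
  shows "snorm (cochains V p q) i \<phi> \<le> C"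
proof -
  have "replicate (Suc p) (0::'g) \<in> diag_nbhd (real (Suc i)) p" by (auto simp: diag_nbhd_def)
  then have "cochain_norms V p q (real (Suc i)) \<phi> \<noteq> {}"
    using length_replicate[of "Suc q" "0::'g"] unfolding cochain_norms_def by blast
  then show ?thesis
    unfolding cochains_def seminormed.select_convs
    by (rule cSup_least) (auto simp: cochain_norms_def simp del: of_nat_Suc intro: assms)
qed

lemma diag_nbhd_mono: "R \<le> R' \<Longrightarrow> diag_nbhd R p \<subseteq> diag_nbhd R' p"
  by (force simp: diag_nbhd_def)

lemma controlled_supports_iff:
  "controlled_supports V p q \<phi> \<longleftrightarrow> (\<forall>R>0. \<exists>S>0. \<forall>xs ys z. (xs, ys) \<in> diag_nbhd2 R p q \<longrightarrow> z \<in> set xs \<union> set ys \<longrightarrow>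
    vsupp V (\<phi> xs ys) \<subseteq> ball z S)"
  by (simp add: controlled_supports_def Ball_def split_paired_All)

lemma controlled_supportsD:
  assumes "controlled_supports V p q \<phi>" "R > 0"
  obtains S where "S > 0" "\<And>xs ys z. (xs, ys) \<in> diag_nbhd2 R p q \<Longrightarrow> z \<in> set xs \<union> set ys \<Longrightarrow>
    vsupp V (\<phi> xs ys) \<subseteq> ball z S"
  using assms unfolding controlled_supports_iff by metis

lemma cochains_seminormed_space:
  fixes V :: "('g::{group_add,metric_space}, 'v::complex_vector) xmodule"
  assumes "equivariant_module V"
  shows "seminormed_space (cochains V p q)"
proof -
  interpret V: equivariant_module V by fact
  note cl = csubspaceD[OF V.subspace]
  have add: "\<phi> + \<psi> \<in> points (cochains V p q)"
    if \<phi>: "\<phi> \<in> points (cochains V p q)" and \<psi>: "\<psi> \<in> points (cochains V p q)" for \<phi> \<psi>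
    unfolding points_cochains_iff
  proof (intro conjI allI impI)
    show "equivariant V p q (\<phi> + \<psi>)"
      using V.act_linear cochainD(1)[OF \<phi>] cochainD(1)[OF \<psi>]
      by (simp add: equivariant_def clinear_on_def cochainD(3)[OF \<phi>] cochainD(3)[OF \<psi>])
    show "controlled_supports V p q (\<phi> + \<psi>)"
      unfolding controlled_supports_iff
    proof (intro allI impI)
      fix R :: real assume R: "R > 0"
      obtain S where S: "S > 0" "\<And>xs ys z. (xs, ys) \<in> diag_nbhd2 R p q \<Longrightarrow> z \<in> set xs \<union> set ys \<Longrightarrow>
          vsupp V (\<phi> xs ys) \<subseteq> ball z S"
        using controlled_supportsD[OF cochainD(4)[OF \<phi>] R] by blast
      obtain S' where S': "S' > 0" "\<And>xs ys z. (xs, ys) \<in> diag_nbhd2 R p q \<Longrightarrow> z \<in> set xs \<union> set ys \<Longrightarrow>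
          vsupp V (\<psi> xs ys) \<subseteq> ball z S'"
        using controlled_supportsD[OF cochainD(4)[OF \<psi>] R] by blast
      have "vsupp V ((\<phi> + \<psi>) xs ys) \<subseteq> ball z (max S S')"
        if d: "(xs, ys) \<in> diag_nbhd2 R p q" and z: "z \<in> set xs \<union> set ys" for xs ys z
      proof -
        have l: "length xs = Suc p" "length ys = Suc q" using d by (auto simp: diag_nbhd2_def)
        have "vsupp V ((\<phi> + \<psi>) xs ys) \<subseteq> vsupp V (\<phi> xs ys) \<union> vsupp V (\<psi> xs ys)"
          using V.supp_add[OF cochainD(1)[OF \<phi> l] cochainD(1)[OF \<psi> l]] by simp
        moreover have "ball z S \<subseteq> ball z (max S S')" "ball z S' \<subseteq> ball z (max S S')"
          by (simp_all add: subset_ball)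
        ultimately show ?thesis using S(2)[OF d z] S'(2)[OF d z] by blast
      qed
      then show "\<exists>S>0. \<forall>xs ys z. (xs, ys) \<in> diag_nbhd2 R p q \<longrightarrow> z \<in> set xs \<union> set ys \<longrightarrow>
          vsupp V ((\<phi> + \<psi>) xs ys) \<subseteq> ball z S"
        using S(1) by (intro exI[of _ "max S S'"] conjI allI impI) auto
    qed
    fix R :: real assume R: "R > 0"
    obtain C C' where "\<And>xs ys. xs \<in> diag_nbhd R p \<Longrightarrow> length ys = Suc q \<Longrightarrow> vnorm V (\<phi> xs ys) \<le> C"
      "\<And>xs ys. xs \<in> diag_nbhd R p \<Longrightarrow> length ys = Suc q \<Longrightarrow> vnorm V (\<psi> xs ys) \<le> C'"
      using cochainD(5)[OF \<phi> R] cochainD(5)[OF \<psi> R] by blast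
    then have "vnorm V (\<phi> xs ys) + vnorm V (\<psi> xs ys) \<le> C + C'" if "xs \<in> diag_nbhd R p" "length ys = Suc q" for xs ys
      using that by (intro add_mono)
    moreover have "vnorm V ((\<phi> + \<psi>) xs ys) \<le> vnorm V (\<phi> xs ys) + vnorm V (\<psi> xs ys)"
      if "xs \<in> diag_nbhd R p" "length ys = Suc q" for xs ys
      using V.norm_triangle[OF cochainD(1)[OF \<phi>] cochainD(1)[OF \<psi>], of xs ys xs ys] that
      by (simp add: diag_nbhd_def)
    ultimately have "vnorm V ((\<phi> + \<psi>) xs ys) \<le> C + C'" if "xs \<in> diag_nbhd R p" "length ys = Suc q" for xs ys
      using that order_trans by blast
    then show "\<exists>C. \<forall>xs\<in>diag_nbhd R p. \<forall>ys. length ys = Suc q \<longrightarrow> vnorm V ((\<phi> + \<psi>) xs ys) \<le> C" by blast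
  qed (use cochainD(1,2)[OF \<phi>] cochainD(1,2)[OF \<psi>] cl in auto)
  have scale: "c *\<^sub>C \<phi> \<in> points (cochains V p q)" if \<phi>: "\<phi> \<in> points (cochains V p q)" for c \<phi>
    unfolding points_cochains_iff
  proof (intro conjI allI impI)
    show "equivariant V p q (c *\<^sub>C \<phi>)"
      using V.act_linear cochainD(1)[OF \<phi>]
      by (simp add: equivariant_def clinear_on_def cochainD(3)[OF \<phi>] scaleC_fun_def)
    show "controlled_supports V p q (c *\<^sub>C \<phi>)"
      unfolding controlled_supports_iff
    proof (intro allI impI)
      fix R :: real assume R: "R > 0"
      obtain S where S: "S > 0" "\<And>xs ys z. (xs, ys) \<in> diag_nbhd2 R p q \<Longrightarrow> z \<in> set xs \<union> set ys \<Longrightarrow>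
          vsupp V (\<phi> xs ys) \<subseteq> ball z S"
        using controlled_supportsD[OF cochainD(4)[OF \<phi>] R] by blast
      have "vsupp V ((c *\<^sub>C \<phi>) xs ys) \<subseteq> vsupp V (\<phi> xs ys)" if "(xs, ys) \<in> diag_nbhd2 R p q" for xs ys
        using that V.supp_scale[OF cochainD(1)[OF \<phi>], of xs ys c]
        by (cases "c = 0") (auto simp: scaleC_fun_def V.supp_zero diag_nbhd2_def)
      then show "\<exists>S>0. \<forall>xs ys z. (xs, ys) \<in> diag_nbhd2 R p q \<longrightarrow> z \<in> set xs \<union> set ys \<longrightarrow>
          vsupp V ((c *\<^sub>C \<phi>) xs ys) \<subseteq> ball z S"
        using S by (intro exI[of _ S] conjI allI impI) (blast intro: order_trans)+
    qed
    fix R :: real assume R: "R > 0"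
    obtain C where C: "\<And>xs ys. xs \<in> diag_nbhd R p \<Longrightarrow> length ys = Suc q \<Longrightarrow> vnorm V (\<phi> xs ys) \<le> C"
      using cochainD(5)[OF \<phi> R] by blast
    have "vnorm V ((c *\<^sub>C \<phi>) xs ys) \<le> cmod c * C" if "xs \<in> diag_nbhd R p" "length ys = Suc q" for xs ys
      using that mult_left_mono[OF C[OF that], of "cmod c"] V.norm_scale[OF cochainD(1)[OF \<phi>], of xs ys c]
      by (simp add: scaleC_fun_def diag_nbhd_def)
    then show "\<exists>C. \<forall>xs\<in>diag_nbhd R p. \<forall>ys. length ys = Suc q \<longrightarrow> vnorm V ((c *\<^sub>C \<phi>) xs ys) \<le> C" by blast
  qed (use cochainD(1,2)[OF \<phi>] cl in \<open>auto simp: scaleC_fun_def\<close>)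
  have zero: "0 \<in> points (cochains V p q)"
    unfolding points_cochains_iff
    by (auto simp: cl V.act_0 V.norm_zero V.supp_zero equivariant_def controlled_supports_def intro!: exI[of _ "1::real"])
  have len: "length xs = Suc p" if "xs \<in> diag_nbhd R p" for xs :: "'g list" and R
    using that by (simp add: diag_nbhd_def)
  show ?thesis
  proof
    show "csubspace (points (cochains V p q))"
      unfolding csubspace_def using add scale zero by blast
    fix \<phi> i assume \<phi>: "\<phi> \<in> points (cochains V p q)"
    show "0 \<le> snorm (cochains V p q) i \<phi>"
    proof -
      have "0 \<le> vnorm V (\<phi> (replicate (Suc p) 0) (replicate (Suc q) 0))"
        by (intro V.norm_nonneg cochainD(1)[OF \<phi>]) auto
      also have "\<dots> \<le> snorm (cochains V p q) i \<phi>"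
        by (rule snorm_cochains_upper[OF \<phi>]) (auto simp: diag_nbhd_def)
      finally show ?thesis .
    qed
    show "snorm (cochains V p q) i (c *\<^sub>C \<phi>) = cmod c * snorm (cochains V p q) i \<phi>" for c
    proof -
      have le: "snorm (cochains V p q) i (c *\<^sub>C \<phi>) \<le> cmod c * snorm (cochains V p q) i \<phi>"
        if \<phi>: "\<phi> \<in> points (cochains V p q)" for c \<phi>
        by (rule snorm_cochains_least)
           (auto simp: scaleC_fun_def V.norm_scale cochainD(1)[OF \<phi>] len intro!: mult_left_mono snorm_cochains_upper \<phi>)
      have "cmod c * snorm (cochains V p q) i \<phi> \<le> snorm (cochains V p q) i (c *\<^sub>C \<phi>)"
      proof (cases "c = 0")
        case True
        have "0 \<le> vnorm V ((c *\<^sub>C \<phi>) (replicate (Suc p) 0) (replicate (Suc q) 0))"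
          by (intro V.norm_nonneg cochainD(1)[OF scale[OF \<phi>]]) auto
        also have "\<dots> \<le> snorm (cochains V p q) i (c *\<^sub>C \<phi>)"
          by (rule snorm_cochains_upper[OF scale[OF \<phi>]]) (auto simp: diag_nbhd_def)
        finally show ?thesis using True by simp
      next
        case False
        then have "snorm (cochains V p q) i \<phi> \<le> cmod (1 / c) * snorm (cochains V p q) i (c *\<^sub>C \<phi>)"
          using le[OF scale[OF \<phi>, of c], of "1 / c"] by (simp add: scaleC_scaleC scaleC_one)
        then show ?thesis using False by (simp add: norm_divide field_simps)
      qed
      with le[OF \<phi>, of c] show ?thesis by simp
    qed
    show "snorm (cochains V p q) i (\<phi> + \<psi>) \<le> snorm (cochains V p q) i \<phi> + snorm (cochains V p q) i \<psi>"
      if \<psi>: "\<psi> \<in> points (cochains V p q)" for \<psi>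
    proof (rule snorm_cochains_least)
      fix xs ys :: "'g list" assume l: "xs \<in> diag_nbhd (real (Suc i)) p" "length ys = Suc q"
      have "vnorm V ((\<phi> + \<psi>) xs ys) \<le> vnorm V (\<phi> xs ys) + vnorm V (\<psi> xs ys)"
        using V.norm_triangle[OF cochainD(1)[OF \<phi>] cochainD(1)[OF \<psi>]] l len[OF l(1)] by simp
      also have "\<dots> \<le> snorm (cochains V p q) i \<phi> + snorm (cochains V p q) i \<psi>"
        by (intro add_mono snorm_cochains_upper \<phi> \<psi> l)
      finally show "vnorm V ((\<phi> + \<psi>) xs ys) \<le> \<dots>" .
    qed
    show "snorm (cochains V p q) i \<phi> \<le> snorm (cochains V p q) j \<phi>" if "i \<le> j" for j
    proof (rule snorm_cochains_least)
      fix xs ys :: "'g list" assume l: "xs \<in> diag_nbhd (real (Suc i)) p" "length ys = Suc q"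
      have "xs \<in> diag_nbhd (real (Suc j)) p"
        using l(1) diag_nbhd_mono[of "real (Suc i)" "real (Suc j)"] that by auto
      from snorm_cochains_upper[OF \<phi> this l(2)] show "vnorm V (\<phi> xs ys) \<le> snorm (cochains V p q) j \<phi>" .
    qed
  qed
qed

lemma bounded_map_cochainsI:
  fixes V :: "('g::{group_add,metric_space}, 'v::complex_vector) xmodule"
    and W :: "('g, 'w::complex_vector) xmodule"
  assumes "equivariant_module V" "equivariant_module W"
    and "\<And>\<phi>. \<phi> \<in> points (cochains V p q) \<Longrightarrow> T \<phi> \<in> points (cochains W p' q')"
    and "clinear_on (points (cochains V p q)) T"
    and "\<And>\<phi> i xs ys. \<phi> \<in> points (cochains V p q) \<Longrightarrow> xs \<in> diag_nbhd (real (Suc i)) p' \<Longrightarrow> length ys = Suc q' \<Longrightarrow>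
      vnorm W (T \<phi> xs ys) \<le> C * snorm (cochains V p q) i \<phi>"
  shows "bounded_map (cochains V p q) (cochains W p' q') T"
proof (intro bounded_map.intro bounded_map_axioms.intro cochains_seminormed_space assms(1,2))
  fix j show "\<exists>i C. \<forall>u\<in>points (cochains V p q). snorm (cochains W p' q') j (T u) \<le> C * snorm (cochains V p q) i u"
    by (intro exI[of _ j] exI[of _ C] ballI snorm_cochains_least assms)
qed (use assms in auto)

text \<open>Both differentials are combinations of maps of the following form.\<close>

definition reindex :: "nat \<Rightarrow> nat \<Rightarrow> ('g list \<Rightarrow> 'g list) \<Rightarrow> ('g list \<Rightarrow> 'g list) \<Rightarrow>
    ('g, 'v::complex_vector) cochain \<Rightarrow> ('g, 'v) cochain" where
  "reindex p q a b \<phi> = (\<lambda>xs ys. if length xs = Suc p \<and> length ys = Suc q then \<phi> (a xs) (b ys) else 0)"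

text \<open>All points of a tuple in the \<open>R\<close>-neighbourhood of the diagonal are within \<open>R\<close> of those that remain after
  reindexing, so that the radius of control grows from \<open>S\<close> to \<open>S + R\<close>.\<close>

lemma reindex_bounded:
  fixes V :: "('g::{group_add,metric_space}, 'v::complex_vector) xmodule"
  assumes V: "equivariant_module V"
    and a: "\<And>xs. length xs = Suc p' \<Longrightarrow> length (a xs) = Suc p \<and> set (a xs) \<subseteq> set xs"
      "\<And>f xs. a (map f xs) = map f (a xs)"
    and b: "\<And>ys. length ys = Suc q' \<Longrightarrow> length (b ys) = Suc q \<and> set (b ys) \<subseteq> set ys"
      "\<And>f ys. b (map f ys) = map f (b ys)"
  shows "bounded_map (cochains V p q) (cochains V p' q') (reindex p' q' a b)"
proof (rule bounded_map_cochainsI[OF V V])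
  interpret V: equivariant_module V by fact
  have diag: "a xs \<in> diag_nbhd R p" if "xs \<in> diag_nbhd R p'" for xs R
    using that a(1)[of xs] by (auto simp: diag_nbhd_def subset_eq)
  fix \<phi> assume \<phi>: "\<phi> \<in> points (cochains V p q)"
  show "reindex p' q' a b \<phi> \<in> points (cochains V p' q')"
    unfolding points_cochains_iff
  proof (intro conjI allI impI)
    show "controlled_supports V p' q' (reindex p' q' a b \<phi>)"
      unfolding controlled_supports_iff
    proof (intro allI impI)
      fix R :: real assume R: "R > 0"
      obtain S where S: "S > 0" "\<And>xs ys z. (xs, ys) \<in> diag_nbhd2 R p q \<Longrightarrow> z \<in> set xs \<union> set ys \<Longrightarrow>
          vsupp V (\<phi> xs ys) \<subseteq> ball z S"
        using controlled_supportsD[OF cochainD(4)[OF \<phi>] R] by blast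
      have "vsupp V (reindex p' q' a b \<phi> xs ys) \<subseteq> ball z (S + R)"
        if d: "(xs, ys) \<in> diag_nbhd2 R p' q'" and z: "z \<in> set xs \<union> set ys" for xs ys z
      proof -
        have l: "length xs = Suc p'" "length ys = Suc q'" using d by (auto simp: diag_nbhd2_def)
        have d': "(a xs, b ys) \<in> diag_nbhd2 R p q"
          using d a(1)[OF l(1)] b(1)[OF l(2)] unfolding diag_nbhd2_def by blast
        have h: "hd (a xs) \<in> set (a xs)" using a(1)[OF l(1)] by (intro hd_in_set) auto
        have "vsupp V (\<phi> (a xs) (b ys)) \<subseteq> ball (hd (a xs)) S" using S(2)[OF d'] h by blast
        moreover have "dist z (hd (a xs)) \<le> R" using d z h a(1)[OF l(1)] unfolding diag_nbhd2_def by blast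
        then have "ball (hd (a xs)) S \<subseteq> ball z (S + R)"
          using dist_triangle[of z _ "hd (a xs)"] by (intro subsetI) (smt (verit) mem_ball)
        ultimately show ?thesis
          unfolding reindex_def using l by simp
      qed
      then show "\<exists>S>0. \<forall>xs ys z. (xs, ys) \<in> diag_nbhd2 R p' q' \<longrightarrow> z \<in> set xs \<union> set ys \<longrightarrow>
          vsupp V (reindex p' q' a b \<phi> xs ys) \<subseteq> ball z S"
        using S(1) R by (intro exI[of _ "S + R"] conjI allI impI) auto
    qed
    fix R :: real assume R: "R > 0"
    obtain C where C: "\<And>xs ys. xs \<in> diag_nbhd R p \<Longrightarrow> length ys = Suc q \<Longrightarrow> vnorm V (\<phi> xs ys) \<le> C"
      using cochainD(5)[OF \<phi> R] by blast
    then show "\<exists>C. \<forall>xs\<in>diag_nbhd R p'. \<forall>ys. length ys = Suc q' \<longrightarrow> vnorm V (reindex p' q' a b \<phi> xs ys) \<le> C"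
      using diag b(1) by (intro exI[of _ C]) (auto simp: reindex_def diag_nbhd_def)
  qed (use cochainD(1,3)[OF \<phi>] a b in \<open>auto simp: reindex_def equivariant_def\<close>)
  show "vnorm V (reindex p' q' a b \<phi> xs ys) \<le> 1 * snorm (cochains V p q) i \<phi>"
    if "xs \<in> diag_nbhd (real (Suc i)) p'" "length ys = Suc q'" for i xs ys
    using snorm_cochains_upper[OF \<phi> diag[OF that(1)], of "b ys"] that b(1)
    by (simp add: reindex_def diag_nbhd_def)
qed (auto simp: clinear_on_def reindex_def fun_eq_iff scaleC_fun_def)

lemma length_omit: "i < length xs \<Longrightarrow> length (omit i xs) = length xs - 1"
  and set_omit: "set (omit i xs) \<subseteq> set xs"
  and map_omit: "omit i (map f xs) = map f (omit i xs)"
  by (auto simp: omit_def take_map drop_map dest: in_set_takeD in_set_dropD)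

lemma diffD_bounded:
  fixes V :: "('g::{group_add,metric_space}, 'v::complex_vector) xmodule"
  assumes V: "equivariant_module V"
  shows "bounded_map (cochains V p q) (cochains V (Suc p) q) diffD"
proof (rule bounded_map.cong)
  note E = cochains_seminormed_space[OF V]
  show "bounded_map (cochains V p q) (cochains V (Suc p) q)
      (\<lambda>\<phi>. \<Sum>i<Suc (Suc p). (-1) ^ i *\<^sub>C reindex (Suc p) q (omit i) (\<lambda>ys. ys) \<phi>)"
    by (intro bounded_map_sum bounded_map.scaled E reindex_bounded V)
       (auto simp: length_omit map_omit dest: set_omit[THEN subsetD])
  fix \<phi> assume \<phi>: "\<phi> \<in> points (cochains V p q)"
  show "diffD \<phi> = (\<Sum>i<Suc (Suc p). (-1) ^ i *\<^sub>C reindex (Suc p) q (omit i) (\<lambda>ys. ys) \<phi>)"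
  proof (intro ext)
    fix xs ys :: "'g list"
    have "\<phi> (omit i xs) ys = 0" if "length xs \<noteq> Suc (Suc p) \<or> length ys \<noteq> Suc q" "i < length xs" for i
      using that by (intro cochainD(2)[OF \<phi>]) (auto simp: length_omit)
    then show "diffD \<phi> xs ys = (\<Sum>i<Suc (Suc p). (-1) ^ i *\<^sub>C reindex (Suc p) q (omit i) (\<lambda>ys. ys) \<phi>) xs ys"
      by (cases "length xs = Suc (Suc p) \<and> length ys = Suc q")
         (auto simp: diffD_def sum_fun_apply reindex_def scaleC_fun_def)
  qed
qed

lemma diffd_bounded:
  fixes V :: "('g::{group_add,metric_space}, 'v::complex_vector) xmodule"
  assumes V: "equivariant_module V"
  shows "bounded_map (cochains V p q) (cochains V p (Suc q)) (diffd p)"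
proof (rule bounded_map.cong)
  note E = cochains_seminormed_space[OF V]
  show "bounded_map (cochains V p q) (cochains V p (Suc q))
      (\<lambda>\<phi>. \<Sum>i<Suc (Suc q). (-1) ^ (i + p) *\<^sub>C reindex p (Suc q) (\<lambda>xs. xs) (omit i) \<phi>)"
    by (intro bounded_map_sum bounded_map.scaled E reindex_bounded V)
       (auto simp: length_omit map_omit dest: set_omit[THEN subsetD])
  fix \<phi> assume \<phi>: "\<phi> \<in> points (cochains V p q)"
  show "diffd p \<phi> = (\<Sum>i<Suc (Suc q). (-1) ^ (i + p) *\<^sub>C reindex p (Suc q) (\<lambda>xs. xs) (omit i) \<phi>)"
  proof (intro ext)
    fix xs ys :: "'g list"
    have "\<phi> xs (omit i ys) = 0" if "length xs \<noteq> Suc p \<or> length ys \<noteq> Suc (Suc q)" "i < length ys" for i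
      using that by (intro cochainD(2)[OF \<phi>]) (auto simp: length_omit)
    then show "diffd p \<phi> xs ys = (\<Sum>i<Suc (Suc q). (-1) ^ (i + p) *\<^sub>C reindex p (Suc q) (\<lambda>xs. xs) (omit i) \<phi>) xs ys"
      by (cases "length xs = Suc p \<and> length ys = Suc (Suc q)")
         (auto simp: diffd_def sum_fun_apply reindex_def scaleC_fun_def)
  qed
qed

section \<open>The splitting of the coefficient sequence\<close>

lemma cochains_ell1_0:
  shows points_ell1_0_iff: "\<phi> \<in> points (cochains ell1_0 p q) \<longleftrightarrow>
      \<phi> \<in> points (cochains ell1 p q) \<and> (\<forall>xs ys. ell1_sum (\<phi> xs ys) = 0)"
    and snorm_ell1_0: "snorm (cochains ell1_0 p q) = snorm (cochains ell1 p q)"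
proof -
  have 0: "ell1_sum (0::'a \<Rightarrow> complex) = 0" by (simp add: ell1_sum_def)
  show "\<phi> \<in> points (cochains ell1_0 p q) \<longleftrightarrow>
      \<phi> \<in> points (cochains ell1 p q) \<and> (\<forall>xs ys. ell1_sum (\<phi> xs ys) = 0)"
  proof
    assume L: "\<phi> \<in> points (cochains ell1_0 p q)"
    have "ell1_sum (\<phi> xs ys) = 0" for xs ys
      using cochainD(1)[OF L, of xs ys] cochainD(2)[OF L, of xs ys] 0 by fastforce
    then show "\<phi> \<in> points (cochains ell1 p q) \<and> (\<forall>xs ys. ell1_sum (\<phi> xs ys) = 0)"
      using L unfolding points_cochains_iff equivariant_def controlled_supports_def
      by (simp del: ell1_sel)
  next
    assume "\<phi> \<in> points (cochains ell1 p q) \<and> (\<forall>xs ys. ell1_sum (\<phi> xs ys) = 0)"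
    then show "\<phi> \<in> points (cochains ell1_0 p q)"
      unfolding points_cochains_iff equivariant_def controlled_supports_def
      by (simp del: ell1_sel)
  qed
  show "snorm (cochains ell1_0 p q) = snorm (cochains ell1 p q)"
    by (simp add: cochains_def cochain_norms_def del: ell1_sel)
qed

lemma push_incl: "push ell1_incl = (\<lambda>\<phi>. \<phi>)"
  by (simp add: push_def ell1_incl_def fun_eq_iff)

lemma incl_bounded:
  "bounded_map (cochains (ell1_0 :: ('g::{group_add,metric_space}, 'g \<Rightarrow> complex) xmodule) p q) (cochains ell1 p q) (\<lambda>\<phi>. \<phi>)"
  by (rule bounded_map_cochainsI[OF ell1_0_module ell1_module, where C = 1])
     (auto simp: points_ell1_0_iff snorm_ell1_0 clinear_on_def simp del: ell1_sel intro: snorm_cochains_upper)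

lemma push_sum_bounded:
  "bounded_map (cochains (ell1 :: ('g::{group_add,metric_space}, 'g \<Rightarrow> complex) xmodule) p q)
     (cochains trivial_module p q) (push ell1_sum)"
proof (rule bounded_map_cochainsI[OF ell1_module trivial_module_module])
  note [simp del] = ell1_sel
  have 0: "ell1_sum (0::'g \<Rightarrow> complex) = 0" by (simp add: ell1_sum_def)
  fix \<phi> :: "('g, 'g \<Rightarrow> complex) cochain"
  assume \<phi>: "\<phi> \<in> points (cochains ell1 p q)"
  show "push ell1_sum \<phi> \<in> points (cochains trivial_module p q)"
    unfolding points_cochains_iff
  proof (intro conjI allI impI)
    show "equivariant trivial_module p q (push ell1_sum \<phi>)"
      by (simp add: equivariant_def push_def cochainD(3)[OF \<phi>, symmetric] ell1_sum_translate)
    fix R :: real assume R: "R > 0"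
    obtain C where C: "\<And>xs ys. xs \<in> diag_nbhd R p \<Longrightarrow> length ys = Suc q \<Longrightarrow> vnorm ell1 (\<phi> xs ys) \<le> C"
      using cochainD(5)[OF \<phi> R] by blast
    have "cmod (ell1_sum (\<phi> xs ys)) \<le> C" if "xs \<in> diag_nbhd R p" "length ys = Suc q" for xs ys
      using order_trans[OF ell1_sum_bound[OF cochainD(1)[OF \<phi>]] C[OF that]] that by (simp add: diag_nbhd_def)
    then show "\<exists>C. \<forall>xs\<in>diag_nbhd R p. \<forall>ys. length ys = Suc q \<longrightarrow> vnorm trivial_module (push ell1_sum \<phi> xs ys) \<le> C"
      by (auto simp: push_def)
  qed (auto simp: push_def cochainD(2)[OF \<phi>] 0 controlled_supports_def intro: exI[of _ "1::real"])
  show "vnorm trivial_module (push ell1_sum \<phi> xs ys) \<le> 1 * snorm (cochains ell1 p q) i \<phi>"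
    if "xs \<in> diag_nbhd (real (Suc i)) p" "length ys = Suc q" for i xs ys
    using order_trans[OF ell1_sum_bound[OF cochainD(1)[OF \<phi>]] snorm_cochains_upper[OF \<phi> that]] that
    by (simp add: diag_nbhd_def push_def)
next
  show "clinear_on (points (cochains (ell1 :: ('g, 'g \<Rightarrow> complex) xmodule) p q)) (push ell1_sum)"
    unfolding clinear_on_def
  proof (intro conjI ballI allI)
    fix \<phi> \<psi> :: "('g, 'g \<Rightarrow> complex) cochain"
    assume \<phi>: "\<phi> \<in> points (cochains ell1 p q)" and \<psi>: "\<psi> \<in> points (cochains ell1 p q)"
    have "\<phi> xs ys \<in> vcarrier ell1" "\<psi> xs ys \<in> vcarrier ell1" for xs ys
      using cochainD(1,2)[OF \<phi>, of xs ys] cochainD(1,2)[OF \<psi>, of xs ys]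
        csubspaceD(1)[OF equivariant_module.subspace[OF ell1_module]] by metis+
    then show "push ell1_sum (\<phi> + \<psi>) = push ell1_sum \<phi> + push ell1_sum \<psi>"
      unfolding push_def by (intro ext) (simp only: plus_fun_apply ell1_sum_add)
  next
    fix c and \<phi> :: "('g, 'g \<Rightarrow> complex) cochain"
    have "(c *\<^sub>C \<phi>) xs ys = c *\<^sub>C \<phi> xs ys" for xs ys by (simp add: scaleC_fun_def)
    moreover have "(c *\<^sub>C push ell1_sum \<phi>) xs ys = c * ell1_sum (\<phi> xs ys)" for xs ys
      by (simp add: scaleC_fun_def scaleC_complex_def push_def)
    ultimately show "push ell1_sum (c *\<^sub>C \<phi>) = c *\<^sub>C push ell1_sum \<phi>"
      by (intro ext) (simp only: push_def ell1_sum_scale)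
  qed
qed

text \<open>Multiplying the point mass at the first coordinate by a scalar cochain splits \<open>\<ell>\<^sup>1(G) \<rightarrow> \<complex>\<close>
  on cochains. The splitting is equivariant, but does not commute with the differentials.\<close>

definition sect :: "('g, complex) cochain \<Rightarrow> ('g, 'g \<Rightarrow> complex) cochain" where
  "sect \<psi> = (\<lambda>xs ys x. if x = hd xs then \<psi> xs ys else 0)"

lemma point_mass:
  "(\<lambda>x. if x = a then c else 0) \<in> vcarrier ell1"
  "vnorm ell1 (\<lambda>x. if x = a then c else 0) = cmod c"
  "ell1_sum (\<lambda>x. if x = a then c else 0) = c"
proof -
  have "(\<Sum>\<^sub>\<infinity>x. if x = a then c else 0) = (\<Sum>\<^sub>\<infinity>x\<in>{a}. c)"
    by (rule infsum_cong_neutral) auto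
  then show "ell1_sum (\<lambda>x. if x = a then c else 0) = c" by (simp add: ell1_sum_def)
  have "(\<Sum>\<^sub>\<infinity>x. cmod (if x = a then c else 0)) = (\<Sum>\<^sub>\<infinity>x\<in>{a}. cmod c)"
    by (rule infsum_cong_neutral) auto
  then show "vnorm ell1 (\<lambda>x. if x = a then c else 0) = cmod c" by simp
  show "(\<lambda>x. if x = a then c else 0) \<in> vcarrier ell1"
    by (auto intro!: finite_nonzero_values_imp_summable_on)
qed

lemma sect_bounded:
  "bounded_map (cochains (trivial_module :: ('g::{group_add,metric_space}, complex) xmodule) p q) (cochains ell1 p q) sect"
proof (rule bounded_map_cochainsI[OF trivial_module_module ell1_module])
  note [simp del] = ell1_sel
  fix \<psi> :: "('g, complex) cochain"
  assume \<psi>: "\<psi> \<in> points (cochains trivial_module p q)"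
  show "sect \<psi> \<in> points (cochains ell1 p q)"
    unfolding points_cochains_iff
  proof (intro conjI allI impI)
    show "equivariant ell1 p q (sect \<psi>)"
      unfolding equivariant_def
    proof (intro allI impI ext)
      fix g x and xs ys :: "'g list" assume l: "length xs = Suc p" "length ys = Suc q"
      have "xs \<noteq> []" using l by auto
      have "- g + x = hd xs \<longleftrightarrow> x = g + hd xs"
        by (metis add.assoc add.left_neutral add.right_inverse left_minus)
      then show "vact ell1 g (sect \<psi> xs ys) x = sect \<psi> (map ((+) g) xs) (map ((+) g) ys) x"
        using cochainD(3)[OF \<psi> l, of g] \<open>xs \<noteq> []\<close> by (simp add: ell1_sel sect_def hd_map)
    qed
    show "controlled_supports ell1 p q (sect \<psi>)"
      unfolding controlled_supports_iff
    proof (intro allI impI)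
      fix R :: real assume R: "R > 0"
      have "vsupp ell1 (sect \<psi> xs ys) \<subseteq> ball z (R + 1)"
        if "(xs, ys) \<in> diag_nbhd2 R p q" "z \<in> set xs \<union> set ys" for xs ys z
      proof -
        have "hd xs \<in> set xs" using that by (intro hd_in_set) (auto simp: diag_nbhd2_def)
        then have "dist z (hd xs) \<le> R" using that unfolding diag_nbhd2_def by blast
        then show ?thesis by (auto simp: ell1_sel sect_def)
      qed
      then show "\<exists>S>0. \<forall>xs ys z. (xs, ys) \<in> diag_nbhd2 R p q \<longrightarrow> z \<in> set xs \<union> set ys \<longrightarrow>
          vsupp ell1 (sect \<psi> xs ys) \<subseteq> ball z S"
        using R by (intro exI[of _ "R + 1"] conjI allI impI) auto
    qed
    show "\<exists>C. \<forall>xs\<in>diag_nbhd R p. \<forall>ys. length ys = Suc q \<longrightarrow> vnorm ell1 (sect \<psi> xs ys) \<le> C" if "R > 0" for R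
      using cochainD(5)[OF \<psi> that] by (simp add: sect_def point_mass)
  qed (auto simp: sect_def point_mass cochainD(2)[OF \<psi>])
  show "vnorm ell1 (sect \<psi> xs ys) \<le> 1 * snorm (cochains trivial_module p q) i \<psi>"
    if "xs \<in> diag_nbhd (real (Suc i)) p" "length ys = Suc q" for i xs ys
    using snorm_cochains_upper[OF \<psi> that] by (simp add: sect_def point_mass)
qed (auto simp: clinear_on_def sect_def fun_eq_iff scaleC_fun_def)

lemma push_sum_sect: "push ell1_sum (sect \<psi>) = (\<psi> :: ('g::group_add, complex) cochain)"
  by (simp add: push_def sect_def point_mass)

text \<open>The retraction onto the cochains with values in \<open>\<ell>\<^sup>1\<^sub>0(G)\<close> that belongs to the splitting.\<close>

definition retr :: "('g, 'g \<Rightarrow> complex) cochain \<Rightarrow> ('g, 'g \<Rightarrow> complex) cochain" where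
  "retr \<phi> = \<phi> - sect (push ell1_sum \<phi>)"

lemma retr_bounded:
  "bounded_map (cochains (ell1 :: ('g::{group_add,metric_space}, 'g \<Rightarrow> complex) xmodule) p q) (cochains ell1_0 p q) retr"
proof -
  let ?E = "cochains (ell1 :: ('g, 'g \<Rightarrow> complex) xmodule) p q"
  interpret P: bounded_map ?E "cochains trivial_module p q" "push ell1_sum" by (rule push_sum_bounded)
  interpret S: bounded_map "cochains trivial_module p q" ?E sect by (rule sect_bounded)
  interpret R: bounded_map ?E ?E retr
    using bounded_map.plus[OF P.E.bounded_map_id bounded_map.scaled[OF P.comp[OF sect_bounded], of "-1"]]
    unfolding retr_def scaleC_minus_one by simp
  have "ell1_sum (retr \<phi> xs ys) = 0" if \<phi>: "\<phi> \<in> points ?E" for \<phi> xs ys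
  proof -
    have "push ell1_sum (retr \<phi>) = push ell1_sum \<phi> - push ell1_sum (sect (push ell1_sum \<phi>))"
      unfolding retr_def by (intro clinear_on_diff[OF P.E.subspace P.linear] \<phi> S.maps P.maps)
    then have "push ell1_sum (retr \<phi>) = 0" by (simp add: push_sum_sect)
    then show ?thesis by (simp add: push_def fun_eq_iff)
  qed
  then show ?thesis
    using R.maps R.linear R.estimate
    by (intro bounded_map.intro bounded_map_axioms.intro cochains_seminormed_space ell1_module ell1_0_module)
       (simp_all only: snorm_ell1_0 points_ell1_0_iff simp_thms)
qed

lemma push_sum_ell1_0: "\<phi> \<in> points (cochains ell1_0 p q) \<Longrightarrow> push ell1_sum \<phi> = 0"
  by (simp add: points_ell1_0_iff push_def fun_eq_iff)

lemma retr_ell1_0: "\<phi> \<in> points (cochains ell1_0 p q) \<Longrightarrow> retr \<phi> = \<phi>"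
  unfolding retr_def push_sum_ell1_0 by (simp add: sect_def fun_eq_iff)

lemma retr_split: "retr \<phi> + sect (push ell1_sum \<phi>) = \<phi>"
  by (simp add: retr_def)

section \<open>The Johnson cocycle\<close>

text \<open>The standard lift of the constant cochain 1 is \<open>(x, y) \<mapsto> \<delta>\<^sub>x\<close>; its boundary is
  $((x_0, x_1), y) \mapsto \delta_{x_1} - \delta_{x_0}$.\<close>

definition dirac :: "('g, 'g \<Rightarrow> complex) cochain" where
  "dirac = sect const_one"

definition johnson :: "('g, 'g \<Rightarrow> complex) cochain" where
  "johnson = diffD dirac"

lemma dirac_cochain: "dirac \<in> points (cochains (ell1 :: ('g::{group_add,metric_space}, 'g \<Rightarrow> complex) xmodule) 0 0)"
  unfolding dirac_def by (rule bounded_map.maps[OF sect_bounded const_one_cochain])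

lemma dirac_indep: "dirac xs [y] = dirac xs [y']"
  by (auto simp: dirac_def sect_def const_one_def fun_eq_iff)

lemma push_sum_dirac: "push ell1_sum (dirac :: ('g::group_add, 'g \<Rightarrow> complex) cochain) = const_one"
  by (simp add: dirac_def push_sum_sect)

lemma diffd_const:
  assumes "\<phi> \<in> points (cochains V p 0)" "\<And>xs y y'. \<phi> xs [y] = \<phi> xs [y']"
  shows "diffd p \<phi> = 0"
proof (intro ext)
  fix xs ys
  show "diffd p \<phi> xs ys = 0 xs ys"
  proof (cases "length ys = Suc (Suc 0)")
    case True
    then obtain y0 y1 where "ys = [y0, y1]" by (auto simp: length_Suc_conv)
    then show ?thesis
      using assms(2)[of xs y0 y1] by (simp add: diffd_def omit_def lessThan_Suc flip: scaleC_add_left)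
  next
    case False
    then have "\<phi> xs (omit i ys) = 0" if "i < length ys" for i
      using that by (intro cochainD(2)[OF assms(1)]) (auto simp: length_omit)
    then show ?thesis by (simp add: diffd_def)
  qed
qed

lemma diffd_dirac: "diffd 0 (dirac :: ('g::{group_add,metric_space}, 'g \<Rightarrow> complex) cochain) = 0"
  by (rule diffd_const[OF dirac_cochain dirac_indep])

lemma johnson_ell1: "johnson \<in> points (cochains (ell1 :: ('g::{group_add,metric_space}, 'g \<Rightarrow> complex) xmodule) (Suc 0) 0)"
  unfolding johnson_def by (rule bounded_map.maps[OF diffD_bounded[OF ell1_module] dirac_cochain])

lemma johnson_apply: "johnson [x0, x1] [y] = dirac [x1] [y] - dirac [x0] [y]"
  by (simp add: johnson_def diffD_def omit_def lessThan_Suc scaleC_minus_one scaleC_one)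

lemma johnson_cochain: "johnson \<in> points (cochains (ell1_0 :: ('g::{group_add,metric_space}, 'g \<Rightarrow> complex) xmodule) (Suc 0) 0)"
  unfolding points_ell1_0_iff
proof (intro conjI allI johnson_ell1)
  fix xs ys :: "'g list"
  note E = cochains_seminormed_space[OF ell1_module, of "0::nat" "0::nat"]
  show "ell1_sum (johnson xs ys) = 0"
  proof (cases "length xs = Suc (Suc 0) \<and> length ys = Suc 0")
    case True
    then obtain x0 x1 y where *: "xs = [x0, x1]" "ys = [y]" by (auto simp: length_Suc_conv)
    have d: "dirac [x] [y] = (\<lambda>z. if z = x then 1 else 0)" for x y :: 'g
      by (simp add: dirac_def sect_def const_one_def)
    note V = equivariant_module.subspace[OF ell1_module]
    have "dirac [x0] [y] \<in> vcarrier ell1" "dirac [x1] [y] \<in> vcarrier ell1" unfolding d by (rule point_mass)+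
    then have "ell1_sum (dirac [x1] [y] + (-1) *\<^sub>C dirac [x0] [y]) = ell1_sum (dirac [x1] [y]) + (-1) * ell1_sum (dirac [x0] [y])"
      by (simp only: ell1_sum_add csubspaceD(3)[OF V] ell1_sum_scale)
    then show ?thesis unfolding * johnson_apply by (simp add: scaleC_minus_one d point_mass)
  next
    case False
    then have "johnson xs ys = 0" by (intro cochainD(2)[OF johnson_ell1]) auto
    then show ?thesis by (simp add: ell1_sum_def)
  qed
qed

lemma diffD_johnson: "diffD (johnson :: ('g::{group_add,metric_space}, 'g \<Rightarrow> complex) cochain) = 0"
proof (intro ext)
  fix xs ys :: "'g list" and x
  show "diffD johnson xs ys x = 0 xs ys x"
  proof (cases "length xs = Suc (Suc (Suc 0)) \<and> length ys = Suc 0")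
    case True
    then obtain x0 x1 x2 y where "xs = [x0, x1, x2]" "ys = [y]" by (auto simp: length_Suc_conv)
    then have "diffD johnson xs ys = johnson [x1, x2] [y] - johnson [x0, x2] [y] + johnson [x0, x1] [y]"
      by (simp add: diffD_def omit_def lessThan_Suc scaleC_minus_one scaleC_one)
    then show ?thesis by (simp add: johnson_apply)
  next
    case False
    then have "johnson (omit i xs) ys = 0" if "i < length xs" for i
      using that by (intro cochainD(2)[OF johnson_ell1]) (auto simp: length_omit)
    then show ?thesis by (simp add: diffD_def)
  qed
qed

lemma diffd_johnson: "diffd (Suc 0) (johnson :: ('g::{group_add,metric_space}, 'g \<Rightarrow> complex) cochain) = 0"
proof (rule diffd_const[OF johnson_ell1])
  fix xs :: "'g list" and y y'
  show "johnson xs [y] = johnson xs [y']"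
    by (simp only: johnson_def diffD_def dirac_indep[of _ y y'])
qed

section \<open>The connecting map for the completed bicomplexes\<close>

lemmas modules = ell1_module ell1_0_module trivial_module_module

lemmas cochain_spaces = modules[THEN cochains_seminormed_space]

lemma Q_bicomplex_sel [simp]:
  "bgrp (Q_bicomplex V) p q = Q_completion (cochains V p q)"
  "bD (Q_bicomplex V) p q = Q_map (cochains V (Suc p) q) diffD"
  "bd (Q_bicomplex V) p q = Q_map (cochains V p (Suc q)) (diffd p)"
  by (simp_all add: Q_bicomplex_def)

lemma W_bicomplex_sel [simp]:
  "bgrp (W_bicomplex V) p q = W_completion (cochains V p q)"
  "bD (W_bicomplex V) p q = W_map (cochains V p q) (cochains V (Suc p) q) diffD"
  "bd (W_bicomplex V) p q = W_map (cochains V p q) (cochains V p (Suc q)) (diffd p)"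
  by (simp_all add: W_bicomplex_def)

lemma W_completion_sel [simp]:
  "carrier (W_completion E) = bidual E" "\<one>\<^bsub>W_completion E\<^esub> = 0" "x \<otimes>\<^bsub>W_completion E\<^esub> y = x + y"
  by (simp_all add: W_completion_def)

lemma Q_group_bicomplex:
  fixes V :: "('g::{group_add,metric_space}, 'v::complex_vector) xmodule"
  assumes V: "equivariant_module V"
  shows "group_bicomplex (Q_bicomplex V)"
proof -
  note E = cochains_seminormed_space[OF V]
  show ?thesis
    by (rule group_bicomplex.intro)
       (simp_all only: Q_bicomplex_sel seminormed_space.Q_completion_group[OF E]
        bounded_map.Q_map_hom[OF diffD_bounded[OF V]] bounded_map.Q_map_hom[OF diffd_bounded[OF V]])
qed

lemma W_group_bicomplex:
  fixes V :: "('g::{group_add,metric_space}, 'v::complex_vector) xmodule"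
  assumes V: "equivariant_module V"
  shows "group_bicomplex (W_bicomplex V)"
proof -
  note E = cochains_seminormed_space[OF V]
  show ?thesis
    by (rule group_bicomplex.intro)
       (simp_all only: W_bicomplex_sel seminormed_space.W_completion_group[OF E]
        bounded_map.W_map_hom[OF diffD_bounded[OF V]] bounded_map.W_map_hom[OF diffd_bounded[OF V]])
qed

text \<open>Exactness after completion comes from the splitting: \<open>sect\<close> and \<open>retr\<close> are bounded and thus extend to
  the completions, where they satisfy the same identities.\<close>

lemma Q_connecting_lift:
  "connecting_lift (Q_bicomplex (ell1_0 :: ('g::{group_add,metric_space}, 'g \<Rightarrow> complex) xmodule))
     (Q_bicomplex ell1) (Q_bicomplex trivial_module)
     (Q_bimap ell1 ell1_incl) (Q_bimap trivial_module ell1_sum)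
     (Q_incl (cochains trivial_module 0 0) const_one) (Q_incl (cochains ell1 0 0) dirac)
     (Q_incl (cochains ell1_0 (Suc 0) 0) johnson)"
proof -
  let ?A = "cochains (ell1_0 :: ('g, 'g \<Rightarrow> complex) xmodule)"
  let ?B = "cochains (ell1 :: ('g, 'g \<Rightarrow> complex) xmodule)"
  let ?C = "cochains (trivial_module :: ('g, complex) xmodule)"
  interpret A: seminormed_space "?A p q" for p q by (rule cochain_spaces)
  interpret B: seminormed_space "?B p q" for p q by (rule cochain_spaces)
  interpret C: seminormed_space "?C p q" for p q by (rule cochain_spaces)
  interpret i: bounded_map "?A p q" "?B p q" "\<lambda>\<phi>. \<phi>" for p q by (rule incl_bounded)
  interpret r: bounded_map "?B p q" "?C p q" "push ell1_sum" for p q by (rule push_sum_bounded)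
  interpret s: bounded_map "?C p q" "?B p q" sect for p q by (rule sect_bounded)
  interpret t: bounded_map "?B p q" "?A p q" retr for p q by (rule retr_bounded)
  interpret DA: bounded_map "?A p q" "?A (Suc p) q" diffD for p q by (rule diffD_bounded[OF ell1_0_module])
  interpret dA: bounded_map "?A p q" "?A p (Suc q)" "diffd p" for p q by (rule diffd_bounded[OF ell1_0_module])
  interpret DB: bounded_map "?B p q" "?B (Suc p) q" diffD for p q by (rule diffD_bounded[OF ell1_module])
  interpret dB: bounded_map "?B p q" "?B p (Suc q)" "diffd p" for p q by (rule diffd_bounded[OF ell1_module])
  note car = A.carrier_Q_completion B.carrier_Q_completion C.carrier_Q_completion
  show ?thesis
  proof (intro connecting_lift.intro connecting_lift_axioms.intro Q_group_bicomplex modules,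
      unfold Q_bicomplex_sel Q_bimap_def push_incl)
    fix p q
    show "Q_map (?B p q) (\<lambda>\<phi>. \<phi>) \<in> hom (Q_completion (?A p q)) (Q_completion (?B p q))"
      by (rule i.Q_map_hom)
    show "inj_on (Q_map (?B p q) (\<lambda>\<phi>. \<phi>)) (carrier (Q_completion (?A p q)))"
    proof (rule inj_on_inverseI)
      fix x assume "x \<in> carrier (Q_completion (?A p q))"
      then obtain u where u: "u \<in> bounded_seqs (?A p q)" "x = Q_class (?A p q) u" unfolding car by blast
      show "Q_map (?A p q) retr (Q_map (?B p q) (\<lambda>\<phi>. \<phi>) x) = x"
        unfolding u(2) i.Q_map_class[OF u(1)] t.Q_map_class[OF i.bounded_seqs[OF u(1)]]
          retr_ell1_0[OF A.bounded_seqs_points[OF u(1)]] ..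
    qed
  next
    show "Q_map (?C 0 0) (push ell1_sum) \<in> hom (Q_completion (?B 0 0)) (Q_completion (?C 0 0))"
      by (rule r.Q_map_hom)
  next
    fix x assume "x \<in> carrier (Q_completion (?B 0 0))"
      and one: "Q_map (?C 0 0) (push ell1_sum) x = \<one>\<^bsub>Q_completion (?C 0 0)\<^esub>"
    then obtain u where u: "u \<in> bounded_seqs (?B 0 0)" "x = Q_class (?B 0 0) u" unfolding car by blast
    have null: "(\<lambda>n. push ell1_sum (u n)) \<in> null_seqs (?C 0 0)"
      using one unfolding u(2) r.Q_map_class[OF u(1)] C.Q_class_eq_one_iff .
    have "u - (\<lambda>n. retr (u n)) = (\<lambda>n. sect (push ell1_sum (u n)))"
      by (simp add: fun_eq_iff retr_def)
    then have "Q_class (?B 0 0) u = Q_class (?B 0 0) (\<lambda>n. retr (u n))"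
      unfolding B.Q_class_eq_iff using s.null_seqs[OF null] by simp
    then have "Q_map (?B 0 0) (\<lambda>\<phi>. \<phi>) (Q_class (?A 0 0) (\<lambda>n. retr (u n))) = x"
      unfolding i.Q_map_class[OF t.bounded_seqs[OF u(1)]] u(2) by (rule sym)
    then show "\<exists>c\<in>carrier (Q_completion (?A 0 0)). Q_map (?B 0 0) (\<lambda>\<phi>. \<phi>) c = x"
      using t.bounded_seqs[OF u(1)] unfolding car by blast
  next
    fix c assume "c \<in> carrier (Q_completion (?A 0 0))"
    then obtain u where u: "u \<in> bounded_seqs (?A 0 0)" "c = Q_class (?A 0 0) u" unfolding car by blast
    note iu = i.Q_map_class[OF u(1)] and u' = i.bounded_seqs[OF u(1)]
    show "Q_map (?C 0 0) (push ell1_sum) (Q_map (?B 0 0) (\<lambda>\<phi>. \<phi>) c) = \<one>\<^bsub>Q_completion (?C 0 0)\<^esub>"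
      unfolding u(2) iu r.Q_map_class[OF u'] C.Q_completion_one
        push_sum_ell1_0[OF A.bounded_seqs_points[OF u(1)]] ..
    show "Q_map (?B (Suc 0) 0) (\<lambda>\<phi>. \<phi>) (Q_map (?A (Suc 0) 0) diffD c) =
        Q_map (?B (Suc 0) 0) diffD (Q_map (?B 0 0) (\<lambda>\<phi>. \<phi>) c)"
      unfolding u(2) iu DA.Q_map_class[OF u(1)] i.Q_map_class[OF DA.bounded_seqs[OF u(1)]] DB.Q_map_class[OF u'] ..
    show "Q_map (?B 0 (Suc 0)) (\<lambda>\<phi>. \<phi>) (Q_map (?A 0 (Suc 0)) (diffd 0) c) =
        Q_map (?B 0 (Suc 0)) (diffd 0) (Q_map (?B 0 0) (\<lambda>\<phi>. \<phi>) c)"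
      unfolding u(2) iu dA.Q_map_class[OF u(1)] i.Q_map_class[OF dA.bounded_seqs[OF u(1)]] dB.Q_map_class[OF u'] ..
  next
    note dirac = B.const_bounded_seq[OF dirac_cochain]
    note johnson = A.const_bounded_seq[OF johnson_cochain]
    show "Q_incl (?C 0 0) const_one \<in> carrier (Q_completion (?C 0 0))"
      unfolding Q_incl_eq car using C.const_bounded_seq[OF const_one_cochain] by blast
    show "Q_incl (?B 0 0) dirac \<in> carrier (Q_completion (?B 0 0))"
      unfolding Q_incl_eq car using dirac by blast
    show "Q_map (?C 0 0) (push ell1_sum) (Q_incl (?B 0 0) dirac) = Q_incl (?C 0 0) const_one"
      unfolding Q_incl_eq r.Q_map_class[OF dirac] push_sum_dirac ..
    show "Q_map (?B 0 (Suc 0)) (diffd 0) (Q_incl (?B 0 0) dirac) = \<one>\<^bsub>Q_completion (?B 0 (Suc 0))\<^esub>"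
      unfolding Q_incl_eq dB.Q_map_class[OF dirac] diffd_dirac B.Q_completion_one ..
    show "Q_incl (?A (Suc 0) 0) johnson \<in> carrier (Q_completion (?A (Suc 0) 0))"
      unfolding Q_incl_eq car using johnson by blast
    show "Q_map (?B (Suc 0) 0) (\<lambda>\<phi>. \<phi>) (Q_incl (?A (Suc 0) 0) johnson) =
        Q_map (?B (Suc 0) 0) diffD (Q_incl (?B 0 0) dirac)"
      unfolding Q_incl_eq i.Q_map_class[OF johnson] DB.Q_map_class[OF dirac] by (simp only: johnson_def)
    show "Q_map (?A (Suc (Suc 0)) 0) diffD (Q_incl (?A (Suc 0) 0) johnson) = \<one>\<^bsub>Q_completion (?A (Suc (Suc 0)) 0)\<^esub>"
      unfolding Q_incl_eq DA.Q_map_class[OF johnson] diffD_johnson A.Q_completion_one ..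
    show "Q_map (?A (Suc 0) (Suc 0)) (diffd (Suc 0)) (Q_incl (?A (Suc 0) 0) johnson) = \<one>\<^bsub>Q_completion (?A (Suc 0) (Suc 0))\<^esub>"
      unfolding Q_incl_eq dA.Q_map_class[OF johnson] diffd_johnson A.Q_completion_one ..
  qed
qed

lemma W_connecting_lift:
  "connecting_lift (W_bicomplex (ell1_0 :: ('g::{group_add,metric_space}, 'g \<Rightarrow> complex) xmodule))
     (W_bicomplex ell1) (W_bicomplex trivial_module)
     (W_bimap ell1_0 ell1 ell1_incl) (W_bimap ell1 trivial_module ell1_sum)
     (W_incl (cochains trivial_module 0 0) const_one) (W_incl (cochains ell1 0 0) dirac)
     (W_incl (cochains ell1_0 (Suc 0) 0) johnson)"
proof -
  let ?A = "cochains (ell1_0 :: ('g, 'g \<Rightarrow> complex) xmodule)"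
  let ?B = "cochains (ell1 :: ('g, 'g \<Rightarrow> complex) xmodule)"
  let ?C = "cochains (trivial_module :: ('g, complex) xmodule)"
  interpret A: seminormed_space "?A p q" for p q by (rule cochain_spaces)
  interpret B: seminormed_space "?B p q" for p q by (rule cochain_spaces)
  interpret C: seminormed_space "?C p q" for p q by (rule cochain_spaces)
  interpret i: bounded_map "?A p q" "?B p q" "\<lambda>\<phi>. \<phi>" for p q by (rule incl_bounded)
  interpret r: bounded_map "?B p q" "?C p q" "push ell1_sum" for p q by (rule push_sum_bounded)
  interpret t: bounded_map "?B p q" "?A p q" retr for p q by (rule retr_bounded)
  interpret DA: bounded_map "?A p q" "?A (Suc p) q" diffD for p q by (rule diffD_bounded[OF ell1_0_module])
  interpret dA: bounded_map "?A p q" "?A p (Suc q)" "diffd p" for p q by (rule diffd_bounded[OF ell1_0_module])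
  interpret DB: bounded_map "?B p q" "?B (Suc p) q" diffD for p q by (rule diffD_bounded[OF ell1_module])
  interpret dB: bounded_map "?B p q" "?B p (Suc q)" "diffd p" for p q by (rule diffd_bounded[OF ell1_module])
  show ?thesis
  proof (intro connecting_lift.intro connecting_lift_axioms.intro W_group_bicomplex modules,
      unfold W_bicomplex_sel W_bimap_def W_completion_sel push_incl)
    fix p q
    show "W_map (?A p q) (?B p q) (\<lambda>\<phi>. \<phi>) \<in> hom (W_completion (?A p q)) (W_completion (?B p q))"
      by (rule i.W_map_hom)
    show "inj_on (W_map (?A p q) (?B p q) (\<lambda>\<phi>. \<phi>)) (bidual (?A p q))"
    proof (rule inj_on_inverseI)
      fix x assume x: "x \<in> bidual (?A p q)"
      have "W_map (?B p q) (?A p q) retr (W_map (?A p q) (?B p q) (\<lambda>\<phi>. \<phi>) x) =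
          W_map (?A p q) (?A p q) retr x"
        by (rule i.W_map_comp[OF retr_bounded])
      also have "\<dots> = W_map (?A p q) (?A p q) (\<lambda>u. u) x"
        by (rule W_map_cong) (rule retr_ell1_0)
      also have "\<dots> = x" by (rule A.W_map_id[OF x])
      finally show "W_map (?B p q) (?A p q) retr (W_map (?A p q) (?B p q) (\<lambda>\<phi>. \<phi>) x) = x" .
    qed
  next
    show "W_map (?B 0 0) (?C 0 0) (push ell1_sum) \<in> hom (W_completion (?B 0 0)) (W_completion (?C 0 0))"
      by (rule r.W_map_hom)
  next
    fix x assume x: "x \<in> bidual (?B 0 0)" and zero: "W_map (?B 0 0) (?C 0 0) (push ell1_sum) x = 0"
    have "x = W_map (?B 0 0) (?B 0 0) (\<lambda>u. u) x" by (rule B.W_map_id[OF x, symmetric])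
    also have "\<dots> = W_map (?B 0 0) (?B 0 0) (\<lambda>u. retr u + sect (push ell1_sum u)) x"
      by (rule W_map_cong) (simp only: retr_split)
    also have "\<dots> = W_map (?B 0 0) (?B 0 0) retr x + W_map (?B 0 0) (?B 0 0) (\<lambda>u. sect (push ell1_sum u)) x"
      by (rule bounded_map.W_map_plus[OF t.comp[OF incl_bounded] r.comp[OF sect_bounded] x])
    also have "W_map (?B 0 0) (?B 0 0) (\<lambda>u. sect (push ell1_sum u)) x =
        W_map (?C 0 0) (?B 0 0) sect (W_map (?B 0 0) (?C 0 0) (push ell1_sum) x)"
      by (rule r.W_map_comp[OF sect_bounded, symmetric])
    also have "\<dots> = 0" unfolding zero by (simp add: W_map_def fun_eq_iff)
    also have "W_map (?B 0 0) (?B 0 0) retr x = W_map (?A 0 0) (?B 0 0) (\<lambda>\<phi>. \<phi>) (W_map (?B 0 0) (?A 0 0) retr x)"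
      by (rule t.W_map_comp[OF incl_bounded, symmetric])
    finally have "W_map (?A 0 0) (?B 0 0) (\<lambda>\<phi>. \<phi>) (W_map (?B 0 0) (?A 0 0) retr x) + 0 = x" by (rule sym)
    then show "\<exists>c\<in>bidual (?A 0 0). W_map (?A 0 0) (?B 0 0) (\<lambda>\<phi>. \<phi>) c = x"
      unfolding add_0_right by (rule bexI[OF _ t.W_map_bidual[OF x]])
  next
    fix c assume c: "c \<in> bidual (?A 0 0)"
    show "W_map (?B 0 0) (?C 0 0) (push ell1_sum) (W_map (?A 0 0) (?B 0 0) (\<lambda>\<phi>. \<phi>) c) = 0"
      unfolding i.W_map_comp[OF push_sum_bounded]
      by (rule A.W_map_zero[OF C.seminormed_space_axioms c push_sum_ell1_0])
    show "W_map (?A (Suc 0) 0) (?B (Suc 0) 0) (\<lambda>\<phi>. \<phi>) (W_map (?A 0 0) (?A (Suc 0) 0) diffD c) =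
        W_map (?B 0 0) (?B (Suc 0) 0) diffD (W_map (?A 0 0) (?B 0 0) (\<lambda>\<phi>. \<phi>) c)"
      unfolding i.W_map_comp[OF DB.bounded_map_axioms] DA.W_map_comp[OF incl_bounded] ..
    show "W_map (?A 0 (Suc 0)) (?B 0 (Suc 0)) (\<lambda>\<phi>. \<phi>) (W_map (?A 0 0) (?A 0 (Suc 0)) (diffd 0) c) =
        W_map (?B 0 0) (?B 0 (Suc 0)) (diffd 0) (W_map (?A 0 0) (?B 0 0) (\<lambda>\<phi>. \<phi>) c)"
      unfolding i.W_map_comp[OF dB.bounded_map_axioms] dA.W_map_comp[OF incl_bounded] ..
  next
    show "W_incl (?C 0 0) const_one \<in> bidual (?C 0 0)" by (rule C.W_incl_bidual[OF const_one_cochain])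
    show "W_incl (?B 0 0) dirac \<in> bidual (?B 0 0)" by (rule B.W_incl_bidual[OF dirac_cochain])
    show "W_map (?B 0 0) (?C 0 0) (push ell1_sum) (W_incl (?B 0 0) dirac) = W_incl (?C 0 0) const_one"
      unfolding r.W_map_incl[OF dirac_cochain] push_sum_dirac ..
    show "W_map (?B 0 0) (?B 0 (Suc 0)) (diffd 0) (W_incl (?B 0 0) dirac) = 0"
      unfolding dB.W_map_incl[OF dirac_cochain] diffd_dirac by (rule B.W_incl_zero)
    show "W_incl (?A (Suc 0) 0) johnson \<in> bidual (?A (Suc 0) 0)" by (rule A.W_incl_bidual[OF johnson_cochain])
    show "W_map (?A (Suc 0) 0) (?B (Suc 0) 0) (\<lambda>\<phi>. \<phi>) (W_incl (?A (Suc 0) 0) johnson) =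
        W_map (?B 0 0) (?B (Suc 0) 0) diffD (W_incl (?B 0 0) dirac)"
      unfolding i.W_map_incl[OF johnson_cochain] DB.W_map_incl[OF dirac_cochain] by (simp only: johnson_def)
    show "W_map (?A (Suc 0) 0) (?A (Suc (Suc 0)) 0) diffD (W_incl (?A (Suc 0) 0) johnson) = 0"
      unfolding DA.W_map_incl[OF johnson_cochain] diffD_johnson by (rule A.W_incl_zero)
    show "W_map (?A (Suc 0) 0) (?A (Suc 0) (Suc 0)) (diffd (Suc 0)) (W_incl (?A (Suc 0) 0) johnson) = 0"
      unfolding dA.W_map_incl[OF johnson_cochain] diffd_johnson by (rule A.W_incl_zero)
  qed
qed

section \<open>From almost invariant functions to cocycles in the quotient completion\<close>

text \<open>The orbit map of \<open>v\<close> as a cochain, constant in the second variable.\<close>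

definition orbit_cochain :: "('g::group_add, 'v::complex_vector) xmodule \<Rightarrow> 'v \<Rightarrow> ('g, 'v) cochain" where
  "orbit_cochain V v = (\<lambda>xs ys. if length xs = Suc 0 \<and> length ys = Suc 0 then vact V (hd xs) v else 0)"

lemma orbit_cochain_points:
  fixes V :: "('g::{group_add,metric_space}, 'v::complex_vector) xmodule"
  assumes V: "equivariant_module V" and left_invariant: "\<And>g x y::'g. dist (g + x) (g + y) = dist x y"
    and v: "v \<in> vcarrier V" and fin: "finite (vsupp V v)"
  shows "orbit_cochain V v \<in> points (cochains V 0 0)"
  unfolding points_cochains_iff
proof (intro conjI allI impI)
  interpret V: equivariant_module V by fact
  show "equivariant V 0 0 (orbit_cochain V v)"
    unfolding equivariant_def
  proof (intro allI impI)
    fix g and xs ys :: "'g list" assume "length xs = Suc 0" "length ys = Suc 0"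
    then show "vact V g (orbit_cochain V v xs ys) = orbit_cochain V v (map ((+) g) xs) (map ((+) g) ys)"
      using V.act_add[OF v, of g "hd xs"] by (cases xs) (simp_all add: orbit_cochain_def)
  qed
  show "controlled_supports V 0 0 (orbit_cochain V v)"
    unfolding controlled_supports_iff
  proof (intro allI impI)
    fix R :: real assume R: "R > 0"
    obtain S where S: "S > 0" "\<And>s. s \<in> vsupp V v \<Longrightarrow> dist 0 s < S"
    proof -
      have "bounded (vsupp V v)" by (rule finite_imp_bounded[OF fin])
      then obtain K where "\<And>s. s \<in> vsupp V v \<Longrightarrow> dist 0 s \<le> K" by (auto simp: bounded_any_center[of _ 0])
      then show ?thesis by (intro that[of "\<bar>K\<bar> + 1"]) force+
    qed
    have "vsupp V (orbit_cochain V v xs ys) \<subseteq> ball z (R + S)"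
      if d: "(xs, ys) \<in> diag_nbhd2 R 0 0" and z: "z \<in> set xs \<union> set ys" for xs ys z
    proof
      fix w assume w: "w \<in> vsupp V (orbit_cochain V v xs ys)"
      have l: "length xs = Suc 0" "length ys = Suc 0" using d by (auto simp: diag_nbhd2_def)
      have "hd xs \<in> set xs" using l by (intro hd_in_set) auto
      then have dz: "dist z (hd xs) \<le> R" using d z unfolding diag_nbhd2_def by blast
      have "vsupp V (orbit_cochain V v xs ys) = (\<lambda>x. hd xs + x) ` vsupp V v"
        using l V.supp_act[OF v] by (simp add: orbit_cochain_def)
      then obtain s where s: "s \<in> vsupp V v" "w = hd xs + s" using w by auto
      have "dist (hd xs) w = dist 0 s" using left_invariant[of "hd xs" 0 s] s by simp
      then show "w \<in> ball z (R + S)" using S(2)[OF s(1)] dz dist_triangle[of z w "hd xs"] by simp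
    qed
    then show "\<exists>S>0. \<forall>xs ys z. (xs, ys) \<in> diag_nbhd2 R 0 0 \<longrightarrow> z \<in> set xs \<union> set ys \<longrightarrow>
        vsupp V (orbit_cochain V v xs ys) \<subseteq> ball z S"
      using S(1) R by (intro exI[of _ "R + S"] conjI allI impI) auto
  qed
  show "\<exists>C. \<forall>xs\<in>diag_nbhd R 0. \<forall>ys. length ys = Suc 0 \<longrightarrow> vnorm V (orbit_cochain V v xs ys) \<le> C" for R
    by (intro exI[of _ "vnorm V v"]) (auto simp: orbit_cochain_def diag_nbhd_def V.act_isometric[OF v])
qed (auto simp: orbit_cochain_def equivariant_module.act_closed[OF V v])

lemma snorm_orbit_cochain_le:
  fixes V :: "('g::{group_add,metric_space}, 'v::complex_vector) xmodule"
  assumes V: "equivariant_module V" and v: "v \<in> vcarrier V"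
  shows "snorm (cochains V 0 0) i (orbit_cochain V v) \<le> vnorm V v"
  by (rule snorm_cochains_least)
     (simp add: orbit_cochain_def diag_nbhd_def equivariant_module.act_isometric[OF V v])

text \<open>As the action is isometric, \<open>x\<^sub>1 v - x\<^sub>0 v\<close> has the norm of \<open>g v - v\<close> for \<open>g = - x\<^sub>0 + x\<^sub>1\<close>, and left
  invariance of the metric gives \<open>dist 0 g = dist x\<^sub>0 x\<^sub>1\<close>.\<close>

lemma snorm_diffD_orbit_cochain_le:
  fixes V :: "('g::{group_add,metric_space}, 'v::complex_vector) xmodule"
  assumes V: "equivariant_module V" and left_invariant: "\<And>g x y::'g. dist (g + x) (g + y) = dist x y"
    and v: "v \<in> vcarrier V" and small: "\<And>g. dist 0 g \<le> real (Suc i) \<Longrightarrow> vnorm V (vact V g v - v) \<le> e"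
  shows "snorm (cochains V (Suc 0) 0) i (diffD (orbit_cochain V v)) \<le> e"
proof (rule snorm_cochains_least)
  interpret V: equivariant_module V by fact
  fix xs ys :: "'g list" assume xs: "xs \<in> diag_nbhd (real (Suc i)) (Suc 0)" and ys: "length ys = Suc 0"
  obtain x0 x1 y where *: "xs = [x0, x1]" "ys = [y]"
    using xs ys by (auto simp: diag_nbhd_def length_Suc_conv)
  define g where "g = - x0 + x1"
  have x1: "x1 = x0 + g" by (simp add: g_def add.assoc[symmetric])
  have "dist 0 g \<le> real (Suc i)"
    using left_invariant[of x0 0 g] xs unfolding * x1 diag_nbhd_def by auto
  note cl = csubspaceD[OF V.subspace]
  have "diffD (orbit_cochain V v) xs ys = vact V x1 v - vact V x0 v"
    by (simp add: * diffD_def orbit_cochain_def omit_def lessThan_Suc scaleC_one scaleC_minus_one)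
  also have "\<dots> = vact V x0 (vact V g v - v)"
    unfolding x1 V.act_add[OF v] by (rule clinear_on_diff[OF V.subspace V.act_linear V.act_closed[OF v] v, symmetric])
  finally have "vnorm V (diffD (orbit_cochain V v) xs ys) = vnorm V (vact V g v - v)"
    using V.act_isometric[OF cl(5)[OF V.act_closed[OF v] v]] by simp
  also have "\<dots> \<le> e" by (rule small) fact
  finally show "vnorm V (diffD (orbit_cochain V v) xs ys) \<le> e" .
qed

lemma finite_cball_if_proper:
  fixes x :: "'a::{discrete_topology,metric_space}"
  assumes "compact (cball x r)"
  shows "finite (cball x r)"
proof -
  obtain D where D: "D \<subseteq> cball x r" "finite D" "cball x r \<subseteq> (\<Union>y\<in>D. {y})"
    using compactE_image[OF assms, of "cball x r" "\<lambda>y. {y}"] by (auto simp: open_discrete)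
  then show ?thesis by (auto intro: finite_subset)
qed

text \<open>The cocycle is the sequence of orbit maps of increasingly invariant probability functions. The
  function \<open>f n\<close> is almost invariant under the ball of radius \<open>n + 1\<close>, that of the \<open>n\<close>-th seminorm, so
  that each seminorm of the boundary is at most \<open>1 / (n + 1)\<close> from some point on.\<close>

lemma amenable_imp_Q_cocycle:
  assumes am: "amenable TYPE('g::{group_add,discrete_topology,metric_space})"
    and left_invariant: "\<And>g x y::'g. dist (g + x) (g + y) = dist x y"
    and proper: "\<And>(x::'g) r. compact (cball x r)"
  shows "\<exists>u\<in>bounded_seqs (cochains (ell1 :: ('g, 'g \<Rightarrow> complex) xmodule) 0 0).
    (\<lambda>n. diffD (u n)) \<in> null_seqs (cochains ell1 (Suc 0) 0) \<and>
    (\<lambda>n. diffd 0 (u n)) \<in> null_seqs (cochains ell1 0 (Suc 0)) \<and>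
    (\<forall>n. push ell1_sum (u n) = const_one)"
proof -
  let ?V = "ell1 :: ('g, 'g \<Rightarrow> complex) xmodule"
  interpret B: seminormed_space "cochains ?V p q" for p q by (rule cochain_spaces)
  have "\<exists>f :: 'g \<Rightarrow> real. finite {x. f x \<noteq> 0} \<and> (\<forall>x. 0 \<le> f x) \<and> (\<Sum>\<^sub>\<infinity>x. f x) = 1 \<and>
      (\<forall>g\<in>cball 0 (real (Suc n)). (\<Sum>\<^sub>\<infinity>x. \<bar>f (- g + x) - f x\<bar>) < 1 / real (Suc n))" for n
    by (rule amenable_imp_almost_invariant[OF am finite_cball_if_proper[OF proper, of 0 "real (Suc n)"], of "1 / real (Suc n)"])
       (simp, blast)
  from choice[OF allI[OF this]] obtain f :: "nat \<Rightarrow> 'g \<Rightarrow> real"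
    where f: "\<forall>n. finite {x. f n x \<noteq> 0} \<and> (\<forall>x. 0 \<le> f n x) \<and> (\<Sum>\<^sub>\<infinity>x. f n x) = 1 \<and>
      (\<forall>g\<in>cball 0 (real (Suc n)). (\<Sum>\<^sub>\<infinity>x. \<bar>f n (- g + x) - f n x\<bar>) < 1 / real (Suc n))" ..
  have fin: "finite {x. f n x \<noteq> 0}" and nonneg: "0 \<le> f n x" and mass: "(\<Sum>\<^sub>\<infinity>x. f n x) = 1" for n x
    using f[THEN spec, of n] by simp_all
  have small: "(\<Sum>\<^sub>\<infinity>x. \<bar>f n (- g + x) - f n x\<bar>) < 1 / real (Suc n)" if "dist 0 g \<le> real (Suc n)" for n g
    using f[THEN spec, of n] that unfolding mem_cball[symmetric] by blast
  define v where "v n = (\<lambda>x. complex_of_real (f n x))" for n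
  have v: "v n \<in> vcarrier ?V" for n
    using fin[of n] by (auto simp: v_def intro!: finite_nonzero_values_imp_summable_on)
  have norm_v: "vnorm ?V (v n) = 1" for n using mass[of n] nonneg[of n] by (simp add: v_def)
  have sum_v: "ell1_sum (v n) = 1" for n
  proof -
    have "f n summable_on UNIV" using fin[of n] by (intro finite_nonzero_values_imp_summable_on) simp
    then have "(f n has_sum 1) UNIV" using mass[of n] by (metis has_sum_infsum)
    then have "(v n has_sum of_real 1) UNIV" unfolding v_def by (rule has_sum_of_real)
    then show ?thesis by (simp add: ell1_sum_def infsumI)
  qed
  have supp_v: "finite (vsupp ?V (v n))" for n using fin[of n] by (simp add: v_def)
  define u where "u n = orbit_cochain ?V (v n)" for n
  have up: "u n \<in> points (cochains ?V 0 0)" for n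
    unfolding u_def by (rule orbit_cochain_points[OF ell1_module left_invariant v supp_v])
  have Dp: "diffD (u n) \<in> points (cochains ?V (Suc 0) 0)" for n
    by (rule bounded_map.maps[OF diffD_bounded[OF ell1_module] up])
  have small_v: "vnorm ?V (vact ?V g (v n) - v n) \<le> 1 / real (Suc n)" if "dist 0 g \<le> real (Suc n)" for g n
  proof -
    have "cmod ((vact ?V g (v n) - v n) x) = \<bar>f n (- g + x) - f n x\<bar>" for x
      by (simp add: v_def norm_of_real flip: of_real_diff)
    then have "vnorm ?V (vact ?V g (v n) - v n) = (\<Sum>\<^sub>\<infinity>x. \<bar>f n (- g + x) - f n x\<bar>)"
      unfolding ell1_sel(2) by (simp only:)
    with small[OF that] show ?thesis by simp
  qed
  have "u \<in> bounded_seqs (cochains ?V 0 0)"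
    using up snorm_orbit_cochain_le[OF ell1_module v] by (auto simp: bounded_seqs_def u_def norm_v simp del: ell1_sel)
  moreover have "(\<lambda>n. diffD (u n)) \<in> null_seqs (cochains ?V (Suc 0) 0)"
  proof -
    have "(\<lambda>n. snorm (cochains ?V (Suc 0) 0) i (diffD (u n))) \<longlonglongrightarrow> 0" for i
    proof (rule tendsto_sandwich[OF _ _ tendsto_const LIMSEQ_inverse_real_of_nat])
      show "\<forall>\<^sub>F n in sequentially. 0 \<le> snorm (cochains ?V (Suc 0) 0) i (diffD (u n))"
        by (intro always_eventually allI B.snorm_nonneg Dp)
      show "\<forall>\<^sub>F n in sequentially. snorm (cochains ?V (Suc 0) 0) i (diffD (u n)) \<le> inverse (real (Suc n))"
        unfolding eventually_sequentially
      proof (intro exI[of _ i] allI impI)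
        fix n assume n: "i \<le> n"
        have "vnorm ?V (vact ?V g (v n) - v n) \<le> inverse (real (Suc n))" if "dist 0 g \<le> real (Suc i)" for g
          using small_v[of g n] that n by (simp add: inverse_eq_divide del: ell1_sel)
        then show "snorm (cochains ?V (Suc 0) 0) i (diffD (u n)) \<le> inverse (real (Suc n))"
          unfolding u_def by (rule snorm_diffD_orbit_cochain_le[OF ell1_module left_invariant v])
      qed
    qed
    then show ?thesis using Dp by (simp add: null_seqs_def)
  qed
  moreover have "(\<lambda>n. diffd 0 (u n)) \<in> null_seqs (cochains ?V 0 (Suc 0))"
  proof -
    have "diffd 0 (u n) = 0" for n
      by (rule diffd_const[OF up]) (simp add: u_def orbit_cochain_def)
    then show ?thesis by (simp add: null_seqs_def B.closed B.snorm_zero)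
  qed
  moreover have "push ell1_sum (u n) = const_one" for n
  proof (intro ext)
    fix xs ys :: "'g list"
    have "ell1_sum (0::'g \<Rightarrow> complex) = 0" by (simp add: ell1_sum_def)
    then show "push ell1_sum (u n) xs ys = const_one xs ys"
      by (simp add: push_def u_def orbit_cochain_def const_one_def ell1_sum_translate sum_v del: ell1_sel)
  qed
  ultimately show ?thesis by blast
qed

section \<open>From cocycles in the weak-* completion to means\<close>

definition pair :: "('g \<Rightarrow> real) \<Rightarrow> ('g \<Rightarrow> complex) \<Rightarrow> complex" where
  "pair f v = (\<Sum>\<^sub>\<infinity>x. complex_of_real (f x) * v x)"

lemma
  assumes f: "\<And>x. \<bar>f x\<bar> \<le> K" and v: "v \<in> vcarrier ell1"
  shows pair_summable: "(\<lambda>x. complex_of_real (f x) * v x) summable_on UNIV"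
    and pair_bound: "cmod (pair f v) \<le> K * vnorm ell1 v"
proof -
  have s: "(\<lambda>x. K * cmod (v x)) summable_on UNIV" using v by (simp add: summable_on_cmult_right)
  have le: "cmod (complex_of_real (f x) * v x) \<le> K * cmod (v x)" for x
    using f[of x] by (simp add: norm_mult mult_right_mono)
  have a: "(\<lambda>x. cmod (complex_of_real (f x) * v x)) summable_on UNIV"
    by (rule summable_on_comparison_test[OF s]) (use le in auto)
  then show "(\<lambda>x. complex_of_real (f x) * v x) summable_on UNIV" by (rule abs_summable_summable)
  have "cmod (pair f v) \<le> (\<Sum>\<^sub>\<infinity>x. cmod (complex_of_real (f x) * v x))"
    unfolding pair_def by (rule norm_infsum_bound[OF a])
  also have "\<dots> \<le> (\<Sum>\<^sub>\<infinity>x. K * cmod (v x))" by (rule infsum_mono[OF a s le])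
  finally show "cmod (pair f v) \<le> K * vnorm ell1 v" by (simp add: infsum_cmult_right')
qed

lemma bounded_rangeE:
  assumes "bounded (range f)"
  obtains K where "K > 0" "\<And>x. \<bar>f x :: real\<bar> \<le> K"
  using assms by (auto simp: bounded_pos)

lemma pair_add_right:
  assumes "bounded (range f)" "v \<in> vcarrier ell1" "w \<in> vcarrier ell1"
  shows "pair f (v + w) = pair f v + pair f w"
proof -
  obtain K where K: "\<And>x. \<bar>f x\<bar> \<le> K" using bounded_rangeE[OF assms(1)] by blast
  show ?thesis
    using infsum_add[OF pair_summable[OF K assms(2)] pair_summable[OF K assms(3)]]
    by (simp add: pair_def distrib_left)
qed

lemma pair_scale_right: "pair f (c *\<^sub>C v) = c * pair f v"
proof -
  have "pair f (c *\<^sub>C v) = (\<Sum>\<^sub>\<infinity>x. c * (complex_of_real (f x) * v x))"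
    by (simp add: pair_def scaleC_fun_def scaleC_complex_def mult.left_commute)
  then show ?thesis by (simp add: infsum_cmult_right' pair_def)
qed

lemma pair_diff_right:
  assumes "bounded (range f)" "v \<in> vcarrier ell1" "w \<in> vcarrier ell1"
  shows "pair f (v - w) = pair f v - pair f w"
proof -
  have "clinear_on (vcarrier ell1) (pair f)"
    using pair_add_right[OF assms(1)] pair_scale_right[of f]
    by (simp add: clinear_on_def scaleC_complex_def del: ell1_sel)
  from clinear_on_diff[OF equivariant_module.subspace[OF ell1_module] this assms(2,3)] show ?thesis .
qed

lemma pair_add_left:
  assumes "bounded (range f)" "bounded (range h)" "v \<in> vcarrier ell1"
  shows "pair (\<lambda>x. f x + h x) v = pair f v + pair h v"
proof -
  obtain K where K: "\<And>x. \<bar>f x\<bar> \<le> K" using bounded_rangeE[OF assms(1)] by blast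
  obtain K' where K': "\<And>x. \<bar>h x\<bar> \<le> K'" using bounded_rangeE[OF assms(2)] by blast
  show ?thesis
    using infsum_add[OF pair_summable[OF K assms(3)] pair_summable[OF K' assms(3)]]
    by (simp add: pair_def distrib_right)
qed

lemma pair_scale_left: "pair (\<lambda>x. c * f x) v = complex_of_real c * pair f v"
  by (simp add: pair_def mult.assoc infsum_cmult_right')

lemma pair_translate: "pair (\<lambda>x. f (g + x)) v = pair f (vact ell1 g v)"
proof -
  have "pair f (vact ell1 g v) = (\<Sum>\<^sub>\<infinity>x. complex_of_real (f (g + (- g + x))) * v (- g + x))"
    by (simp add: pair_def add.assoc[symmetric])
  also have "\<dots> = pair (\<lambda>x. f (g + x)) v"
    unfolding pair_def by (rule infsum_reindex_bij_betw[OF translate_bij, of "\<lambda>x. complex_of_real (f (g + x)) * v x"])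
  finally show ?thesis by simp
qed

definition eval_functional :: "nat \<Rightarrow> nat \<Rightarrow> 'g list \<Rightarrow> 'g list \<Rightarrow> ('g \<Rightarrow> real) \<Rightarrow>
    ('g::{group_add,metric_space}, 'g \<Rightarrow> complex) cochain \<Rightarrow> complex" where
  "eval_functional p q xs ys f = (\<lambda>\<phi>. if \<phi> \<in> points (cochains ell1 p q) then pair f (\<phi> xs ys) else 0)"

lemma eval_functional_bound:
  assumes "\<phi> \<in> points (cochains (ell1 :: ('g::{group_add,metric_space}, 'g \<Rightarrow> complex) xmodule) p q)"
    "\<And>x. \<bar>f x\<bar> \<le> K" "xs \<in> diag_nbhd (real (Suc i)) p" "length ys = Suc q"
  shows "cmod (eval_functional p q xs ys f \<phi>) \<le> K * snorm (cochains ell1 p q) i \<phi>"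
proof -
  have "length xs = Suc p" using assms(3) by (simp add: diag_nbhd_def)
  have "K \<ge> 0" using assms(2)[of undefined] by simp
  have "cmod (eval_functional p q xs ys f \<phi>) \<le> K * vnorm ell1 (\<phi> xs ys)"
    using pair_bound[OF assms(2) cochainD(1)[OF assms(1) \<open>length xs = Suc p\<close> assms(4)]] assms(1)
    by (simp add: eval_functional_def del: ell1_sel)
  also have "\<dots> \<le> K * snorm (cochains ell1 p q) i \<phi>"
    by (intro mult_left_mono snorm_cochains_upper assms \<open>K \<ge> 0\<close>)
  finally show ?thesis .
qed

lemma eval_functional_cdual:
  assumes f: "bounded (range f)" and xs: "xs \<in> diag_nbhd (real (Suc i)) p" and ys: "length ys = Suc q"
  shows "eval_functional p q xs ys f \<in> cdual (cochains (ell1 :: ('g::{group_add,metric_space}, 'g \<Rightarrow> complex) xmodule) p q)"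
proof -
  interpret B: seminormed_space "cochains (ell1 :: ('g, 'g \<Rightarrow> complex) xmodule) p q" by (rule cochain_spaces)
  obtain K where K: "\<And>x. \<bar>f x\<bar> \<le> K" using bounded_rangeE[OF f] by blast
  have l: "length xs = Suc p" using xs by (simp add: diag_nbhd_def)
  have "clinear_on (points (cochains (ell1 :: ('g, 'g \<Rightarrow> complex) xmodule) p q)) (eval_functional p q xs ys f)"
    unfolding clinear_on_def
  proof (intro conjI ballI allI)
    fix \<phi> \<psi> :: "('g, 'g \<Rightarrow> complex) cochain"
    assume p: "\<phi> \<in> points (cochains ell1 p q)" "\<psi> \<in> points (cochains ell1 p q)"
    have "(\<phi> + \<psi>) xs ys = \<phi> xs ys + \<psi> xs ys" by simp
    then have "pair f ((\<phi> + \<psi>) xs ys) = pair f (\<phi> xs ys) + pair f (\<psi> xs ys)"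
      by (simp only: pair_add_right[OF f cochainD(1)[OF p(1) l ys] cochainD(1)[OF p(2) l ys]])
    then show "eval_functional p q xs ys f (\<phi> + \<psi>) = eval_functional p q xs ys f \<phi> + eval_functional p q xs ys f \<psi>"
      using p B.closed(2)[OF p] unfolding eval_functional_def by (simp only: if_True)
  next
    fix c and \<phi> :: "('g, 'g \<Rightarrow> complex) cochain"
    assume p: "\<phi> \<in> points (cochains ell1 p q)"
    have "(c *\<^sub>C \<phi>) xs ys = c *\<^sub>C \<phi> xs ys" by (simp add: scaleC_fun_def)
    then have "pair f ((c *\<^sub>C \<phi>) xs ys) = c * pair f (\<phi> xs ys)" by (simp only: pair_scale_right)
    then show "eval_functional p q xs ys f (c *\<^sub>C \<phi>) = c *\<^sub>C eval_functional p q xs ys f \<phi>"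
      using p B.closed(3)[OF p] unfolding eval_functional_def scaleC_complex_def by (simp only: if_True)
  qed
  moreover have "cmod (eval_functional p q xs ys f \<phi>) \<le> K * snorm (cochains ell1 p q) i \<phi>"
    if "\<phi> \<in> points (cochains ell1 p q)" for \<phi>
    by (rule eval_functional_bound[OF that K xs ys])
  moreover have "eval_functional p q xs ys f \<phi> = 0" if "\<phi> \<notin> points (cochains ell1 p q)" for \<phi>
    using that by (simp add: eval_functional_def)
  ultimately show ?thesis
    unfolding B.cdual_iff by blast
qed

text \<open>Translating \<open>f\<close> changes the evaluation at \<open>(0, 0)\<close> by evaluations of the two boundaries: move
  the first and then the second argument from \<open>g\<close> to \<open>0\<close>.\<close>

lemma eval_functional_translate:
  fixes g :: "'g::{group_add,metric_space}"
  assumes f: "bounded (range f)"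
  shows "eval_functional 0 0 [0] [0] (\<lambda>x. f (g + x)) = eval_functional 0 0 [0] [0] f +
    (transp (cochains ell1 0 0) diffD (eval_functional (Suc 0) 0 [0, g] [g] f) +
     transp (cochains ell1 0 0) (diffd 0) (eval_functional 0 (Suc 0) [0] [0, g] f))"
proof
  fix \<phi> :: "('g, 'g \<Rightarrow> complex) cochain"
  let ?B = "\<lambda>p q. cochains (ell1 :: ('g, 'g \<Rightarrow> complex) xmodule) p q"
  show "eval_functional 0 0 [0] [0] (\<lambda>x. f (g + x)) \<phi> = (eval_functional 0 0 [0] [0] f +
    (transp (?B 0 0) diffD (eval_functional (Suc 0) 0 [0, g] [g] f) +
     transp (?B 0 0) (diffd 0) (eval_functional 0 (Suc 0) [0] [0, g] f))) \<phi>"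
  proof (cases "\<phi> \<in> points (?B 0 0)")
    case True
    have c: "\<phi> [x] [y] \<in> vcarrier ell1" for x y by (rule cochainD(1)[OF True]) auto
    have D: "diffD \<phi> \<in> points (?B (Suc 0) 0)" and d: "diffd 0 \<phi> \<in> points (?B 0 (Suc 0))"
      by (rule bounded_map.maps[OF diffD_bounded[OF ell1_module] True]
          bounded_map.maps[OF diffd_bounded[OF ell1_module] True])+
    have "diffD \<phi> [0, g] [g] = \<phi> [g] [g] - \<phi> [0] [g]" "diffd 0 \<phi> [0] [0, g] = \<phi> [0] [g] - \<phi> [0] [0]"
      by (simp_all add: diffD_def diffd_def omit_def lessThan_Suc scaleC_one scaleC_minus_one)
    moreover have "pair (\<lambda>x. f (g + x)) (\<phi> [0] [0]) = pair f (\<phi> [g] [g])"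
      using cochainD(3)[OF True, of "[0]" "[0]" g] unfolding pair_translate by (simp del: ell1_sel)
    ultimately show ?thesis
      using True D d by (simp add: eval_functional_def transp_def pair_diff_right[OF f c c] del: ell1_sel)
  qed (simp add: eval_functional_def transp_def)
qed

text \<open>Evaluating \<open>\<eta>\<close> at the functionals of the previous lemma is translation invariant, because \<open>\<eta>\<close> kills
  the transposes of both differentials. At the constant function 1 the functional is the transpose under
  \<open>\<pi>\<close> of the evaluation of scalar cochains at \<open>(0, 0)\<close>, whose value at the constant cochain is 1.\<close>

lemma W_cocycle_imp_amenable:
  fixes \<eta> :: "('g::{group_add,metric_space}, 'g \<Rightarrow> complex) W_cochain"
  assumes \<eta>: "\<eta> \<in> bidual (cochains ell1 0 0)"
    and D: "W_map (cochains ell1 0 0) (cochains ell1 (Suc 0) 0) diffD \<eta> = 0"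
    and d: "W_map (cochains ell1 0 0) (cochains ell1 0 (Suc 0)) (diffd 0) \<eta> = 0"
    and one: "W_map (cochains ell1 0 0) (cochains trivial_module 0 0) (push ell1_sum) \<eta> =
      W_incl (cochains trivial_module 0 0) const_one"
  shows "amenable TYPE('g)"
proof -
  let ?B = "\<lambda>p q. cochains (ell1 :: ('g, 'g \<Rightarrow> complex) xmodule) p q"
  let ?C = "cochains (trivial_module :: ('g, complex) xmodule) 0 0"
  interpret B: seminormed_space "?B p q" for p q by (rule cochain_spaces)
  interpret C: seminormed_space ?C by (rule cochain_spaces)
  define E where "E f = eval_functional 0 0 [0] [0::'g] f" for f :: "'g \<Rightarrow> real"
  have diag: "[0::'g] \<in> diag_nbhd (real (Suc i)) 0" for i by (simp add: diag_nbhd_def)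
  have E: "E f \<in> cdual (?B 0 0)" if "bounded (range f)" for f
    unfolding E_def by (rule eval_functional_cdual[OF that diag]) simp
  note lin = B.bidualD[OF \<eta>]
  have E_apply: "E f \<phi> = (if \<phi> \<in> points (?B 0 0) then pair f (\<phi> [0] [0]) else 0)" for f \<phi>
    by (simp add: E_def eval_functional_def)
  have c: "\<phi> [0] [0] \<in> vcarrier ell1" if "\<phi> \<in> points (?B 0 0)" for \<phi>
    by (rule cochainD(1)[OF that]) auto
  have null_D: "\<eta> (transp (?B 0 0) diffD \<beta>) = 0" if "\<beta> \<in> cdual (?B (Suc 0) 0)" for \<beta>
    using fun_cong[OF D, of \<beta>] that by (simp add: W_map_def)
  have null_d: "\<eta> (transp (?B 0 0) (diffd 0) \<beta>) = 0" if "\<beta> \<in> cdual (?B 0 (Suc 0))" for \<beta>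
    using fun_cong[OF d, of \<beta>] that by (simp add: W_map_def)
  obtain C where C: "\<And>\<alpha>. \<alpha> \<in> cdual (?B 0 0) \<Longrightarrow> dual_norm (?B 0 0) 0 \<alpha> \<le> 1 \<Longrightarrow> cmod (\<eta> \<alpha>) \<le> C"
    using \<eta> unfolding B.bidual_iff by blast
  show ?thesis
  proof (rule amenable_if_bounded_invariant_functional[where n = "\<lambda>f. Re (\<eta> (E f))" and C = C])
    fix f h :: "'g \<Rightarrow> real" assume f: "bounded (range f)" and h: "bounded (range h)"
    have "E (\<lambda>x. f x + h x) = E f + E h"
      using pair_add_left[OF f h c] by (auto simp: E_apply fun_eq_iff simp del: ell1_sel)
    then show "Re (\<eta> (E (\<lambda>x. f x + h x))) = Re (\<eta> (E f)) + Re (\<eta> (E h))"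
      using lin(2)[OF E[OF f] E[OF h]] by simp
  next
    fix a and f :: "'g \<Rightarrow> real" assume f: "bounded (range f)"
    have "E (\<lambda>x. a * f x) = complex_of_real a *\<^sub>C E f"
      by (auto simp: E_apply fun_eq_iff pair_scale_left scaleC_fun_def scaleC_complex_def)
    then show "Re (\<eta> (E (\<lambda>x. a * f x))) = a * Re (\<eta> (E f))"
      using lin(3)[OF E[OF f], of "complex_of_real a"] by simp
  next
    fix f :: "'g \<Rightarrow> real" assume f: "\<And>x. \<bar>f x\<bar> \<le> 1"
    have "cmod (\<eta> (E f)) \<le> C"
    proof (rule C)
      show "E f \<in> cdual (?B 0 0)" using f by (intro E) (auto simp: bounded_iff)
      show "dual_norm (?B 0 0) 0 (E f) \<le> 1"
        unfolding B.dual_norm_le_1_iff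
      proof (intro ballI impI)
        fix \<phi> assume "\<phi> \<in> points (?B 0 0)" "snorm (?B 0 0) 0 \<phi> \<le> 1"
        then show "cmod (E f \<phi>) \<le> 1"
          using eval_functional_bound[where f = f and K = 1, OF _ f diag[of 0], of \<phi> 0 "[0]"]
          unfolding E_def by simp
      qed
    qed
    then show "Re (\<eta> (E f)) \<le> C" using complex_Re_le_cmod order_trans by blast
  next
    define ev where "ev = (\<lambda>\<psi>. if \<psi> \<in> points ?C then \<psi> [0] [0] else 0)"
    have "cmod (ev \<psi>) \<le> 1 * snorm ?C 0 \<psi>" if "\<psi> \<in> points ?C" for \<psi>
      using snorm_cochains_upper[OF that diag[of 0], of "[0]"] that by (simp add: ev_def)
    moreover have "clinear_on (points ?C) ev"
      using C.closed by (simp add: clinear_on_def ev_def scaleC_fun_def)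
    moreover have "ev \<psi> = 0" if "\<psi> \<notin> points ?C" for \<psi> using that by (simp add: ev_def)
    ultimately have ev: "ev \<in> cdual ?C" unfolding C.cdual_iff by blast
    have "transp (?B 0 0) (push ell1_sum) ev = E (\<lambda>x. 1)"
      using bounded_map.maps[OF push_sum_bounded]
      by (auto simp: transp_def ev_def E_apply pair_def push_def ell1_sum_def fun_eq_iff)
    then have "\<eta> (E (\<lambda>x. 1)) = W_map (?B 0 0) ?C (push ell1_sum) \<eta> ev"
      using ev by (simp add: W_map_def)
    also have "\<dots> = 1"
      unfolding one using ev const_one_cochain by (simp add: W_incl_def ev_def const_one_def)
    finally show "Re (\<eta> (E (\<lambda>x. 1))) = 1" by simp
  next
    fix g :: 'g and f :: "'g \<Rightarrow> real" assume f: "bounded (range f)"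
    obtain i where "dist 0 g \<le> real i" using real_arch_simple by blast
    then have i: "dist 0 g \<le> real (Suc i)" by simp
    have 1: "eval_functional (Suc 0) 0 [0, g] [g] f \<in> cdual (?B (Suc 0) 0)"
      by (rule eval_functional_cdual[OF f, of _ i]) (use i in \<open>auto simp: diag_nbhd_def dist_commute\<close>)
    have 2: "eval_functional 0 (Suc 0) [0] [0, g] f \<in> cdual (?B 0 (Suc 0))"
      by (rule eval_functional_cdual[OF f diag]) simp
    note t1 = bounded_map.transp_cdual[OF diffD_bounded[OF ell1_module] 1]
    note t2 = bounded_map.transp_cdual[OF diffd_bounded[OF ell1_module] 2]
    have "\<eta> (E (\<lambda>x. f (g + x))) = \<eta> (E f)"
      unfolding E_def eval_functional_translate[OF f]
        lin(2)[OF E[OF f, unfolded E_def] csubspaceD(2)[OF B.cdual_subspace t1 t2]] lin(2)[OF t1 t2]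
        null_D[OF 1] null_d[OF 2] by simp
    then show "Re (\<eta> (E (\<lambda>x. f (g + x)))) = Re (\<eta> (E f))" by simp
  qed
qed

text \<open>Generalized limits annihilate null sequences, so that a sequence that is a cocycle up to null sequences
  has a limit in the bidual that is a cocycle.\<close>

lemma Q_cocycle_imp_W_cocycle:
  assumes u: "u \<in> bounded_seqs (cochains (ell1 :: ('g::{group_add,metric_space}, 'g \<Rightarrow> complex) xmodule) 0 0)"
    and D: "(\<lambda>n. diffD (u n)) \<in> null_seqs (cochains ell1 (Suc 0) 0)"
    and d: "(\<lambda>n. diffd 0 (u n)) \<in> null_seqs (cochains ell1 0 (Suc 0))"
    and one: "(\<lambda>n. push ell1_sum (u n) - const_one) \<in> null_seqs (cochains trivial_module 0 0)"
  shows "\<exists>\<eta>\<in>bidual (cochains (ell1 :: ('g, 'g \<Rightarrow> complex) xmodule) 0 0).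
    W_map (cochains ell1 0 0) (cochains ell1 (Suc 0) 0) diffD \<eta> = 0 \<and>
    W_map (cochains ell1 0 0) (cochains ell1 0 (Suc 0)) (diffd 0) \<eta> = 0 \<and>
    W_map (cochains ell1 0 0) (cochains trivial_module 0 0) (push ell1_sum) \<eta> =
      W_incl (cochains trivial_module 0 0) const_one"
proof -
  let ?B = "\<lambda>p q. cochains (ell1 :: ('g, 'g \<Rightarrow> complex) xmodule) p q"
  interpret r: bounded_map "?B p q" "cochains trivial_module p q" "push ell1_sum" for p q by (rule push_sum_bounded)
  obtain L where L: "generalized_limit L" using generalized_limit_exists by blast
  have zero: "bidual_limit L (?B p q) w = 0" if "w \<in> null_seqs (?B p q)" for p q w
  proof -
    have "bidual_limit L (?B p q) w = W_incl (?B p q) 0"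
      by (rule r.E.bidual_limit_eq_incl[OF L r.E.closed(1)])
         (use that in \<open>auto simp: null_seqs_def\<close>)
    then show ?thesis by (simp only: r.E.W_incl_zero)
  qed
  have up: "u n \<in> points (?B 0 0)" for n by (rule r.E.bounded_seqs_points[OF u])
  show ?thesis
  proof (intro bexI[of _ "bidual_limit L (?B 0 0) u"] conjI)
    show "bidual_limit L (?B 0 0) u \<in> bidual (?B 0 0)" by (rule r.E.bidual_limit_bidual[OF L u])
    show "W_map (?B 0 0) (?B (Suc 0) 0) diffD (bidual_limit L (?B 0 0) u) = 0"
      unfolding bounded_map.W_map_bidual_limit[OF diffD_bounded[OF ell1_module] u] by (rule zero[OF D])
    show "W_map (?B 0 0) (?B 0 (Suc 0)) (diffd 0) (bidual_limit L (?B 0 0) u) = 0"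
      unfolding bounded_map.W_map_bidual_limit[OF diffd_bounded[OF ell1_module] u] by (rule zero[OF d])
    show "W_map (?B 0 0) (cochains trivial_module 0 0) (push ell1_sum) (bidual_limit L (?B 0 0) u) =
        W_incl (cochains trivial_module 0 0) const_one"
      unfolding r.W_map_bidual_limit[OF u]
      by (rule r.F.bidual_limit_eq_incl[OF L const_one_cochain r.maps[OF up] one])
  qed
qed

section \<open>Amenability and the vanishing of the Johnson class\<close>

theorem theorem11:
  assumes left_invariant:
      "\<And>g x y :: 'g::{group_add,countable,discrete_topology,metric_space}.
         dist (g + x) (g + y) = dist x y"
    and proper: "\<And>(x::'g) r. compact (cball x r)"
  shows "(amenable TYPE('g) \<longleftrightarrow>
            (one_Q :: (nat \<Rightarrow> ('g, complex) Q_cochain) set) \<in> pi_star_Q 0 ` carrier (H_Q 0 ell1)) \<and>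
         ((one_Q :: (nat \<Rightarrow> ('g, complex) Q_cochain) set) \<in> pi_star_Q 0 ` carrier (H_Q 0 ell1) \<longleftrightarrow>
            connecting_Q 0 (one_Q :: (nat \<Rightarrow> ('g, complex) Q_cochain) set) = \<one>\<^bsub>H_Q 1 ell1_0\<^esub>) \<and>
         (connecting_Q 0 (one_Q :: (nat \<Rightarrow> ('g, complex) Q_cochain) set) = \<one>\<^bsub>H_Q 1 ell1_0\<^esub> \<longleftrightarrow>
            connecting_W 0 (one_W :: (nat \<Rightarrow> ('g, complex) W_cochain) set) = \<one>\<^bsub>H_W 1 ell1_0\<^esub>)"
proof -
  let ?B = "\<lambda>p q. cochains (ell1 :: ('g, 'g \<Rightarrow> complex) xmodule) p q"
  let ?C = "cochains (trivial_module :: ('g, complex) xmodule) 0 0"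
  define cocycle_Q where "cocycle_Q \<longleftrightarrow> (\<exists>y\<in>carrier (Q_completion (?B 0 0)).
    Q_map (?B (Suc 0) 0) diffD y = \<one>\<^bsub>Q_completion (?B (Suc 0) 0)\<^esub> \<and>
    Q_map (?B 0 (Suc 0)) (diffd 0) y = \<one>\<^bsub>Q_completion (?B 0 (Suc 0))\<^esub> \<and>
    Q_map ?C (push ell1_sum) y = Q_incl ?C const_one)"
  define cocycle_W where "cocycle_W \<longleftrightarrow> (\<exists>y\<in>bidual (?B 0 0).
    W_map (?B 0 0) (?B (Suc 0) 0) diffD y = 0 \<and> W_map (?B 0 0) (?B 0 (Suc 0)) (diffd 0) y = 0 \<and>
    W_map (?B 0 0) ?C (push ell1_sum) y = W_incl ?C const_one)"
  have one_Q: "one_Q = cohomology_class (Q_bicomplex trivial_module) 0 (cochain0 (Q_incl ?C const_one))"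
    by (simp only: one_Q_def cochain0_def)
  have one_W: "one_W = cohomology_class (W_bicomplex trivial_module) 0 (cochain0 (W_incl ?C const_one))"
    by (simp only: one_W_def cochain0_def)
  have 2: "(one_Q :: (nat \<Rightarrow> ('g, complex) Q_cochain) set) \<in> pi_star_Q 0 ` carrier (H_Q 0 ell1) \<longleftrightarrow> cocycle_Q"
    using connecting_lift.in_image_iff[OF Q_connecting_lift]
    unfolding one_Q pi_star_Q_def cocycle_Q_def Q_bicomplex_sel Q_bimap_def .
  have 3: "connecting_Q 0 (one_Q :: (nat \<Rightarrow> ('g, complex) Q_cochain) set) = \<one>\<^bsub>H_Q 1 ell1_0\<^esub> \<longleftrightarrow> cocycle_Q"
    using connecting_lift.connecting_trivial_iff[OF Q_connecting_lift]
    unfolding one_Q connecting_Q_def cocycle_Q_def Q_bicomplex_sel Q_bimap_def One_nat_def .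
  have 4: "connecting_W 0 (one_W :: (nat \<Rightarrow> ('g, complex) W_cochain) set) = \<one>\<^bsub>H_W 1 ell1_0\<^esub> \<longleftrightarrow> cocycle_W"
    using connecting_lift.connecting_trivial_iff[OF W_connecting_lift]
    unfolding one_W connecting_W_def cocycle_W_def W_bicomplex_sel W_bimap_def W_completion_sel One_nat_def .
  interpret B: seminormed_space "?B p q" for p q by (rule cochain_spaces)
  interpret C: seminormed_space ?C by (rule cochain_spaces)
  note classes = bounded_map.Q_map_class[OF diffD_bounded[OF ell1_module]]
    bounded_map.Q_map_class[OF diffd_bounded[OF ell1_module]] bounded_map.Q_map_class[OF push_sum_bounded]
  have cocycle_Q: "cocycle_Q \<longleftrightarrow> (\<exists>u\<in>bounded_seqs (?B 0 0).
      (\<lambda>n. diffD (u n)) \<in> null_seqs (?B (Suc 0) 0) \<and> (\<lambda>n. diffd 0 (u n)) \<in> null_seqs (?B 0 (Suc 0)) \<and>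
      (\<lambda>n. push ell1_sum (u n) - const_one) \<in> null_seqs ?C)"
    by (simp add: cocycle_Q_def B.carrier_Q_completion classes Q_incl_eq B.Q_class_eq_one_iff C.Q_class_eq_iff
        fun_diff_def cong: bex_cong)
  have "amenable TYPE('g) \<Longrightarrow> cocycle_Q"
  proof -
    assume "amenable TYPE('g)"
    from amenable_imp_Q_cocycle[OF this left_invariant proper]
    obtain u where u: "u \<in> bounded_seqs (?B 0 0)" "(\<lambda>n. diffD (u n)) \<in> null_seqs (?B (Suc 0) 0)"
      "(\<lambda>n. diffd 0 (u n)) \<in> null_seqs (?B 0 (Suc 0))" "\<And>n. push ell1_sum (u n) = const_one" by blast
    have "(\<lambda>n. push ell1_sum (u n) - const_one) \<in> null_seqs ?C"
      using C.null_seqs_closed(1) u(4) by (simp add: zero_fun_def)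
    with u show cocycle_Q unfolding cocycle_Q by blast
  qed
  moreover have "cocycle_Q \<Longrightarrow> cocycle_W"
    unfolding cocycle_Q cocycle_W_def using Q_cocycle_imp_W_cocycle by blast
  moreover have "cocycle_W \<Longrightarrow> amenable TYPE('g)"
    unfolding cocycle_W_def using W_cocycle_imp_amenable by blast
  ultimately show ?thesis unfolding 2 3 4 by blast
qed

end
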